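(* Let $K$ be a commutative ring, $\delta\in K$, $l\ge1$, $n\ge0$, $\mathbf m\in\gamma^{l,n}$ and $\underline\lambda\in\Lambda_{\mathbf m}$. There is a contravariant form $(-,-)_e$ on $\mathcal S^n_{\underline\lambda}=P^{\mathbf m}_na^{\mathbf m}\cdot e_{\underline\lambda}$, i.e. a $K$-bilinear form with $(u,gv)_e=(g^{op}u,v)_e$ for all $g\in P^l_n$, $u,v\in \mathcal S^n_{\underline\lambda}$, defined by $$(xa^{\mathbf m}e_{\underline\lambda})^{op}\;ya^{\mathbf m}e_{\underline\lambda}=(e_{\underline\lambda})^{op}\,(a^{\mathbf m}x^{op}ya^{\mathbf m})\,e_{\underline\lambda}=(x,y)_e\;a^{\mathbf m}e_{\underline\lambda}$$ (computed in $P^{\mathbf m}_n$, for $x,y\in P^{\mathbf m}_n$), where $(x,y)_e\in K$ stands for $(xa^{\mathbf m}e_{\underline\lambda},ya^{\mathbf m}e_{\underline\lambda})_e$.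
   Context: Partitions and products: for $n,m\ge 0$ let $\mathsf P_{n,m}$ be the set of set partitions of the disjoint union $\{1,\dots,n\}\cup\{1',\dots,m'\}$. For $p\in\mathsf P_{n,m}$, $p'\in\mathsf P_{m,r}$: rename each $i'$ of $p$ and each $i\in\{1,\dots,m\}$ of $p'$ as $i''$; take the finest partition of $\{1,\dots,n\}\cup\{1'',\dots,m''\}\cup\{1',\dots,r'\}$ such that every part of $p$ and of $p'$ is contained in a part; let $c$ be the number of its parts contained in $\{1'',\dots,m''\}$; delete all $i''$ (and empty parts) to get $q$; then $pp'=\delta^cq$. $p\otimes p'$ is side-by-side juxtaposition ($p'$ to the right). A part $s$ is $l$-tone if $|s\cap\{1,\dots,n\}|\equiv|s\cap\{1',\dots,m'\}|$ mod $l$; a partition is $l$-tone if all its parts are. The tonal partition algebra $P^l_n$ is the $K$-algebra with basis the set $\mathsf P^l_n$ of $l$-tone partitions in $\mathsf P_{n,n}$. The involutive antiautomorphism $op$ of $P^l_n$ is the $K$-linear map exchanging $i\leftrightarrow i'$ in each partition. Propagating vector: a part is propagating if it meets both rows. For $p\in\mathsf P^l_n$ let $\#^i(p)$ ($1\le i\le l$) be the number of propagating parts $s$ with $|s\cap\{1,\dots,n\}|\equiv i$ mod $l$, and $\#^-(p)=(\#^1(p),\dots,\#^l(p))$. Index poset: for $\mathbf m=(m_1,\dots,m_l)$ let $r_{\mathbf m}=\sum_i i\,m_i$; $\gamma^{l,n}=\{\mathbf m\in\mathbb N_0^l:(n-r_{\mathbf m})/l\in\mathbb N_0\}$. With $\epsilon_i$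 the standard basis of $\mathbb Z^l$, indices read mod $l$ in $\{1,\dots,l\}$, let $v_{ij}=\epsilon_{i+j}-\epsilon_i-\epsilon_j$ ($1\le i\le j\le l$); $\mathbf m\ge\mathbf m'$ iff $\mathbf m'-\mathbf m$ is a nonnegative integral combination of the $v_{ij}$. Elements and quotients: $b^i\in\mathsf P_{i,i}$ has the single part $\{1,\dots,i,1',\dots,i'\}$; $w\in\mathsf P_{l,0}$, $w^\star\in\mathsf P_{0,l}$ are the one-part partitions; $a^{\mathbf m}=(b^l)^{\otimes m_l}\otimes\cdots\otimes(b^1)^{\otimes m_1}\otimes(ww^\star)^{\otimes(n-r_{\mathbf m})/l}$ (so $(a^{\mathbf m})^{op}=a^{\mathbf m}$). $I^{<\mathbf m}=\sum_{\mathbf m'<\mathbf m}P^l_na^{\mathbf m'}P^l_n$ (stable under $op$) and $P^{\mathbf m}_n=P^l_n/I^{<\mathbf m}$, with induced $op$. Standard modules: let $S_{\mathbf m}=S_{m_1}\times\cdots\times S_{m_l}$. The left ideal $P^{\mathbf m}_na^{\mathbf m}$ has basis the classes of those $p\in\mathsf P^l_n$ with $\#^-(p)=\mathbf m$ and with the same restriction to the bottom row, and the same non-propagating bottom parts, as $a^{\mathbf m}$. It is a free right $KS_{\mathbf m}$-module by permuting, for each $i$, the $m_i$ bottom blocks of size $i$ attached to propagating parts: if $B_{i,1},\dots,B_{i,m_i}$ are these blocks from left to right, then in $p\cdot\sigma$ the propagating part of $p$ with bottom block $B_{i,\sigma_i(j)}$ is given the bottom block $B_{i,j}$. Symmetrically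 (applying $op$), $a^{\mathbf m}P^{\mathbf m}_n$ is a left $KS_{\mathbf m}$-module with $\sigma\cdot x=(x^{op}\cdot\sigma^{-1})^{op}$. Expressions such as $xa^{\mathbf m}e$ and $e^{op}a^{\mathbf m}x$ are understood via these actions, $op$ on $KS_{\mathbf m}$ being $\sigma\mapsto\sigma^{-1}$. $\Lambda_{\mathbf m}$ is the set of $l$-tuples of integer partitions $(\lambda^1,\dots,\lambda^l)$ with $\lambda^i\vdash m_i$. For each $\underline\lambda\in\Lambda_{\mathbf m}$, $e_{\underline\lambda}$ is a chosen primitive preidempotent of $\mathbb ZS_{\mathbf m}$ (mapped to $KS_{\mathbf m}$) with $e_{\underline\lambda}^{op}=e_{\underline\lambda}$ such that $KS_{\mathbf m}e_{\underline\lambda}$ is the Specht module of $S_{\mathbf m}$ labelled by $\underline\lambda$ (outer product of Specht modules of the factors); primitivity means that for every $x\in KS_{\mathbf m}$ there is $c_x\in K$ with $e_{\underline\lambda}xe_{\underline\lambda}=c_xe_{\underline\lambda}$, and it is understood that $ce_{\underline\lambda}=0$ with $c\in K$ forces $c=0$, so that $c_x$ is unique. The standard module is $\mathcal S^n_{\underline\lambda}=P^{\mathbf m}_na^{\mathbf m}\cdot e_{\underline\lambda}$. *)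

theory Defs
  imports
    "HOL-Algebra.QuotRing"
    "HOL-Algebra.Module"
    "HOL-Library.Disjoint_Sets"
    "HOL-Combinatorics.Permutations"
    "HOL-Number_Theory.Cong"
begin

section \<open>Functions with prescribed support, linear spans, bilinear extension\<close>

text \<open>The free \<open>K\<close>-module on a finite set \<open>A\<close> consists of the functions with support in \<open>A\<close>.\<close>

definition supported :: "'a set \<Rightarrow> ('a \<Rightarrow> 'k::zero) set" where
  "supported A = {f. \<forall>a. a \<notin> A \<longrightarrow> f a = 0}"

definition basis_vec :: "'a \<Rightarrow> 'a \<Rightarrow> 'k::zero_neq_one" where
  "basis_vec a = (\<lambda>b. if b = a then 1 else 0)"

definition lin_span :: "('a \<Rightarrow> 'k::comm_ring_1) set \<Rightarrow> ('a \<Rightarrow> 'k) set" where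
  "lin_span G = {(\<lambda>a. \<Sum>f\<in>F. c f * f a) | F c. finite F \<and> F \<subseteq> G}"

text \<open>The bilinear map sending the pair of basis elements \<open>(a, b)\<close> to \<open>c a b\<close> times the
  basis element \<open>h a b\<close>.\<close>

definition bilin ::
  "'a set \<Rightarrow> 'b set \<Rightarrow> ('a \<Rightarrow> 'b \<Rightarrow> 'k) \<Rightarrow> ('a \<Rightarrow> 'b \<Rightarrow> 'c) \<Rightarrow>
   ('a \<Rightarrow> 'k::comm_ring_1) \<Rightarrow> ('b \<Rightarrow> 'k) \<Rightarrow> 'c \<Rightarrow> 'k" where
  "bilin A B c h f g =
     (\<lambda>r. \<Sum>a\<in>A. \<Sum>b\<in>B. if h a b = r then c a b * f a * g b else 0)"


section \<open>Set partitions and their products\<close>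

text \<open>\<open>Up i\<close>, \<open>Dn i\<close> and \<open>Mid i\<close> stand for the symbols $i$, $i'$ and $i''$ respectively.\<close>

datatype vertex = Up nat | Mid nat | Dn nat

type_synonym diagram = "vertex set set"

definition diagrams :: "nat \<Rightarrow> nat \<Rightarrow> diagram set" where
  "diagrams n m = {p. partition_on (Up ` {1..n} \<union> Dn ` {1..m}) p}"

primrec dn_to_mid :: "vertex \<Rightarrow> vertex" where
  "dn_to_mid (Up i) = Up i"
| "dn_to_mid (Mid i) = Mid i"
| "dn_to_mid (Dn i) = Mid i"

primrec up_to_mid :: "vertex \<Rightarrow> vertex" where
  "up_to_mid (Up i) = Mid i"
| "up_to_mid (Mid i) = Mid i"
| "up_to_mid (Dn i) = Dn i"

definition finest_containing :: "vertex set \<Rightarrow> vertex set set \<Rightarrow> diagram" where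
  "finest_containing V G =
     (THE r. partition_on V r \<and> (\<forall>s\<in>G. \<exists>t\<in>r. s \<subseteq> t) \<and>
        (\<forall>r'. partition_on V r' \<and> (\<forall>s\<in>G. \<exists>t\<in>r'. s \<subseteq> t) \<longrightarrow> refines V r r'))"

definition stack :: "nat \<Rightarrow> nat \<Rightarrow> nat \<Rightarrow> diagram \<Rightarrow> diagram \<Rightarrow> diagram" where
  "stack n m r p p' =
     finest_containing (Up ` {1..n} \<union> Mid ` {1..m} \<union> Dn ` {1..r})
       ((`) dn_to_mid ` p \<union> (`) up_to_mid ` p')"

text \<open>For \<open>p\<close> in \<open>diagrams n m\<close> and \<open>p'\<close> in \<open>diagrams m r\<close>, the product \<open>p p'\<close> is
  \<open>\<delta> ^ loops n m r p p'\<close> times \<open>compose_diag n m r p p'\<close>.\<close>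

definition loops :: "nat \<Rightarrow> nat \<Rightarrow> nat \<Rightarrow> diagram \<Rightarrow> diagram \<Rightarrow> nat" where
  "loops n m r p p' = card {s \<in> stack n m r p p'. s \<subseteq> Mid ` {1..m}}"

definition compose_diag :: "nat \<Rightarrow> nat \<Rightarrow> nat \<Rightarrow> diagram \<Rightarrow> diagram \<Rightarrow> diagram" where
  "compose_diag n m r p p' = (\<lambda>s. s - range Mid) ` stack n m r p p' - {{}}"

definition id_diag :: "nat \<Rightarrow> diagram" where
  "id_diag n = (\<lambda>i. {Up i, Dn i}) ` {1..n}"

primrec shift :: "nat \<Rightarrow> nat \<Rightarrow> vertex \<Rightarrow> vertex" where
  "shift n m (Up i) = Up (n + i)"
| "shift n m (Mid i) = Mid i"
| "shift n m (Dn i) = Dn (m + i)"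

definition tensor :: "nat \<Rightarrow> nat \<Rightarrow> diagram \<Rightarrow> diagram \<Rightarrow> diagram" where
  "tensor n m p p' = p \<union> (`) (shift n m) ` p'"

text \<open>Juxtaposition, from left to right, of a list of pairs \<open>(k, p)\<close> with \<open>p\<close> in
  \<open>diagrams k k\<close>.\<close>

primrec tensor_list :: "(nat \<times> diagram) list \<Rightarrow> diagram" where
  "tensor_list [] = {}"
| "tensor_list (d # ds) = tensor (fst d) (fst d) (snd d) (tensor_list ds)"

primrec flip_vertex :: "vertex \<Rightarrow> vertex" where
  "flip_vertex (Up i) = Dn i"
| "flip_vertex (Mid i) = Mid i"
| "flip_vertex (Dn i) = Up i"

definition flip_diag :: "diagram \<Rightarrow> diagram" where
  "flip_diag p = (`) flip_vertex ` p"


section \<open>The tonal partition algebra\<close>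

definition tonal_diagrams :: "nat \<Rightarrow> nat \<Rightarrow> diagram set" where
  "tonal_diagrams l n =
     {p \<in> diagrams n n. \<forall>s\<in>p. [card (s \<inter> range Up) = card (s \<inter> range Dn)] (mod l)}"

definition tonal_algebra ::
  "nat \<Rightarrow> nat \<Rightarrow> 'k::comm_ring_1 \<Rightarrow> ('k, diagram \<Rightarrow> 'k) module" where
  "tonal_algebra l n \<delta> =
     \<lparr>carrier = supported (tonal_diagrams l n),
      monoid.mult = bilin (tonal_diagrams l n) (tonal_diagrams l n)
        (\<lambda>p q. \<delta> ^ loops n n n p q) (compose_diag n n n),
      one = basis_vec (id_diag n),
      ring.zero = (\<lambda>_. 0),
      add = (\<lambda>f g p. f p + g p),
      smult = (\<lambda>c f p. c * f p)\<rparr>"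

text \<open>The linear extension of \<^const>\<open>flip_diag\<close>, using that it is an involution.\<close>

definition alg_op :: "(diagram \<Rightarrow> 'k) \<Rightarrow> diagram \<Rightarrow> 'k" where
  "alg_op f = (\<lambda>p. f (flip_diag p))"


section \<open>Propagating vectors and the index poset\<close>

text \<open>An \<open>l\<close>-tuple $(m_1,\dots,m_l)$ of natural numbers is a function on all of \<open>nat\<close> that
  vanishes outside \<open>{1..l}\<close>.\<close>

definition propagating :: "vertex set \<Rightarrow> bool" where
  "propagating s \<longleftrightarrow> s \<inter> range Up \<noteq> {} \<and> s \<inter> range Dn \<noteq> {}"

definition prop_vector :: "nat \<Rightarrow> diagram \<Rightarrow> nat \<Rightarrow> nat" where
  "prop_vector l p i =
     (if i \<in> {1..l}
      then card {s \<in> p. propagating s \<and> [card (s \<inter> range Up) = i] (mod l)} else 0)"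

definition rank_vec :: "nat \<Rightarrow> (nat \<Rightarrow> nat) \<Rightarrow> nat" where
  "rank_vec l m = (\<Sum>i\<in>{1..l}. i * m i)"

definition index_set :: "nat \<Rightarrow> nat \<Rightarrow> (nat \<Rightarrow> nat) set" where
  "index_set l n =
     {m. (\<forall>i. i \<notin> {1..l} \<longrightarrow> m i = 0) \<and> rank_vec l m \<le> n \<and> l dvd n - rank_vec l m}"

definition std_vec :: "nat \<Rightarrow> nat \<Rightarrow> nat \<Rightarrow> int" where
  "std_vec l i k = (if [k = i] (mod l) then 1 else 0)"

text \<open>The argument \<open>k\<close> runs over \<open>{1..l}\<close>, whereas the index \<open>i\<close> of the standard basis
  vector is read modulo \<open>l\<close>.\<close>

definition fusion_vec :: "nat \<Rightarrow> nat \<Rightarrow> nat \<Rightarrow> nat \<Rightarrow> int" where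
  "fusion_vec l i j k = std_vec l (i + j) k - std_vec l i k - std_vec l j k"

definition index_le :: "nat \<Rightarrow> (nat \<Rightarrow> nat) \<Rightarrow> (nat \<Rightarrow> nat) \<Rightarrow> bool" where
  "index_le l m' m \<longleftrightarrow>
     (\<exists>c :: nat \<Rightarrow> nat \<Rightarrow> nat. \<forall>k\<in>{1..l}.
        int (m' k) - int (m k) = (\<Sum>j\<in>{1..l}. \<Sum>i\<in>{1..j}. int (c i j) * fusion_vec l i j k))"

definition index_less :: "nat \<Rightarrow> (nat \<Rightarrow> nat) \<Rightarrow> (nat \<Rightarrow> nat) \<Rightarrow> bool" where
  "index_less l m' m \<longleftrightarrow> index_le l m' m \<and> m' \<noteq> m"


section \<open>The elements \<open>a\<^sup>m\<close> and the quotient algebras\<close>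

definition b_diag :: "nat \<Rightarrow> diagram" where
  "b_diag i = {Up ` {1..i} \<union> Dn ` {1..i}}"

definition w_diag :: "nat \<Rightarrow> diagram" where
  "w_diag l = {Up ` {1..l}}"

definition w_star_diag :: "nat \<Rightarrow> diagram" where
  "w_star_diag l = {Dn ` {1..l}}"

definition a_diag :: "nat \<Rightarrow> nat \<Rightarrow> (nat \<Rightarrow> nat) \<Rightarrow> diagram" where
  "a_diag l n m = tensor_list
     (concat (map (\<lambda>i. replicate (m i) (i, b_diag i)) (rev [1..<Suc l])) @
      replicate ((n - rank_vec l m) div l)
        (l, compose_diag l 0 l (w_diag l) (w_star_diag l)))"

definition ideal_below ::
  "nat \<Rightarrow> nat \<Rightarrow> 'k::comm_ring_1 \<Rightarrow> (nat \<Rightarrow> nat) \<Rightarrow> (diagram \<Rightarrow> 'k) set" where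
  "ideal_below l n \<delta> m =
     lin_span {x \<otimes>\<^bsub>tonal_algebra l n \<delta>\<^esub> basis_vec (a_diag l n m') \<otimes>\<^bsub>tonal_algebra l n \<delta>\<^esub> y | x y m'.
       x \<in> carrier (tonal_algebra l n \<delta>) \<and> y \<in> carrier (tonal_algebra l n \<delta>) \<and>
       m' \<in> index_set l n \<and> index_less l m' m}"

text \<open>The library quotient ring, made into an algebra by \<open>c \<odot> (I +> x) = I +> c \<odot> x\<close>.\<close>

definition quotient_algebra :: "('k, 'a) module \<Rightarrow> 'a set \<Rightarrow> ('k, 'a set) module" where
  "quotient_algebra A I =
     ring.extend (A Quot I)
       (module.fields (\<lambda>c X. I <+>\<^bsub>A\<^esub> ((\<lambda>x. c \<odot>\<^bsub>A\<^esub> x) ` X)))"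

definition quot_tonal ::
  "nat \<Rightarrow> nat \<Rightarrow> 'k::comm_ring_1 \<Rightarrow> (nat \<Rightarrow> nat) \<Rightarrow> ('k, (diagram \<Rightarrow> 'k) set) module" where
  "quot_tonal l n \<delta> m = quotient_algebra (tonal_algebra l n \<delta>) (ideal_below l n \<delta> m)"

definition quot_class ::
  "nat \<Rightarrow> nat \<Rightarrow> 'k::comm_ring_1 \<Rightarrow> (nat \<Rightarrow> nat) \<Rightarrow> (diagram \<Rightarrow> 'k) \<Rightarrow> (diagram \<Rightarrow> 'k) set" where
  "quot_class l n \<delta> m g = ideal_below l n \<delta> m +>\<^bsub>tonal_algebra l n \<delta>\<^esub> g"

definition quot_op :: "(diagram \<Rightarrow> 'k) set \<Rightarrow> (diagram \<Rightarrow> 'k) set" where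
  "quot_op X = alg_op ` X"

definition a_elem ::
  "nat \<Rightarrow> nat \<Rightarrow> 'k::comm_ring_1 \<Rightarrow> (nat \<Rightarrow> nat) \<Rightarrow> (diagram \<Rightarrow> 'k) set" where
  "a_elem l n \<delta> m = quot_class l n \<delta> m (basis_vec (a_diag l n m))"


section \<open>The groups \<open>S\<^sub>m\<close> and their group algebras\<close>

text \<open>An element of $S_{m_1}\times\cdots\times S_{m_l}$ is a family \<open>\<sigma>\<close> of permutations;
  outside \<open>{1..l}\<close>, where \<open>m\<close> vanishes, \<open>\<sigma> i\<close> is necessarily the identity.\<close>

definition sym_prod :: "(nat \<Rightarrow> nat) \<Rightarrow> (nat \<Rightarrow> nat \<Rightarrow> nat) set" where
  "sym_prod m = {\<sigma>. \<forall>i. \<sigma> i permutes {1..m i}}"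

definition galg_mult ::
  "(nat \<Rightarrow> nat) \<Rightarrow> ((nat \<Rightarrow> nat \<Rightarrow> nat) \<Rightarrow> 'k::comm_ring_1) \<Rightarrow>
   ((nat \<Rightarrow> nat \<Rightarrow> nat) \<Rightarrow> 'k) \<Rightarrow> (nat \<Rightarrow> nat \<Rightarrow> nat) \<Rightarrow> 'k" where
  "galg_mult m = bilin (sym_prod m) (sym_prod m) (\<lambda>_ _. 1) (\<lambda>\<sigma> \<tau> i. \<sigma> i \<circ> \<tau> i)"

definition galg_op :: "((nat \<Rightarrow> nat \<Rightarrow> nat) \<Rightarrow> 'k) \<Rightarrow> (nat \<Rightarrow> nat \<Rightarrow> nat) \<Rightarrow> 'k" where
  "galg_op x = (\<lambda>\<sigma>. x (\<lambda>i. inv_into UNIV (\<sigma> i)))"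

definition galg_of_int ::
  "((nat \<Rightarrow> nat \<Rightarrow> nat) \<Rightarrow> int) \<Rightarrow> (nat \<Rightarrow> nat \<Rightarrow> nat) \<Rightarrow> 'k::comm_ring_1" where
  "galg_of_int x = (\<lambda>\<sigma>. of_int (x \<sigma>))"


section \<open>The actions of \<open>KS\<^sub>m\<close> on \<open>P\<^sup>m\<^sub>n a\<^sup>m\<close> and \<open>a\<^sup>m P\<^sup>m\<^sub>n\<close>\<close>

text \<open>The diagrams whose classes form the basis of \<open>P\<^sup>m\<^sub>n a\<^sup>m\<close>.\<close>

definition bottom_restriction :: "diagram \<Rightarrow> diagram" where
  "bottom_restriction p = (\<lambda>s. s \<inter> range Dn) ` p - {{}}"

definition nonprop_bottom :: "diagram \<Rightarrow> diagram" where
  "nonprop_bottom p = {s \<in> p. s \<subseteq> range Dn}"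

definition std_diagrams :: "nat \<Rightarrow> nat \<Rightarrow> (nat \<Rightarrow> nat) \<Rightarrow> diagram set" where
  "std_diagrams l n m =
     {p \<in> tonal_diagrams l n. prop_vector l p = m \<and>
        bottom_restriction p = bottom_restriction (a_diag l n m) \<and>
        nonprop_bottom p = nonprop_bottom (a_diag l n m)}"

text \<open>The \<open>j\<close>-th block from the left among the \<open>m i\<close> bottom blocks of size \<open>i\<close> coming from the
  factor $(b^i)^{\otimes m_i}$ of $a^{\mathbf m}$; to the left of these blocks stand the factors
  $(b^k)^{\otimes m_k}$ with $k > i$.\<close>

definition bottom_block :: "nat \<Rightarrow> (nat \<Rightarrow> nat) \<Rightarrow> nat \<Rightarrow> nat \<Rightarrow> vertex set" where
  "bottom_block l m i j =
     (\<lambda>t. Dn ((\<Sum>k\<in>{i<..l}. k * m k) + (j - 1) * i + t)) ` {1..i}"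

definition permute_bottom ::
  "nat \<Rightarrow> (nat \<Rightarrow> nat) \<Rightarrow> diagram \<Rightarrow> (nat \<Rightarrow> nat \<Rightarrow> nat) \<Rightarrow> diagram" where
  "permute_bottom l m p \<sigma> =
     {s \<in> p. \<not> propagating s} \<union>
     {(s \<inter> range Up) \<union> bottom_block l m i j | s i j.
        s \<in> p \<and> propagating s \<and> i \<in> {1..l} \<and> j \<in> {1..m i} \<and>
        s \<inter> range Dn = bottom_block l m i (\<sigma> i j)}"

text \<open>The right action of \<open>KS\<^sub>m\<close> on the span of the basis diagrams, and its transport to
  \<open>P\<^sup>m\<^sub>n a\<^sup>m\<close>: a class \<open>X\<close> is expanded in the basis, which amounts to choosing the unique
  representative supported on \<^const>\<open>std_diagrams\<close>.\<close>

definition diag_right_act ::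
  "nat \<Rightarrow> nat \<Rightarrow> (nat \<Rightarrow> nat) \<Rightarrow> (diagram \<Rightarrow> 'k::comm_ring_1) \<Rightarrow>
   ((nat \<Rightarrow> nat \<Rightarrow> nat) \<Rightarrow> 'k) \<Rightarrow> diagram \<Rightarrow> 'k" where
  "diag_right_act l n m =
     bilin (std_diagrams l n m) (sym_prod m) (\<lambda>_ _. 1) (permute_bottom l m)"

definition right_act ::
  "nat \<Rightarrow> nat \<Rightarrow> 'k::comm_ring_1 \<Rightarrow> (nat \<Rightarrow> nat) \<Rightarrow> (diagram \<Rightarrow> 'k) set \<Rightarrow>
   ((nat \<Rightarrow> nat \<Rightarrow> nat) \<Rightarrow> 'k) \<Rightarrow> (diagram \<Rightarrow> 'k) set" where
  "right_act l n \<delta> m X x =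
     quot_class l n \<delta> m
       (diag_right_act l n m
          (THE v. v \<in> supported (std_diagrams l n m) \<and> quot_class l n \<delta> m v = X) x)"

definition left_act ::
  "nat \<Rightarrow> nat \<Rightarrow> 'k::comm_ring_1 \<Rightarrow> (nat \<Rightarrow> nat) \<Rightarrow> ((nat \<Rightarrow> nat \<Rightarrow> nat) \<Rightarrow> 'k) \<Rightarrow>
   (diagram \<Rightarrow> 'k) set \<Rightarrow> (diagram \<Rightarrow> 'k) set" where
  "left_act l n \<delta> m x X = quot_op (right_act l n \<delta> m (quot_op X) (galg_op x))"


section \<open>Specht modules\<close>

text \<open>The conventions are those of James: the Specht module of shape \<open>lam\<close> is the span of the
  polytabloids in the permutation module on the tabloids of shape \<open>lam\<close>, so that a one-row shape
  gives the trivial module. Rows and columns are numbered from \<open>0\<close>, entries from \<open>1\<close>, and a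
  tabloid is recorded by the function sending a row index to the set of entries of that row.\<close>

definition integer_partition :: "nat \<Rightarrow> nat list \<Rightarrow> bool" where
  "integer_partition k lam \<longleftrightarrow> sorted_wrt (\<ge>) lam \<and> 0 \<notin> set lam \<and> sum_list lam = k"

definition multipartitions :: "nat \<Rightarrow> (nat \<Rightarrow> nat) \<Rightarrow> (nat \<Rightarrow> nat list) set" where
  "multipartitions l m = {lam. \<forall>i\<in>{1..l}. integer_partition (m i) (lam i)}"

definition cells :: "nat list \<Rightarrow> (nat \<times> nat) set" where
  "cells lam = {(r, c). r < length lam \<and> c < lam ! r}"

definition tableaux :: "nat list \<Rightarrow> (nat \<times> nat \<Rightarrow> nat) set" where
  "tableaux lam = {t. bij_betw t (cells lam) {1..sum_list lam}}"

definition tabloid :: "nat list \<Rightarrow> (nat \<times> nat \<Rightarrow> nat) \<Rightarrow> nat \<Rightarrow> nat set" where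
  "tabloid lam t r = {t (r, c) | c. (r, c) \<in> cells lam}"

definition column :: "nat list \<Rightarrow> (nat \<times> nat \<Rightarrow> nat) \<Rightarrow> nat \<Rightarrow> nat set" where
  "column lam t c = {t (r, c) | r. (r, c) \<in> cells lam}"

definition column_stabilizer :: "nat list \<Rightarrow> (nat \<times> nat \<Rightarrow> nat) \<Rightarrow> (nat \<Rightarrow> nat) set" where
  "column_stabilizer lam t =
     {\<pi>. \<pi> permutes {1..sum_list lam} \<and> (\<forall>c. \<pi> ` column lam t c = column lam t c)}"

definition polytabloid ::
  "nat list \<Rightarrow> (nat \<times> nat \<Rightarrow> nat) \<Rightarrow> (nat \<Rightarrow> nat set) \<Rightarrow> 'k::comm_ring_1" where
  "polytabloid lam t T =
     (\<Sum>\<pi>\<in>column_stabilizer lam t. if (\<lambda>r. \<pi> ` tabloid lam t r) = T then of_int (sign \<pi>) else 0)"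

definition specht :: "nat list \<Rightarrow> ((nat \<Rightarrow> nat set) \<Rightarrow> 'k::comm_ring_1) set" where
  "specht lam = lin_span (polytabloid lam ` tableaux lam)"

text \<open>The outer product is realised in the outer product of the permutation modules, that is,
  in functions of families \<open>T\<close> of tabloids that depend on \<open>T 1, \<dots>, T l\<close> only.\<close>

definition outer_specht ::
  "nat \<Rightarrow> (nat \<Rightarrow> nat list) \<Rightarrow> ((nat \<Rightarrow> nat \<Rightarrow> nat set) \<Rightarrow> 'k::comm_ring_1) set" where
  "outer_specht l lam =
     lin_span {(\<lambda>T. \<Prod>i\<in>{1..l}. v i (T i)) | v. \<forall>i\<in>{1..l}. v i \<in> specht (lam i)}"

definition tabloid_act ::
  "(nat \<Rightarrow> nat) \<Rightarrow> ((nat \<Rightarrow> nat \<Rightarrow> nat) \<Rightarrow> 'k::comm_ring_1) \<Rightarrow>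
   ((nat \<Rightarrow> nat \<Rightarrow> nat set) \<Rightarrow> 'k) \<Rightarrow> (nat \<Rightarrow> nat \<Rightarrow> nat set) \<Rightarrow> 'k" where
  "tabloid_act m x f = (\<lambda>T. \<Sum>\<sigma>\<in>sym_prod m. x \<sigma> * f (\<lambda>i r. inv_into UNIV (\<sigma> i) ` T i r))"

text \<open>\<open>KS\<^sub>m e\<close> is isomorphic to the outer Specht module as a left \<open>KS\<^sub>m\<close>-module; compatibility
  with the action of multiples of the identity makes \<open>\<phi>\<close> linear over \<open>K\<close>.\<close>

definition generates_specht ::
  "nat \<Rightarrow> (nat \<Rightarrow> nat) \<Rightarrow> (nat \<Rightarrow> nat list) \<Rightarrow> ((nat \<Rightarrow> nat \<Rightarrow> nat) \<Rightarrow> 'k::comm_ring_1) \<Rightarrow> bool" where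
  "generates_specht l m lam e \<longleftrightarrow>
     (let L = (\<lambda>x. galg_mult m x e) ` supported (sym_prod m) in
      \<exists>\<phi> :: ((nat \<Rightarrow> nat \<Rightarrow> nat) \<Rightarrow> 'k) \<Rightarrow> ((nat \<Rightarrow> nat \<Rightarrow> nat set) \<Rightarrow> 'k).
        bij_betw \<phi> L (outer_specht l lam) \<and>
        (\<forall>u\<in>L. \<forall>v\<in>L. \<phi> (\<lambda>\<sigma>. u \<sigma> + v \<sigma>) = (\<lambda>T. \<phi> u T + \<phi> v T)) \<and>
        (\<forall>x\<in>supported (sym_prod m). \<forall>u\<in>L. \<phi> (galg_mult m x u) = tabloid_act m x (\<phi> u)))"

text \<open>A preidempotent is an element whose square is a nonzero multiple of itself.\<close>

definition preidempotent :: "(nat \<Rightarrow> nat) \<Rightarrow> ((nat \<Rightarrow> nat \<Rightarrow> nat) \<Rightarrow> int) \<Rightarrow> bool" where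
  "preidempotent m e \<longleftrightarrow>
     e \<in> supported (sym_prod m) \<and> (\<exists>k. k \<noteq> 0 \<and> galg_mult m e e = (\<lambda>\<sigma>. k * e \<sigma>))"

definition primitive_elem ::
  "(nat \<Rightarrow> nat) \<Rightarrow> ((nat \<Rightarrow> nat \<Rightarrow> nat) \<Rightarrow> 'k::comm_ring_1) \<Rightarrow> bool" where
  "primitive_elem m e \<longleftrightarrow>
     (\<forall>x\<in>supported (sym_prod m). \<exists>c. galg_mult m (galg_mult m e x) e = (\<lambda>\<sigma>. c * e \<sigma>)) \<and>
     (\<forall>c. (\<lambda>\<sigma>. c * e \<sigma>) = (\<lambda>_. 0) \<longrightarrow> c = 0)"


section \<open>Standard modules and contravariant forms\<close>

definition standard_module ::
  "nat \<Rightarrow> nat \<Rightarrow> 'k::comm_ring_1 \<Rightarrow> (nat \<Rightarrow> nat) \<Rightarrow> ((nat \<Rightarrow> nat \<Rightarrow> nat) \<Rightarrow> 'k) \<Rightarrow>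
   (diagram \<Rightarrow> 'k) set set" where
  "standard_module l n \<delta> m e =
     {right_act l n \<delta> m (x \<otimes>\<^bsub>quot_tonal l n \<delta> m\<^esub> a_elem l n \<delta> m) e | x.
        x \<in> carrier (quot_tonal l n \<delta> m)}"

definition bilinear_form_on ::
  "('k::comm_ring_1, 'a, 'b) module_scheme \<Rightarrow> 'a set \<Rightarrow> ('a \<Rightarrow> 'a \<Rightarrow> 'k) \<Rightarrow> bool" where
  "bilinear_form_on Q S B \<longleftrightarrow>
     (\<forall>u\<in>S. \<forall>u'\<in>S. \<forall>v\<in>S. B (u \<oplus>\<^bsub>Q\<^esub> u') v = B u v + B u' v \<and> B v (u \<oplus>\<^bsub>Q\<^esub> u') = B v u + B v u') \<and>
     (\<forall>c. \<forall>u\<in>S. \<forall>v\<in>S. B (c \<odot>\<^bsub>Q\<^esub> u) v = c * B u v \<and> B u (c \<odot>\<^bsub>Q\<^esub> v) = c * B u v)"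

definition contravariant_form ::
  "nat \<Rightarrow> nat \<Rightarrow> 'k::comm_ring_1 \<Rightarrow> (nat \<Rightarrow> nat) \<Rightarrow> (diagram \<Rightarrow> 'k) set set \<Rightarrow>
   ((diagram \<Rightarrow> 'k) set \<Rightarrow> (diagram \<Rightarrow> 'k) set \<Rightarrow> 'k) \<Rightarrow> bool" where
  "contravariant_form l n \<delta> m S B \<longleftrightarrow>
     bilinear_form_on (quot_tonal l n \<delta> m) S B \<and>
     (\<forall>g\<in>carrier (tonal_algebra l n \<delta>). \<forall>u\<in>S. \<forall>v\<in>S.
        B u (quot_class l n \<delta> m g \<otimes>\<^bsub>quot_tonal l n \<delta> m\<^esub> v) =
        B (quot_class l n \<delta> m (alg_op g) \<otimes>\<^bsub>quot_tonal l n \<delta> m\<^esub> u) v)"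

end

theory Submission
  imports Defs
begin

text \<open>A diagram acts by a zero-one matrix on the tensor powers of a free module of rank two. The
  matrix determines the diagram, and a product of two such matrices is the matrix of the composite
  diagram times the power of 2 given by the number of loops. Associativity and all product
  computations are read off from these matrices. The propagating vector of a product is at most
  that of each factor, as every part of the product merges propagating parts of either factor; and
  a diagram with propagating vector \<open>m\<close> factors through \<open>a\<^sup>m\<close> without loops. Hence the ideal
  \<open>I\<^bsup><m\<^esup>\<close> is the span of the diagrams of smaller propagating vector, and computations in the quotient
  algebra amount to ignoring these diagrams. The group \<open>S\<^sub>m\<close> embeds into the tonal algebra by
  permutations of blocks that commute with \<open>a\<^sup>m\<close>; both actions of \<open>KS\<^sub>m\<close> become multiplications
  by its image, and \<open>a\<^sup>m x a\<^sup>m\<close> lies in \<open>a\<^sup>m KS\<^sub>m\<close> modulo the ideal. So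
  \<open>e (a\<^sup>m x\<^sup>o\<^sup>p y a\<^sup>m) e = a\<^sup>m (e z e)\<close> for some \<open>z\<close> in \<open>KS\<^sub>m\<close>, which is a unique multiple of
  \<open>a\<^sup>m e\<close> by primitivity, and contravariance is associativity.\<close>

section \<open>Partitions and their saturated sets\<close>

text \<open>A product is built on a \<open>THE\<close>-defined finest partition, whose parts arise
  from chains of overlapping parts alternating between the two factors; comparing bracketings
  directly would mean following such chains through three layers. Saturated sets avoid this: a set
  is saturated for the finest partition exactly when it is saturated for the generating sets, so
  gluing becomes a conjunction of two conditions on one intermediate set. Rank two is enough because
  subsets of positions already separate partitions, and because powers of 2 determine their
  exponents: a single comparison of matrices yields both the diagram and the loop number, and the
  result then applies to every \<delta>. Over an arbitrary commutative ring neither \<delta> nor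
  group orders can be inverted. Loop-free factorizations keep powers of \<delta> out of the
  description of the ideal, and the condition that only 0 annihilates \<open>e\<close> makes the
  scalar unique. The form is defined on pairs of elements of the standard module rather than on
  \<open>x\<close> and \<open>y\<close>, so independence of representatives is built in.\<close>

definition saturated :: "'a set set \<Rightarrow> 'a set \<Rightarrow> bool" where
  "saturated p S \<longleftrightarrow> (\<forall>s\<in>p. s \<subseteq> S \<or> s \<inter> S = {})"

lemma saturatedD: "saturated p S \<Longrightarrow> s \<in> p \<Longrightarrow> x \<in> s \<Longrightarrow> y \<in> s \<Longrightarrow> x \<in> S \<longleftrightarrow> y \<in> S"
  by (auto simp: saturated_def)

lemma saturated_iff: "saturated p S \<longleftrightarrow> (\<forall>s\<in>p. \<forall>x\<in>s. \<forall>y\<in>s. x \<in> S \<longleftrightarrow> y \<in> S)"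
  by (auto simp: saturated_def)

lemma saturated_Un: "saturated (p \<union> q) S \<longleftrightarrow> saturated p S \<and> saturated q S"
  by (auto simp: saturated_def)

lemma saturated_image: "saturated ((`) f ` p) S \<longleftrightarrow> saturated p (f -` S)"
  by (simp add: saturated_iff)

lemma partition_on_partsD:
  assumes "partition_on V r" "s \<in> r" "t \<in> r" "x \<in> s" "x \<in> t"
  shows "s = t"
  using assms unfolding partition_on_def disjoint_def by blast

lemma partition_on_ex_part: "partition_on V r \<Longrightarrow> x \<in> V \<Longrightarrow> \<exists>t\<in>r. x \<in> t"
  unfolding partition_on_def by blast

lemma partition_on_subset: "partition_on V r \<Longrightarrow> t \<in> r \<Longrightarrow> t \<subseteq> V"
  unfolding partition_on_def by blast

lemma saturated_part:
  assumes "partition_on V r" "t \<in> r"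
  shows "saturated r t"
  using assms unfolding saturated_def partition_on_def disjoint_def by blast

text \<open>Parts are the minimal nonempty saturated sets. If a part of \<open>r\<close> and a part
  of \<open>q\<close> share a point, each is saturated for the other partition, so each contains the
  other.\<close>

lemma partition_on_eq_saturated:
  assumes r: "partition_on V r" and q: "partition_on V q"
    and "\<And>S. S \<subseteq> V \<Longrightarrow> saturated r S \<longleftrightarrow> saturated q S"
  shows "r = q"
proof -
  have sub: "r \<subseteq> q"
    if r: "partition_on V r" and q: "partition_on V q"
      and eq: "\<And>S. S \<subseteq> V \<Longrightarrow> saturated r S \<longleftrightarrow> saturated q S" for r q
  proof
    fix t assume t: "t \<in> r"
    then obtain x where x: "x \<in> t" "x \<in> V"
      using partition_onD3[OF r] partition_on_subset[OF r t] by (metis all_not_in_conv subsetD)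
    then obtain u where u: "u \<in> q" "x \<in> u" using partition_on_ex_part[OF q] by blast
    have "saturated q t"
      using eq saturated_part[OF r t] partition_on_subset[OF r t] by blast
    moreover have "saturated r u"
      using eq saturated_part[OF q u(1)] partition_on_subset[OF q u(1)] by blast
    ultimately have "t = u" using u t x by (auto simp: saturated_def)
    then show "t \<in> q" using u by simp
  qed
  show ?thesis
    by (intro subset_antisym sub) (use assms in auto)
qed

text \<open>The finest partition is the quotient by the relation of not being separated by any
  saturated set.\<close>

lemma finest_containing:
  assumes sub: "\<Union>G \<subseteq> V" and ne: "{} \<notin> G"
  shows partition_on_finest: "partition_on V (finest_containing V G)"
    and finest_contains: "s \<in> G \<Longrightarrow> \<exists>t\<in>finest_containing V G. s \<subseteq> t"
    and saturated_finest: "saturated (finest_containing V G) S \<longleftrightarrow> saturated G S"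
proof -
  define R where "R = {(x, y) \<in> V \<times> V. \<forall>S. saturated G S \<longrightarrow> (x \<in> S \<longleftrightarrow> y \<in> S)}"
  have R: "equiv V R"
    by (rule equivI) (auto simp: R_def refl_on_def sym_def trans_def)
  define r where "r = V // R"
  have part: "partition_on V r" unfolding r_def using R by (rule partition_on_quotient)
  have cont: "\<exists>t\<in>r. s \<subseteq> t" if s: "s \<in> G" for s
  proof -
    obtain x where x: "x \<in> s" using s ne by fastforce
    have "s \<subseteq> R `` {x}"
      using x s sub by (auto simp: R_def dest: saturatedD)
    moreover have "R `` {x} \<in> r" unfolding r_def using x s sub by (auto intro: quotientI)
    ultimately show ?thesis by blast
  qed
  have fin: "refines V r r'"
    if r': "partition_on V r'" and c: "\<forall>s\<in>G. \<exists>t\<in>r'. s \<subseteq> t" for r'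
    unfolding refines_def
  proof (intro conjI ballI part r')
    fix X assume "X \<in> r"
    then obtain x where x: "x \<in> V" "X = R `` {x}" unfolding r_def by (auto elim: quotientE)
    then obtain Y where Y: "Y \<in> r'" "x \<in> Y" using partition_on_ex_part[OF r'] by blast
    have "saturated G Y"
      unfolding saturated_def
    proof
      fix s assume "s \<in> G"
      then obtain t where t: "t \<in> r'" "s \<subseteq> t" using c by blast
      then show "s \<subseteq> Y \<or> s \<inter> Y = {}"
        using partition_on_partsD[OF r' t(1) Y(1)] by blast
    qed
    then have "X \<subseteq> Y" using Y x by (auto simp: R_def)
    then show "\<exists>Y\<in>r'. X \<subseteq> Y" using Y by blast
  qed
  have eq: "finest_containing V G = r"
    unfolding finest_containing_def
  proof (rule the_equality)
    show "partition_on V r \<and> (\<forall>s\<in>G. \<exists>t\<in>r. s \<subseteq> t) \<and>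
      (\<forall>r'. partition_on V r' \<and> (\<forall>s\<in>G. \<exists>t\<in>r'. s \<subseteq> t) \<longrightarrow> refines V r r')"
      using part cont fin by blast
  next
    fix r' assume r': "partition_on V r' \<and> (\<forall>s\<in>G. \<exists>t\<in>r'. s \<subseteq> t) \<and>
      (\<forall>r''. partition_on V r'' \<and> (\<forall>s\<in>G. \<exists>t\<in>r''. s \<subseteq> t) \<longrightarrow> refines V r' r'')"
    have "refines V r r'" using fin r' by blast
    moreover have "refines V r' r" using r' part cont by blast
    ultimately show "r' = r" using refines_asym by blast
  qed
  show "partition_on V (finest_containing V G)" using part eq by simp
  show "s \<in> G \<Longrightarrow> \<exists>t\<in>finest_containing V G. s \<subseteq> t" using cont eq by simp
  show "saturated (finest_containing V G) S \<longleftrightarrow> saturated G S"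
  proof
    assume S: "saturated G S"
    have "x \<in> S \<longleftrightarrow> y \<in> S" if "t \<in> r" "x \<in> t" "y \<in> t" for t x y
    proof -
      from that(1) obtain z where "t = R `` {z}" unfolding r_def by (auto elim: quotientE)
      with that S show ?thesis by (auto simp: R_def)
    qed
    then show "saturated (finest_containing V G) S" unfolding eq saturated_iff by blast
  next
    assume S: "saturated (finest_containing V G) S"
    show "saturated G S" unfolding saturated_def
    proof
      fix s assume "s \<in> G"
      then obtain t where "t \<in> r" "s \<subseteq> t" using cont by blast
      then show "s \<subseteq> S \<or> s \<inter> S = {}" using S unfolding eq saturated_def by blast
    qed
  qed
qed

lemma partition_on_delete:
  assumes "partition_on V r"
  shows "partition_on (V - M) ((\<lambda>s. s - M) ` r - {{}})"
proof -
  have "partition_on (- M \<inter> V) ((\<inter>) (- M) ` r - {{}})"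
    by (rule partition_on_restrict[OF assms])
  moreover have "- M \<inter> V = V - M" by blast
  moreover have "(\<inter>) (- M) = (\<lambda>s. s - M)" by (rule ext) blast
  ultimately show ?thesis by simp
qed

text \<open>A part meeting \<open>S\<close> forces its points of \<open>M\<close> into the
  extension, a part that reaches outside \<open>M\<close> without meeting \<open>S\<close> must be
  avoided, and a part inside \<open>M\<close> may be taken or left. So there is one binary choice
  for each part inside \<open>M\<close>, provided that \<open>S\<close> is compatible with the parts
  left after deleting \<open>M\<close>.\<close>

lemma card_saturated_extensions:
  assumes r: "partition_on V r" and fin: "finite V" and S: "S \<subseteq> V - M" and M: "M \<subseteq> V"
  shows "card {B. B \<subseteq> M \<and> saturated r (S \<union> B)} =
    2 ^ card {s \<in> r. s \<subseteq> M} * of_bool (saturated ((\<lambda>s. s - M) ` r - {{}}) S)"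
proof (cases "saturated ((\<lambda>s. s - M) ` r - {{}}) S")
  case False
  have "saturated ((\<lambda>s. s - M) ` r - {{}}) S" if "B \<subseteq> M" "saturated r (S \<union> B)" for B
    using that S unfolding saturated_def by blast
  then have e: "{B. B \<subseteq> M \<and> saturated r (S \<union> B)} = {}" using False by blast
  show ?thesis unfolding e using False by simp
next
  case True
  \<comment> \<open>\<open>Lp\<close> collects the free choices; \<open>B0\<close> is the portion of
    \<open>M\<close> that \<open>S\<close> forces in.\<close>
  define Lp where "Lp = {s \<in> r. s \<subseteq> M}"
  define B0 where "B0 = \<Union>{s \<in> r. s \<inter> S \<noteq> {}} \<inter> M"
  have finr: "finite r" using r fin by (rule finite_elements[rotated])
  have sat0: "s - M \<subseteq> S" if "s \<inter> S \<noteq> {}" "s \<in> r" for s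
  proof -
    have ne: "(s - M) \<inter> S \<noteq> {}" using that(1) S by blast
    then have "s - M \<in> (\<lambda>s. s - M) ` r - {{}}" using that(2) by blast
    then show ?thesis using True ne unfolding saturated_def by blast
  qed
  have bij: "bij_betw (\<lambda>Y. B0 \<union> \<Union>Y) (Pow Lp) {B. B \<subseteq> M \<and> saturated r (S \<union> B)}"
  proof (rule bij_betw_byWitness[where f' = "\<lambda>B. {s \<in> Lp. s \<subseteq> B}"])
    show "\<forall>Y\<in>Pow Lp. {s \<in> Lp. s \<subseteq> B0 \<union> \<Union>Y} = Y"
    proof
      fix Y assume Y: "Y \<in> Pow Lp"
      have "s \<in> Y" if s: "s \<in> Lp" "s \<subseteq> B0 \<union> \<Union>Y" for s
      proof -
        obtain x where x: "x \<in> s" using s partition_onD3[OF r] unfolding Lp_def by fastforce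
        have "x \<notin> B0"
        proof
          assume "x \<in> B0"
          then obtain t where "t \<in> r" "t \<inter> S \<noteq> {}" "x \<in> t" unfolding B0_def by blast
          then have "t = s" using partition_on_partsD[OF r] x s unfolding Lp_def by blast
          then show False using \<open>t \<inter> S \<noteq> {}\<close> s S unfolding Lp_def by blast
        qed
        then obtain t where "t \<in> Y" "x \<in> t" using x s by blast
        moreover then have "t = s"
          using partition_on_partsD[OF r] x s Y unfolding Lp_def by blast
        ultimately show ?thesis by blast
      qed
      then show "{s \<in> Lp. s \<subseteq> B0 \<union> \<Union>Y} = Y" using Y by blast
    qed
    show "\<forall>B\<in>{B. B \<subseteq> M \<and> saturated r (S \<union> B)}. B0 \<union> \<Union>{s \<in> Lp. s \<subseteq> B} = B"
    proof
      fix B assume "B \<in> {B. B \<subseteq> M \<and> saturated r (S \<union> B)}"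
      then have B: "B \<subseteq> M" "saturated r (S \<union> B)" by auto
      have "B0 \<subseteq> B" using B S unfolding B0_def saturated_def by blast
      moreover have "x \<in> B0 \<union> \<Union>{s \<in> Lp. s \<subseteq> B}" if x: "x \<in> B" for x
      proof -
        obtain s where s: "s \<in> r" "x \<in> s" using partition_on_ex_part[OF r] x B M by blast
        then have sub: "s \<subseteq> S \<union> B" using B x unfolding saturated_def by blast
        show ?thesis
        proof (cases "s \<inter> S = {}")
          case True
          then show ?thesis using s sub B unfolding Lp_def by blast
        next
          case False
          then show ?thesis using s x B unfolding B0_def by blast
        qed
      qed
      ultimately show "B0 \<union> \<Union>{s \<in> Lp. s \<subseteq> B} = B" by blast
    qed
    show "(\<lambda>Y. B0 \<union> \<Union>Y) ` Pow Lp \<subseteq> {B. B \<subseteq> M \<and> saturated r (S \<union> B)}"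
    proof (clarsimp, intro conjI)
      fix Y assume Y: "Y \<subseteq> Lp"
      show "B0 \<subseteq> M" unfolding B0_def by blast
      show "\<Union>Y \<subseteq> M" using Y unfolding Lp_def by blast
      show "saturated r (S \<union> (B0 \<union> \<Union>Y))"
        unfolding saturated_def
      proof
        fix s assume s: "s \<in> r"
        show "s \<subseteq> S \<union> (B0 \<union> \<Union>Y) \<or> s \<inter> (S \<union> (B0 \<union> \<Union>Y)) = {}"
        proof (cases "s \<inter> S = {}")
          case False
          then show ?thesis using sat0[OF False s] s unfolding B0_def by blast
        next
          case True
          have "s \<inter> B0 = {}"
          proof (rule ccontr)
            assume "s \<inter> B0 \<noteq> {}"
            then obtain t x where "t \<in> r" "t \<inter> S \<noteq> {}" "x \<in> t" "x \<in> s" unfolding B0_def by blast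
            then show False using partition_on_partsD[OF r _ s, of t x] True by blast
          qed
          moreover have "s \<subseteq> \<Union>Y \<or> s \<inter> \<Union>Y = {}"
            using partition_on_partsD[OF r s] Y unfolding Lp_def by blast
          ultimately show ?thesis using True by blast
        qed
      qed
    qed
  qed blast
  have "card {B. B \<subseteq> M \<and> saturated r (S \<union> B)} = card (Pow Lp)"
    using bij_betw_same_card[OF bij] by simp
  also have "\<dots> = 2 ^ card Lp" using finr by (simp add: card_Pow Lp_def)
  finally show ?thesis using True by (simp add: Lp_def)
qed


section \<open>Diagrams as zero-one matrices\<close>

text \<open>\<open>dmat p A C\<close> is the entry at \<open>(A, C)\<close> of the matrix by which \<open>p\<close> acts on tensor powers of a
  free module of rank two, where a basis tensor is encoded by the set of its positions
  carrying the second basis vector. Composition of diagrams at \<open>\<delta> = 2\<close> is multiplication of these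
  matrices, and they determine both the diagram and the exponent of \<open>\<delta>\<close>.\<close>

definition dmat :: "diagram \<Rightarrow> nat set \<Rightarrow> nat set \<Rightarrow> bool" where
  "dmat p A C \<longleftrightarrow> saturated p (Up ` A \<union> Dn ` C)"

lemma diagramsD: "p \<in> diagrams n m \<Longrightarrow> partition_on (Up ` {1..n} \<union> Dn ` {1..m}) p"
  by (simp add: diagrams_def)

lemma diagrams_part_subset: "p \<in> diagrams n m \<Longrightarrow> s \<in> p \<Longrightarrow> s \<subseteq> Up ` {1..n} \<union> Dn ` {1..m}"
  using diagramsD partition_on_subset by blast

lemma diagrams_part_ne: "p \<in> diagrams n m \<Longrightarrow> s \<in> p \<Longrightarrow> s \<noteq> {}"
  using diagramsD partition_onD3 by blast

lemma finite_diagrams [simp]: "finite (diagrams n m)"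
  unfolding diagrams_def by (rule finitely_many_partition_on) simp

lemma finite_diagram: "p \<in> diagrams n m \<Longrightarrow> finite p"
  by (rule finite_elements[OF _ diagramsD]) auto

lemma finite_diagram_part: "p \<in> diagrams n m \<Longrightarrow> s \<in> p \<Longrightarrow> finite s"
  by (rule finite_subset[OF diagrams_part_subset]) auto

lemma diagrams_part_cong:
  "p \<in> diagrams n m \<Longrightarrow> s \<in> p \<Longrightarrow> t \<in> p \<Longrightarrow> x \<in> s \<Longrightarrow> x \<in> t \<Longrightarrow> s = t"
  using diagramsD partition_on_partsD by metis

lemma diagrams_ex_part:
  assumes "p \<in> diagrams n m" shows "i \<in> {1..n} \<Longrightarrow> \<exists>s\<in>p. Up i \<in> s"
    and "i \<in> {1..m} \<Longrightarrow> \<exists>s\<in>p. Dn i \<in> s"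
  using partition_on_ex_part[OF diagramsD[OF assms]] by auto

lemma dmat_empty [simp]: "dmat p {} {}"
  by (simp add: dmat_def saturated_def)

lemma diagram_eqI:
  assumes p: "p \<in> diagrams n m" and q: "q \<in> diagrams n m"
    and eq: "\<And>A C. A \<subseteq> {1..n} \<Longrightarrow> C \<subseteq> {1..m} \<Longrightarrow> dmat p A C \<longleftrightarrow> dmat q A C"
  shows "p = q"
proof (rule partition_on_eq_saturated[OF diagramsD[OF p] diagramsD[OF q]])
  fix S assume S: "S \<subseteq> Up ` {1..n} \<union> Dn ` {1..m}"
  have "S = Up ` (Up -` S) \<union> Dn ` (Dn -` S)" using S by auto
  moreover have "Up -` S \<subseteq> {1..n}" "Dn -` S \<subseteq> {1..m}" using S by auto
  ultimately show "saturated p S \<longleftrightarrow> saturated q S"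
    using eq[of "Up -` S" "Dn -` S"] unfolding dmat_def by simp
qed

section \<open>Stacking two diagrams as multiplication of zero-one matrices\<close>

context
  fixes n m r :: nat and p q :: diagram
  assumes p: "p \<in> diagrams n m" and q: "q \<in> diagrams m r"
begin

private lemma gens:
  "\<Union>((`) dn_to_mid ` p \<union> (`) up_to_mid ` q) \<subseteq> Up ` {1..n} \<union> Mid ` {1..m} \<union> Dn ` {1..r}"
  "{} \<notin> (`) dn_to_mid ` p \<union> (`) up_to_mid ` q"
proof -
  show "\<Union>((`) dn_to_mid ` p \<union> (`) up_to_mid ` q)
      \<subseteq> Up ` {1..n} \<union> Mid ` {1..m} \<union> Dn ` {1..r}"
    using diagrams_part_subset[OF p] diagrams_part_subset[OF q] by fastforce
  show "{} \<notin> (`) dn_to_mid ` p \<union> (`) up_to_mid ` q"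
    using diagrams_part_ne[OF p] diagrams_part_ne[OF q] by auto
qed

lemma partition_on_stack:
  "partition_on (Up ` {1..n} \<union> Mid ` {1..m} \<union> Dn ` {1..r}) (stack n m r p q)"
  unfolding stack_def by (rule partition_on_finest[OF gens])

lemma stack_upper: "s \<in> p \<Longrightarrow> \<exists>t\<in>stack n m r p q. dn_to_mid ` s \<subseteq> t"
  unfolding stack_def by (rule finest_contains[OF gens]) auto

lemma stack_lower: "s \<in> q \<Longrightarrow> \<exists>t\<in>stack n m r p q. up_to_mid ` s \<subseteq> t"
  unfolding stack_def by (rule finest_contains[OF gens]) auto

lemma saturated_stack:
  "saturated (stack n m r p q) S \<longleftrightarrow> saturated p (dn_to_mid -` S) \<and> saturated q (up_to_mid -` S)"
  unfolding stack_def by (subst saturated_finest[OF gens]) (simp add: saturated_Un saturated_image)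

text \<open>The middle vertex \<open>Mid i\<close> pulls back to \<open>Dn i\<close> in
  \<open>p\<close> and to \<open>Up i\<close> in \<open>q\<close>, so a saturated set of the stack
  is a pair of saturated sets that agree on the shared row.\<close>

lemma saturated_stack_iff:
  assumes "A \<subseteq> {1..n}" "B \<subseteq> {1..m}" "C \<subseteq> {1..r}"
  shows "saturated (stack n m r p q) (Up ` A \<union> Dn ` C \<union> Mid ` B) \<longleftrightarrow> dmat p A B \<and> dmat q B C"
proof -
  \<comment> \<open>The preimages also contain stray middle vertices, but saturation only looks at
    points of the parts.\<close>
  have *: "saturated p S \<longleftrightarrow> saturated p T"
    if *: "\<And>x. x \<in> Up ` {1..n} \<union> Dn ` {1..m} \<Longrightarrow> x \<in> S \<longleftrightarrow> x \<in> T"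
      and p: "p \<in> diagrams n m"
    for p S T n m
  proof -
    have "x \<in> S \<longleftrightarrow> x \<in> T" if "s \<in> p" "x \<in> s" for s x
      by (rule *) (use diagrams_part_subset[OF p that(1)] that(2) in blast)
    then show ?thesis unfolding saturated_iff by (intro ball_cong refl) simp
  qed
  have "saturated p (dn_to_mid -` (Up ` A \<union> Dn ` C \<union> Mid ` B)) \<longleftrightarrow> dmat p A B"
    unfolding dmat_def by (rule *[OF _ p]) auto
  moreover have "saturated q (up_to_mid -` (Up ` A \<union> Dn ` C \<union> Mid ` B)) \<longleftrightarrow> dmat q B C"
    unfolding dmat_def by (rule *[OF _ q]) auto
  ultimately show ?thesis by (simp add: saturated_stack)
qed

private lemma stack_part_minus: "s \<in> stack n m r p q \<Longrightarrow> s - range Mid = s - Mid ` {1..m}"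
  using partition_on_subset[OF partition_on_stack] by blast

lemma compose_diag_alt:
  "compose_diag n m r p q = (\<lambda>s. s - Mid ` {1..m}) ` stack n m r p q - {{}}"
  unfolding compose_diag_def using stack_part_minus by (metis (no_types, lifting) image_cong)

lemma compose_diag_in_diagrams [intro, simp]: "compose_diag n m r p q \<in> diagrams n r"
proof -
  have "Up ` {1..n} \<union> Mid ` {1..m} \<union> Dn ` {1..r} - Mid ` {1..m} = Up ` {1..n} \<union> Dn ` {1..r}"
    by auto
  then show ?thesis
    unfolding compose_diag_alt diagrams_def
    using partition_on_delete[OF partition_on_stack, of "Mid ` {1..m}"] by simp
qed

text \<open>The left side is the entry at \<open>(A, C)\<close> of the matrix product. Each loop can
  be coloured independently of the outer rows and therefore doubles the number of intermediate
  sets.\<close>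

lemma card_dmat_compose:
  assumes A: "A \<subseteq> {1..n}" and C: "C \<subseteq> {1..r}"
  shows "card {B. B \<subseteq> {1..m} \<and> dmat p A B \<and> dmat q B C} =
    2 ^ loops n m r p q * of_bool (dmat (compose_diag n m r p q) A C)"
proof -
  have "bij_betw ((`) Mid) {B. B \<subseteq> {1..m} \<and> dmat p A B \<and> dmat q B C}
      {B. B \<subseteq> Mid ` {1..m} \<and> saturated (stack n m r p q) (Up ` A \<union> Dn ` C \<union> B)}"
    by (rule bij_betw_byWitness[where f' = "(-`) Mid"])
      (use A C in \<open>auto simp: saturated_stack_iff subset_image_iff inj_vimage_image_eq inj_def\<close>)
  then have "card {B. B \<subseteq> {1..m} \<and> dmat p A B \<and> dmat q B C} =
      card {B. B \<subseteq> Mid ` {1..m} \<and> saturated (stack n m r p q) (Up ` A \<union> Dn ` C \<union> B)}"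
    by (rule bij_betw_same_card)
  also have "\<dots> = 2 ^ loops n m r p q * of_bool (dmat (compose_diag n m r p q) A C)"
    unfolding loops_def dmat_def compose_diag_alt
    by (rule card_saturated_extensions[OF partition_on_stack]) (use A C in auto)
  finally show ?thesis .
qed

lemma sum_dmat_compose:
  assumes A: "A \<subseteq> {1..n}" and C: "C \<subseteq> {1..r}"
  shows "(\<Sum>B\<in>Pow {1..m}. of_bool (dmat p A B) * of_bool (dmat q B C)) =
    2 ^ loops n m r p q * (of_bool (dmat (compose_diag n m r p q) A C) :: nat)"
proof -
  have "(\<Sum>B\<in>Pow {1..m}. of_bool (dmat p A B) * of_bool (dmat q B C)) =
      (\<Sum>B\<in>Pow {1..m}. if dmat p A B \<and> dmat q B C then 1 else (0::nat))"
    by (rule sum.cong) auto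
  also have "\<dots> = card {B. B \<subseteq> {1..m} \<and> dmat p A B \<and> dmat q B C}"
    by (simp add: sum.If_cases Int_def)
  finally show ?thesis using card_dmat_compose[OF A C] by simp
qed

end

text \<open>The entry at \<open>({}, {})\<close> of every diagram is 1, so it isolates the exponent;
  after cancelling the power of 2 the matrices agree.\<close>

lemma dmat_power_unique:
  assumes "p \<in> diagrams n m" and "q \<in> diagrams n m"
    and eq: "\<And>A C. A \<subseteq> {1..n} \<Longrightarrow> C \<subseteq> {1..m} \<Longrightarrow>
      2 ^ a * (of_bool (dmat p A C) :: nat) = 2 ^ b * of_bool (dmat q A C)"
  shows "p = q" "a = b"
proof -
  show "a = b" using eq[of "{}" "{}"] by simp
  show "p = q"
  proof (rule diagram_eqI[OF assms(1,2)])
    fix A C assume "A \<subseteq> {1..n}" "C \<subseteq> {1..m}"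
    from eq[OF this] show "dmat p A C \<longleftrightarrow> dmat q A C"
      by (cases "dmat p A C"; cases "dmat q A C") auto
  qed
qed

text \<open>This is how products with concrete diagrams are computed: guess the result and count
  intermediate sets, without ever evaluating a finest partition.\<close>

lemma compose_diag_eqI:
  assumes p: "p \<in> diagrams n m" and q: "q \<in> diagrams m r" and s: "s \<in> diagrams n r"
    and eq: "\<And>A C. A \<subseteq> {1..n} \<Longrightarrow> C \<subseteq> {1..r} \<Longrightarrow>
      card {B. B \<subseteq> {1..m} \<and> dmat p A B \<and> dmat q B C} = 2 ^ k * of_bool (dmat s A C)"
  shows "compose_diag n m r p q = s" "loops n m r p q = k"
proof -
  note * = dmat_power_unique[OF compose_diag_in_diagrams[OF p q] s, of "loops n m r p q" k]
  show "compose_diag n m r p q = s" "loops n m r p q = k"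
    by (rule *; use eq card_dmat_compose[OF p q] in simp)+
qed

text \<open>Both bracketings expand to the same triple matrix product, with the loop numbers
  collected in a power of 2. Uniqueness of diagram and exponent gives the two conclusions at
  once.\<close>

lemma compose_diag_assoc:
  assumes p: "p \<in> diagrams n m" and q: "q \<in> diagrams m r" and s: "s \<in> diagrams r k"
  shows "compose_diag n r k (compose_diag n m r p q) s =
      compose_diag n m k p (compose_diag m r k q s)"
    and "loops n m r p q + loops n r k (compose_diag n m r p q) s =
      loops n m k p (compose_diag m r k q s) + loops m r k q s"
proof -
  note pq = compose_diag_in_diagrams[OF p q] and qs = compose_diag_in_diagrams[OF q s]
  have *: "2 ^ (loops n m r p q + loops n r k (compose_diag n m r p q) s) *
      (of_bool (dmat (compose_diag n r k (compose_diag n m r p q) s) A D) :: nat) =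
      2 ^ (loops n m k p (compose_diag m r k q s) + loops m r k q s) *
      of_bool (dmat (compose_diag n m k p (compose_diag m r k q s)) A D)"
    if A: "A \<subseteq> {1..n}" and D: "D \<subseteq> {1..k}" for A D
  proof -
    have "2 ^ (loops n m r p q + loops n r k (compose_diag n m r p q) s) *
        (of_bool (dmat (compose_diag n r k (compose_diag n m r p q) s) A D) :: nat) =
        2 ^ loops n m r p q *
        (\<Sum>C\<in>Pow {1..r}. of_bool (dmat (compose_diag n m r p q) A C) * of_bool (dmat s C D))"
      by (simp only: sum_dmat_compose[OF pq s A D] power_add mult.assoc)
    also have "\<dots> = (\<Sum>C\<in>Pow {1..r}. \<Sum>B\<in>Pow {1..m}.
        of_bool (dmat p A B) * of_bool (dmat q B C) * of_bool (dmat s C D))"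
      unfolding sum_distrib_left
    proof (rule sum.cong[OF refl])
      fix C assume "C \<in> Pow {1..r}"
      then have C: "C \<subseteq> {1..r}" by simp
      show "2 ^ loops n m r p q *
          (of_bool (dmat (compose_diag n m r p q) A C) * of_bool (dmat s C D)) =
        (\<Sum>B\<in>Pow {1..m}. of_bool (dmat p A B) * of_bool (dmat q B C) * of_bool (dmat s C D) :: nat)"
        unfolding sum_distrib_right[symmetric] sum_dmat_compose[OF p q A C] by simp
    qed
    also have "\<dots> = (\<Sum>B\<in>Pow {1..m}. \<Sum>C\<in>Pow {1..r}.
        of_bool (dmat p A B) * (of_bool (dmat q B C) * of_bool (dmat s C D)))"
      by (subst sum.swap) (simp add: mult.assoc)
    also have "\<dots> = (\<Sum>B\<in>Pow {1..m}. of_bool (dmat p A B) *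
        (2 ^ loops m r k q s * of_bool (dmat (compose_diag m r k q s) B D)))"
    proof (rule sum.cong[OF refl])
      fix B assume "B \<in> Pow {1..m}"
      then have B: "B \<subseteq> {1..m}" by simp
      show "(\<Sum>C\<in>Pow {1..r}. of_bool (dmat p A B) * (of_bool (dmat q B C) * of_bool (dmat s C D))) =
        of_bool (dmat p A B) *
        (2 ^ loops m r k q s * of_bool (dmat (compose_diag m r k q s) B D) :: nat)"
        unfolding sum_distrib_left[symmetric] sum_dmat_compose[OF q s B D] ..
    qed
    also have "\<dots> = 2 ^ loops m r k q s * (\<Sum>B\<in>Pow {1..m}. of_bool (dmat p A B) *
        of_bool (dmat (compose_diag m r k q s) B D))"
      by (simp add: sum_distrib_left mult_ac)
    also have "\<dots> = 2 ^ (loops n m k p (compose_diag m r k q s) + loops m r k q s) *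
      of_bool (dmat (compose_diag n m k p (compose_diag m r k q s)) A D)"
      by (simp only: sum_dmat_compose[OF p qs A D] power_add mult_ac)
    finally show ?thesis .
  qed
  note ** = dmat_power_unique[OF compose_diag_in_diagrams[OF pq s] compose_diag_in_diagrams[OF p qs] *]
  show "compose_diag n r k (compose_diag n m r p q) s =
      compose_diag n m k p (compose_diag m r k q s)"
    and "loops n m r p q + loops n r k (compose_diag n m r p q) s =
      loops n m k p (compose_diag m r k q s) + loops m r k q s"
    by (rule **; simp)+
qed

section \<open>Flips, permutation diagrams and units\<close>

lemma flip_vertex_flip [simp]: "flip_vertex (flip_vertex v) = v"
  by (cases v) auto

lemma flip_diag_flip [simp]: "flip_diag (flip_diag p) = p"
  by (simp add: flip_diag_def image_image)

lemma flip_diag_in_diagrams: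
  assumes "p \<in> diagrams n m" shows "flip_diag p \<in> diagrams m n"
proof -
  have "inj flip_vertex" by (rule inj_on_inverseI[where g = flip_vertex]) simp
  then have "partition_on (flip_vertex ` (Up ` {1..n} \<union> Dn ` {1..m})) (flip_diag p)"
    unfolding flip_diag_def
    using partition_on_inj_image[OF diagramsD[OF assms] inj_on_subset[of _ UNIV]]
      diagrams_part_ne[OF assms] by (auto simp: image_iff)
  moreover have "flip_vertex ` (Up ` {1..n} \<union> Dn ` {1..m}) = Up ` {1..m} \<union> Dn ` {1..n}"
    by (auto simp: image_Un image_image)
  ultimately show ?thesis by (simp add: diagrams_def)
qed

lemma dmat_flip: "dmat (flip_diag p) A C \<longleftrightarrow> dmat p C A"
proof -
  have "flip_vertex -` (Up ` A \<union> Dn ` C) = Up ` C \<union> Dn ` A"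
  proof (rule Set.set_eqI)
    fix v show "v \<in> flip_vertex -` (Up ` A \<union> Dn ` C) \<longleftrightarrow> v \<in> Up ` C \<union> Dn ` A"
      by (cases v) auto
  qed
  then show ?thesis by (simp add: dmat_def flip_diag_def saturated_image)
qed

text \<open>Flipping transposes the matrix, and transposition reverses products while keeping the
  count of intermediate sets.\<close>

lemma flip_compose_diag:
  assumes p: "p \<in> diagrams n m" and q: "q \<in> diagrams m r"
  shows "compose_diag r m n (flip_diag q) (flip_diag p) = flip_diag (compose_diag n m r p q)"
    and "loops r m n (flip_diag q) (flip_diag p) = loops n m r p q"
proof -
  note * = compose_diag_eqI[OF flip_diag_in_diagrams[OF q] flip_diag_in_diagrams[OF p]
      flip_diag_in_diagrams[OF compose_diag_in_diagrams[OF p q]], of "loops n m r p q"]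
  show "compose_diag r m n (flip_diag q) (flip_diag p) = flip_diag (compose_diag n m r p q)"
    "loops r m n (flip_diag q) (flip_diag p) = loops n m r p q"
    by (rule *; simp add: dmat_flip card_dmat_compose[OF p q, symmetric] conj_commute)+
qed

definition perm_diag :: "nat \<Rightarrow> (nat \<Rightarrow> nat) \<Rightarrow> diagram" where
  "perm_diag n \<pi> = (\<lambda>i. {Up (\<pi> i), Dn i}) ` {1..n}"

lemma id_diag_eq: "id_diag n = perm_diag n id"
  by (simp add: id_diag_def perm_diag_def)

lemma perm_diag_in_diagrams:
  assumes "\<pi> permutes {1..n}" shows "perm_diag n \<pi> \<in> diagrams n n"
proof -
  have inj: "inj \<pi>" using assms by (rule permutes_inj)
  have "\<Union>(perm_diag n \<pi>) = Up ` \<pi> ` {1..n} \<union> Dn ` {1..n}" by (auto simp: perm_diag_def)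
  then have "\<Union>(perm_diag n \<pi>) = Up ` {1..n} \<union> Dn ` {1..n}"
    using permutes_image[OF assms] by simp
  moreover have "disjoint (perm_diag n \<pi>)"
    by (auto simp: perm_diag_def disjoint_def dest: injD[OF inj])
  ultimately show ?thesis
    by (auto simp: diagrams_def partition_on_def perm_diag_def)
qed

lemma dmat_perm_diag:
  assumes \<pi>: "\<pi> permutes {1..n}" and A: "A \<subseteq> {1..n}" and C: "C \<subseteq> {1..n}"
  shows "dmat (perm_diag n \<pi>) A C \<longleftrightarrow> A = \<pi> ` C"
proof -
  have inj: "inj \<pi>" using \<pi> by (rule permutes_inj)
  have "dmat (perm_diag n \<pi>) A C \<longleftrightarrow> (\<forall>i\<in>{1..n}. \<pi> i \<in> A \<longleftrightarrow> i \<in> C)"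
    by (auto simp: dmat_def saturated_iff perm_diag_def)
  also have "\<dots> \<longleftrightarrow> A = \<pi> ` C"
  proof
    assume *: "\<forall>i\<in>{1..n}. \<pi> i \<in> A \<longleftrightarrow> i \<in> C"
    show "A = \<pi> ` C"
    proof (intro Set.set_eqI iffI)
      fix x assume x: "x \<in> A"
      then have "x \<in> \<pi> ` {1..n}" using A permutes_image[OF \<pi>] by auto
      then show "x \<in> \<pi> ` C" using * x by blast
    next
      fix x assume "x \<in> \<pi> ` C" then show "x \<in> A" using * C by blast
    qed
  next
    assume "A = \<pi> ` C" then show "\<forall>i\<in>{1..n}. \<pi> i \<in> A \<longleftrightarrow> i \<in> C"
      using inj by (auto dest: injD)
  qed
  finally show ?thesis .
qed

lemma compose_perm_diag_right:
  assumes p: "p \<in> diagrams m n" and \<pi>: "\<pi> permutes {1..n}"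
    and s: "s \<in> diagrams m n"
    and eq: "\<And>A C. A \<subseteq> {1..m} \<Longrightarrow> C \<subseteq> {1..n} \<Longrightarrow> dmat s A C \<longleftrightarrow> dmat p A (\<pi> ` C)"
  shows "compose_diag m n n p (perm_diag n \<pi>) = s" "loops m n n p (perm_diag n \<pi>) = 0"
proof -
  have *: "card {B. B \<subseteq> {1..n} \<and> dmat p A B \<and> dmat (perm_diag n \<pi>) B C} =
      2 ^ 0 * of_bool (dmat s A C)" if A: "A \<subseteq> {1..m}" and C: "C \<subseteq> {1..n}" for A C
  proof -
    have "\<pi> ` C \<subseteq> {1..n}" using C permutes_image[OF \<pi>] by blast
    then have "{B. B \<subseteq> {1..n} \<and> dmat p A B \<and> dmat (perm_diag n \<pi>) B C} =
        (if dmat p A (\<pi> ` C) then {\<pi> ` C} else {})"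
      using dmat_perm_diag[OF \<pi> _ C] by auto
    then show ?thesis using eq[OF A C] by simp
  qed
  show "compose_diag m n n p (perm_diag n \<pi>) = s" "loops m n n p (perm_diag n \<pi>) = 0"
    using compose_diag_eqI[OF p perm_diag_in_diagrams[OF \<pi>] s *] by auto
qed

lemma compose_id_diag_right:
  assumes "p \<in> diagrams m n"
  shows "compose_diag m n n p (id_diag n) = p" "loops m n n p (id_diag n) = 0"
  unfolding id_diag_eq
  by (rule compose_perm_diag_right[OF assms permutes_id assms]; simp)+

lemma flip_id_diag: "flip_diag (id_diag n) = id_diag n"
  by (simp add: flip_diag_def id_diag_def image_image insert_commute)

lemma id_diag_in_diagrams: "id_diag n \<in> diagrams n n"
  unfolding id_diag_eq by (rule perm_diag_in_diagrams[OF permutes_id])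

lemma compose_id_diag_left:
  assumes "p \<in> diagrams n m"
  shows "compose_diag n n m (id_diag n) p = p" "loops n n m (id_diag n) p = 0"
  using flip_compose_diag[OF flip_diag_in_diagrams[OF assms] id_diag_in_diagrams]
    compose_id_diag_right[OF flip_diag_in_diagrams[OF assms]]
  by (simp_all add: flip_id_diag)


section \<open>The index order\<close>

text \<open>As membership of a difference in a cone, an inequality of the index order becomes
  additive and can be summed over the parts of a stack. Only coordinates in \<open>{1..l}\<close>
  are constrained.\<close>

definition fusion_cone :: "nat \<Rightarrow> (nat \<Rightarrow> int) set" where
  "fusion_cone l = {v. \<exists>c :: nat \<Rightarrow> nat \<Rightarrow> nat. \<forall>k\<in>{1..l}.
     v k = (\<Sum>j\<in>{1..l}. \<Sum>i\<in>{1..j}. int (c i j) * fusion_vec l i j k)}"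

lemma index_le_iff: "index_le l m' m \<longleftrightarrow> (\<lambda>k. int (m' k) - int (m k)) \<in> fusion_cone l"
  by (simp add: index_le_def fusion_cone_def)

lemma fusion_cone_zero: "(\<lambda>_. 0) \<in> fusion_cone l"
  unfolding fusion_cone_def by (auto intro!: exI[of _ "\<lambda>_ _. 0"])

lemma fusion_cone_add:
  assumes "v \<in> fusion_cone l" "w \<in> fusion_cone l"
  shows "(\<lambda>k. v k + w k) \<in> fusion_cone l"
proof -
  from assms obtain c d :: "nat \<Rightarrow> nat \<Rightarrow> nat" where
    "\<forall>k\<in>{1..l}. v k = (\<Sum>j\<in>{1..l}. \<Sum>i\<in>{1..j}. int (c i j) * fusion_vec l i j k)"
    "\<forall>k\<in>{1..l}. w k = (\<Sum>j\<in>{1..l}. \<Sum>i\<in>{1..j}. int (d i j) * fusion_vec l i j k)"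
    unfolding fusion_cone_def by auto
  then show ?thesis
    unfolding fusion_cone_def
    by (auto intro!: exI[of _ "\<lambda>i j. c i j + d i j"] simp: distrib_right sum.distrib)
qed

lemma fusion_cone_cong:
  assumes "v \<in> fusion_cone l" "\<And>k. k \<in> {1..l} \<Longrightarrow> v k = w k"
  shows "w \<in> fusion_cone l"
  using assms unfolding fusion_cone_def by auto

lemma fusion_cone_sum:
  assumes "finite T" "\<And>t. t \<in> T \<Longrightarrow> v t \<in> fusion_cone l"
  shows "(\<lambda>k. \<Sum>t\<in>T. v t k) \<in> fusion_cone l"
  using assms
  by (induction T rule: finite_induct) (auto intro: fusion_cone_zero fusion_cone_add)

lemma std_vec_cong: "[i = j] (mod l) \<Longrightarrow> std_vec l i = std_vec l j"
  by (auto simp: std_vec_def fun_eq_iff cong_def)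

lemma fusion_vec_cong:
  assumes "[i = i'] (mod l)" "[j = j'] (mod l)"
  shows "fusion_vec l i j = fusion_vec l i' j'"
  using std_vec_cong[OF assms(1)] std_vec_cong[OF assms(2)] std_vec_cong[OF cong_add[OF assms]]
  by (simp add: fusion_vec_def fun_eq_iff)

lemma ex_residue:
  fixes i l :: nat
  assumes "l \<ge> 1" shows "\<exists>k\<in>{1..l}. [i = k] (mod l)"
proof (cases "i mod l = 0")
  \<comment> \<open>Residues are taken in \<open>{1..l}\<close>, so residue zero is represented by
    \<open>l\<close>.\<close>
  case True
  then show ?thesis using assms by (auto simp: cong_def intro!: bexI[of _ l])
next
  case False
  moreover have "i mod l < l" using assms by simp
  ultimately show ?thesis by (auto simp: cong_def intro!: bexI[of _ "i mod l"])
qed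

lemma residue_unique:
  fixes i j l :: nat
  assumes "i \<in> {1..l}" "j \<in> {1..l}" "[i = j] (mod l)" shows "i = j"
proof -
  \<comment> \<open>Moving \<open>{1..l}\<close> down by one gives the standard representatives
    below \<open>l\<close>.\<close>
  have "[i - 1 = j - 1] (mod l)"
    using assms cong_add_rcancel_nat[of "i - 1" 1 "j - 1" l] by simp
  moreover have "i - 1 < l" "j - 1 < l" using assms(1,2) by auto
  ultimately have "i - 1 = j - 1" by (simp add: cong_def)
  then show ?thesis using assms(1,2) by auto
qed

text \<open>The cone is generated by ordered pairs of indices in \<open>{1..l}\<close>. Arbitrary
  indices are reduced modulo \<open>l\<close>, and symmetry of the fusion vector handles the order
  of the pair.\<close>

lemma fusion_vec_in_cone:
  assumes "l \<ge> 1" shows "fusion_vec l i j \<in> fusion_cone l"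
proof -
  have *: "fusion_vec l a b \<in> fusion_cone l" if "a \<in> {1..l}" "b \<in> {1..l}" "a \<le> b" for a b
  proof -
    have "(\<Sum>j\<in>{1..l}. \<Sum>i\<in>{1..j}. int (of_bool (i = a \<and> j = b)) * fusion_vec l i j k) =
        fusion_vec l a b k" for k
    proof -
      have "(\<Sum>i\<in>{1..j}. int (of_bool (i = a \<and> j = b)) * fusion_vec l i j k) =
          (if j = b then fusion_vec l a b k else 0)" for j
      proof (cases "j = b")
        case True
        have "(\<Sum>i\<in>{1..j}. int (of_bool (i = a \<and> j = b)) * fusion_vec l i j k) =
            (\<Sum>i\<in>{1..j}. if i = a then fusion_vec l a b k else 0)"
          by (rule sum.cong) (use True in auto)
        then show ?thesis using that True by simp
      qed simp
      then show ?thesis using that by simp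
    qed
    then show ?thesis
      unfolding fusion_cone_def by (intro CollectI exI[of _ "\<lambda>i j. of_bool (i = a \<and> j = b)"]) simp
  qed
  obtain a where a: "a \<in> {1..l}" "[i = a] (mod l)" using ex_residue[OF assms] by blast
  obtain b where b: "b \<in> {1..l}" "[j = b] (mod l)" using ex_residue[OF assms] by blast
  have eq: "fusion_vec l i j = fusion_vec l a b" by (rule fusion_vec_cong[OF a(2) b(2)])
  show ?thesis
  proof (cases "a \<le> b")
    case True then show ?thesis using * a b eq by simp
  next
    case False
    moreover have "fusion_vec l a b = fusion_vec l b a"
      by (simp add: fusion_vec_def fun_eq_iff add.commute)
    ultimately show ?thesis using *[OF b(1) a(1)] eq by simp
  qed
qed

lemma sum_std_vec:
  assumes "l \<ge> 1" shows "(\<Sum>k\<in>{1..l}. std_vec l i k) = 1"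
proof -
  obtain a where a: "a \<in> {1..l}" "[i = a] (mod l)" using ex_residue[OF assms] by blast
  have "[k = a] (mod l) \<longleftrightarrow> k = a" if "k \<in> {1..l}" for k
    using residue_unique[OF that a(1)] by auto
  then have "(\<Sum>k\<in>{1..l}. std_vec l i k) = (\<Sum>k\<in>{1..l}. if k = a then 1 else 0)"
    unfolding std_vec_cong[OF a(2)] std_vec_def by (intro sum.cong) auto
  then show ?thesis using a by simp
qed

text \<open>Each fusion vector has coordinate sum \<open>-1\<close>, so the coordinate sum vanishes only at the apex
  of the cone.\<close>

lemma fusion_cone_pointed:
  assumes l: "l \<ge> 1" and v: "v \<in> fusion_cone l" and w: "(\<lambda>k. - v k) \<in> fusion_cone l"
    and k: "k \<in> {1..l}"
  shows "v k = 0"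
proof -
  have total: "(\<Sum>k\<in>{1..l}. v k) = - (\<Sum>j\<in>{1..l}. \<Sum>i\<in>{1..j}. int (c i j))"
    if "\<forall>k\<in>{1..l}. v k = (\<Sum>j\<in>{1..l}. \<Sum>i\<in>{1..j}. int (c i j) * fusion_vec l i j k)"
    for v and c :: "nat \<Rightarrow> nat \<Rightarrow> nat"
  proof -
    have fv: "(\<Sum>k\<in>{1..l}. fusion_vec l i j k) = - 1" for i j
      unfolding fusion_vec_def sum_subtractf by (simp only: sum_std_vec[OF l])
    have "(\<Sum>k\<in>{1..l}. v k) =
        (\<Sum>k\<in>{1..l}. \<Sum>j\<in>{1..l}. \<Sum>i\<in>{1..j}. int (c i j) * fusion_vec l i j k)"
      using that by simp
    also have "\<dots> = (\<Sum>j\<in>{1..l}. \<Sum>k\<in>{1..l}. \<Sum>i\<in>{1..j}. int (c i j) * fusion_vec l i j k)"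
      by (rule sum.swap)
    also have "\<dots> = (\<Sum>j\<in>{1..l}. \<Sum>i\<in>{1..j}. \<Sum>k\<in>{1..l}. int (c i j) * fusion_vec l i j k)"
      by (rule sum.cong[OF refl sum.swap])
    also have "\<dots> = - (\<Sum>j\<in>{1..l}. \<Sum>i\<in>{1..j}. int (c i j))"
      by (simp only: fv flip: sum_distrib_left) (simp add: sum_negf)
    finally show ?thesis .
  qed
  from v obtain c :: "nat \<Rightarrow> nat \<Rightarrow> nat" where
    c: "\<forall>k\<in>{1..l}. v k = (\<Sum>j\<in>{1..l}. \<Sum>i\<in>{1..j}. int (c i j) * fusion_vec l i j k)"
    unfolding fusion_cone_def by auto
  from w obtain d :: "nat \<Rightarrow> nat \<Rightarrow> nat" where
    d: "\<forall>k\<in>{1..l}. - v k = (\<Sum>j\<in>{1..l}. \<Sum>i\<in>{1..j}. int (d i j) * fusion_vec l i j k)"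
    unfolding fusion_cone_def by auto
  have nn: "0 \<le> (\<Sum>j\<in>{1..l}. \<Sum>i\<in>{1..j}. int (c i j))" "0 \<le> (\<Sum>j\<in>{1..l}. \<Sum>i\<in>{1..j}. int (d i j))"
    by (intro sum_nonneg; simp)+
  have "(\<Sum>j\<in>{1..l}. \<Sum>i\<in>{1..j}. int (c i j)) = 0"
    using total[OF c] total[OF d] nn by (simp add: sum_negf)
  then have "\<forall>j\<in>{1..l}. (\<Sum>i\<in>{1..j}. int (c i j)) = 0"
    by (subst (asm) sum_nonneg_eq_0_iff) (auto intro: sum_nonneg)
  then have "\<forall>j\<in>{1..l}. \<forall>i\<in>{1..j}. int (c i j) = 0"
    by (subst (asm) sum_nonneg_eq_0_iff) auto
  then show ?thesis using c k by simp
qed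

lemma index_le_trans: "index_le l m m' \<Longrightarrow> index_le l m' m'' \<Longrightarrow> index_le l m m''"
  unfolding index_le_iff by (drule (1) fusion_cone_add) simp

lemma index_le_antisym:
  assumes "l \<ge> 1" "index_le l m m'" "index_le l m' m" "k \<in> {1..l}"
  shows "m k = m' k"
  using fusion_cone_pointed[of l "\<lambda>k. int (m k) - int (m' k)" k] assms
  by (simp add: index_le_iff)

text \<open>Parts are fused one after the other; adding a part of size \<open>g x\<close> to a
  partial merger changes the total by the fusion vector of the two sizes.\<close>

lemma merge_in_cone:
  assumes l: "l \<ge> 1" and "finite F" "F \<noteq> {}"
  shows "(\<lambda>k. std_vec l (\<Sum>s\<in>F. g s) k - (\<Sum>s\<in>F. std_vec l (g s) k)) \<in> fusion_cone l"
  using assms(2,3)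
proof (induction F rule: finite_ne_induct)
  case (singleton x)
  show ?case by (simp add: fusion_cone_zero)
next
  case (insert x F)
  show ?case
    by (rule fusion_cone_cong[OF fusion_cone_add[OF insert.IH
          fusion_vec_in_cone[OF l, of "g x" "\<Sum>s\<in>F. g s"]]])
      (use insert.hyps in \<open>simp add: fusion_vec_def\<close>)
qed

text \<open>Parts whose sizes add up to 0 modulo \<open>l\<close> may disappear together: they first
  merge into one part of residue 0, which is then removed as explained in the proof.\<close>

lemma vanish_in_cone:
  assumes l: "l \<ge> 1" and "finite F" and "[(\<Sum>s\<in>F. g s) = 0] (mod l)"
  shows "(\<lambda>k. - (\<Sum>s\<in>F. std_vec l (g s) k)) \<in> fusion_cone l"
proof (cases "F = {}")
  case True then show ?thesis by (simp add: fusion_cone_zero)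
next
  case False
  \<comment> \<open>\<open>fusion_vec l 0 0\<close> equals \<open>- std_vec l 0\<close>, so adding
    it cancels the merged part.\<close>
  have "(\<lambda>k. (std_vec l (\<Sum>s\<in>F. g s) k - (\<Sum>s\<in>F. std_vec l (g s) k)) + fusion_vec l 0 0 k)
      \<in> fusion_cone l"
    by (rule fusion_cone_add[OF merge_in_cone[OF l assms(2) False] fusion_vec_in_cone[OF l]])
  then show ?thesis
    by (rule fusion_cone_cong) (simp add: fusion_vec_def std_vec_cong[OF assms(3)])
qed


section \<open>Tone and propagating vectors of a product\<close>

definition tonal :: "nat \<Rightarrow> diagram \<Rightarrow> bool" where
  "tonal l p \<longleftrightarrow> (\<forall>s\<in>p. [card (s \<inter> range Up) = card (s \<inter> range Dn)] (mod l))"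

lemma tonal_diagrams_iff: "p \<in> tonal_diagrams l n \<longleftrightarrow> p \<in> diagrams n n \<and> tonal l p"
  by (simp add: tonal_diagrams_def tonal_def)

lemma tonalD: "tonal l p \<Longrightarrow> s \<in> p \<Longrightarrow> [card (s \<inter> range Up) = card (s \<inter> range Dn)] (mod l)"
  by (simp add: tonal_def)

definition prop_parts :: "diagram \<Rightarrow> diagram" where
  "prop_parts p = {s \<in> p. propagating s}"

text \<open>A sum of unit vectors over propagating parts, unlike a cardinality for each residue, can
  be regrouped according to the parts of a stack.\<close>

lemma prop_vector_upper:
  assumes "finite p" "k \<in> {1..l}"
  shows "int (prop_vector l p k) = (\<Sum>s\<in>prop_parts p. std_vec l (card (s \<inter> range Up)) k)"
proof -
  have "prop_vector l p k =
      card (prop_parts p \<inter> {s. [k = card (s \<inter> range Up)] (mod l)})"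
    unfolding prop_vector_def prop_parts_def using assms(2)
    by (auto intro!: arg_cong[of _ _ card] simp: cong_sym_eq)
  then show ?thesis using assms(1) by (simp add: std_vec_def sum.If_cases prop_parts_def)
qed

lemma prop_vector_lower:
  assumes "finite p" "k \<in> {1..l}" "tonal l p"
  shows "int (prop_vector l p k) = (\<Sum>s\<in>prop_parts p. std_vec l (card (s \<inter> range Dn)) k)"
  unfolding prop_vector_upper[OF assms(1,2)]
  by (rule sum.cong) (use assms(3) in \<open>auto simp: prop_parts_def tonal_def intro: fun_cong[OF std_vec_cong]\<close>)

lemma prop_vector_zero: "k \<notin> {1..l} \<Longrightarrow> prop_vector l p k = 0"
  by (auto simp: prop_vector_def)

lemma sum_prop_vector:
  assumes "l \<ge> 1" "finite p"
  shows "(\<Sum>k\<in>{1..l}. prop_vector l p k) = card (prop_parts p)"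
proof -
  have "int (\<Sum>k\<in>{1..l}. prop_vector l p k) =
      (\<Sum>k\<in>{1..l}. \<Sum>s\<in>prop_parts p. std_vec l (card (s \<inter> range Up)) k)"
    using prop_vector_upper[OF assms(2)] by simp
  also have "\<dots> = int (card (prop_parts p))"
    by (subst sum.swap) (simp add: sum_std_vec[OF assms(1), simplified])
  finally show ?thesis by (simp only: of_nat_eq_iff)
qed

lemma diagrams_part_cases:
  assumes "p \<in> diagrams n m" "s \<in> p" "\<not> propagating s"
  shows "s \<subseteq> range Up \<or> s \<subseteq> range Dn"
proof -
  have "s \<subseteq> range Up \<union> range Dn" using diagrams_part_subset[OF assms(1,2)] by auto
  then show ?thesis using assms(3) unfolding propagating_def by blast
qed

lemma tonal_nonprop:
  assumes p: "p \<in> diagrams n m" "tonal l p" and s: "s \<in> p" "\<not> propagating s"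
  shows "[card (s \<inter> range Dn) = 0] (mod l)"
proof (cases "s \<inter> range Dn = {}")
  case False
  then have "s \<inter> range Up = {}" using s by (auto simp: propagating_def)
  then show ?thesis using tonalD[OF p(2) s(1)] by (simp add: cong_sym_eq)
qed simp

text \<open>Every part of \<open>p\<close> is carried into a single part of \<open>r\<close>, so
  \<open>t\<close> meets the image of \<open>U\<close> in a disjoint union of images of parts. Here
  \<open>f\<close> will embed one factor into a stack and \<open>W\<close> will select a
  row.\<close>

lemma card_fibre_sum:
  assumes p: "partition_on U p" and r: "partition_on V r" and fin: "finite U"
    and sub: "\<And>s. s \<in> p \<Longrightarrow> \<exists>t\<in>r. f ` s \<subseteq> t" and inj: "inj_on f U" and t: "t \<in> r"
  shows "card (t \<inter> f ` (U \<inter> W)) = (\<Sum>s\<in>{s \<in> p. f ` s \<subseteq> t}. card (s \<inter> W))"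
proof -
  let ?P = "{s \<in> p. f ` s \<subseteq> t}"
  have subU: "s \<subseteq> U" if "s \<in> p" for s using partition_on_subset[OF p that] .
  have eq: "t \<inter> f ` (U \<inter> W) = (\<Union>s\<in>?P. f ` (s \<inter> W))"
  proof (intro Set.set_eqI iffI)
    fix y assume "y \<in> t \<inter> f ` (U \<inter> W)"
    then obtain x where x: "x \<in> U" "x \<in> W" "y = f x" "f x \<in> t" by blast
    obtain s where s: "s \<in> p" "x \<in> s" using partition_on_ex_part[OF p x(1)] by blast
    then obtain t' where t': "t' \<in> r" "f ` s \<subseteq> t'" using sub by blast
    then have "t' = t" using partition_on_partsD[OF r _ t, of t' "f x"] x s by blast
    then show "y \<in> (\<Union>s\<in>?P. f ` (s \<inter> W))" using s t' x by blast
  next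
    fix y assume "y \<in> (\<Union>s\<in>?P. f ` (s \<inter> W))"
    then obtain s x where "s \<in> p" "f ` s \<subseteq> t" "x \<in> s" "x \<in> W" "y = f x" by blast
    then show "y \<in> t \<inter> f ` (U \<inter> W)" using subU[of s] by blast
  qed
  have finp: "finite p" using finite_elements[OF fin p] .
  have "card (\<Union>s\<in>?P. f ` (s \<inter> W)) = (\<Sum>s\<in>?P. card (f ` (s \<inter> W)))"
  proof (rule card_UN_disjoint)
    show "finite ?P" using finp by simp
    show "\<forall>s\<in>?P. finite (f ` (s \<inter> W))" using subU fin by (auto intro: finite_subset)
    show "\<forall>s\<in>?P. \<forall>s'\<in>?P. s \<noteq> s' \<longrightarrow> f ` (s \<inter> W) \<inter> f ` (s' \<inter> W) = {}"
    proof (intro ballI impI, rule ccontr)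
      fix s s' assume s: "s \<in> ?P" "s' \<in> ?P" "s \<noteq> s'" "f ` (s \<inter> W) \<inter> f ` (s' \<inter> W) \<noteq> {}"
      then obtain x x' where "x \<in> s" "x' \<in> s'" "f x = f x'" by blast
      moreover then have "x = x'" using inj subU s by (metis (no_types, lifting) inj_on_def mem_Collect_eq subsetD)
      ultimately show False using partition_on_partsD[OF p, of s s'] s by blast
    qed
  qed
  also have "\<dots> = (\<Sum>s\<in>?P. card (s \<inter> W))"
  proof (rule sum.cong[OF refl card_image])
    fix s assume "s \<in> ?P"
    then show "inj_on f (s \<inter> W)" using inj subU by (auto intro: inj_on_subset)
  qed
  finally show ?thesis using eq by simp
qed

section \<open>Vertex counts in a stack, and the effect of the lower factor\<close>

context
  fixes l n m r :: nat and p q :: diagram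
  assumes p: "p \<in> diagrams n m" and q: "q \<in> diagrams m r"
begin

private abbreviation (input) "st \<equiv> stack n m r p q"
private abbreviation (input) "lower t \<equiv> {s \<in> q. up_to_mid ` s \<subseteq> t}"

private lemma stack_part_subset:
  "t \<in> st \<Longrightarrow> t \<subseteq> Up ` {1..n} \<union> Mid ` {1..m} \<union> Dn ` {1..r}"
  by (rule partition_on_subset[OF partition_on_stack[OF p q]])

private lemma stack_part_cong: "t \<in> st \<Longrightarrow> t' \<in> st \<Longrightarrow> x \<in> t \<Longrightarrow> x \<in> t' \<Longrightarrow> t = t'"
  by (rule partition_on_partsD[OF partition_on_stack[OF p q]])

private lemma inj_to_mid:
  "inj_on dn_to_mid (Up ` {1..n} \<union> Dn ` {1..m})" "inj_on up_to_mid (Up ` {1..m} \<union> Dn ` {1..r})"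
  by (auto simp: inj_on_def)

private lemma Up_Dn_Int:
  "(Up ` A \<union> Dn ` B) \<inter> range Up = Up ` A" "(Up ` A \<union> Dn ` B) \<inter> range Dn = Dn ` B"
  by auto

lemma card_stack_upper:
  assumes t: "t \<in> st"
  shows "card (t \<inter> range Up) = (\<Sum>s\<in>{s \<in> p. dn_to_mid ` s \<subseteq> t}. card (s \<inter> range Up))"
    and "card (t \<inter> range Mid) = (\<Sum>s\<in>{s \<in> p. dn_to_mid ` s \<subseteq> t}. card (s \<inter> range Dn))"
proof -
  note * = card_fibre_sum[OF diagramsD[OF p] partition_on_stack[OF p q] _ stack_upper[OF p q]
    inj_to_mid(1) t]
  have "t \<inter> range Up = t \<inter> dn_to_mid ` ((Up ` {1..n} \<union> Dn ` {1..m}) \<inter> range Up)"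
    unfolding Up_Dn_Int by (use stack_part_subset[OF t] in \<open>auto simp: image_image\<close>)
  then show "card (t \<inter> range Up) = (\<Sum>s\<in>{s \<in> p. dn_to_mid ` s \<subseteq> t}. card (s \<inter> range Up))"
    using *[of "range Up"] by simp
  have "t \<inter> range Mid = t \<inter> dn_to_mid ` ((Up ` {1..n} \<union> Dn ` {1..m}) \<inter> range Dn)"
    unfolding Up_Dn_Int by (use stack_part_subset[OF t] in \<open>auto simp: image_image\<close>)
  then show "card (t \<inter> range Mid) = (\<Sum>s\<in>{s \<in> p. dn_to_mid ` s \<subseteq> t}. card (s \<inter> range Dn))"
    using *[of "range Dn"] by simp
qed

lemma card_stack_lower:
  assumes t: "t \<in> st"
  shows "card (t \<inter> range Mid) = (\<Sum>s\<in>lower t. card (s \<inter> range Up))"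
    and "card (t \<inter> range Dn) = (\<Sum>s\<in>lower t. card (s \<inter> range Dn))"
proof -
  note * = card_fibre_sum[OF diagramsD[OF q] partition_on_stack[OF p q] _ stack_lower[OF p q]
    inj_to_mid(2) t]
  have "t \<inter> range Mid = t \<inter> up_to_mid ` ((Up ` {1..m} \<union> Dn ` {1..r}) \<inter> range Up)"
    unfolding Up_Dn_Int by (use stack_part_subset[OF t] in \<open>auto simp: image_image\<close>)
  then show "card (t \<inter> range Mid) = (\<Sum>s\<in>lower t. card (s \<inter> range Up))"
    using *[of "range Up"] by simp
  have "t \<inter> range Dn = t \<inter> up_to_mid ` ((Up ` {1..m} \<union> Dn ` {1..r}) \<inter> range Dn)"
    unfolding Up_Dn_Int by (use stack_part_subset[OF t] in \<open>auto simp: image_image\<close>)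
  then show "card (t \<inter> range Dn) = (\<Sum>s\<in>lower t. card (s \<inter> range Dn))"
    using *[of "range Dn"] by simp
qed

text \<open>The middle row mediates: its vertices in \<open>t\<close> are counted once as lower
  vertices of \<open>p\<close> and once as upper vertices of \<open>q\<close>.\<close>

lemma tonal_stack:
  assumes "tonal l p" "tonal l q" and t: "t \<in> st"
  shows "[card (t \<inter> range Up) = card (t \<inter> range Dn)] (mod l)"
proof -
  have "[card (t \<inter> range Up) = card (t \<inter> range Mid)] (mod l)"
    unfolding card_stack_upper[OF t] by (rule cong_sum) (use assms in \<open>auto simp: tonal_def\<close>)
  also have "[card (t \<inter> range Mid) = card (t \<inter> range Dn)] (mod l)"
    unfolding card_stack_lower[OF t] by (rule cong_sum) (use assms in \<open>auto simp: tonal_def\<close>)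
  finally show ?thesis .
qed

private lemma minus_Mid:
  "(t - range Mid) \<inter> range Up = t \<inter> range Up" "(t - range Mid) \<inter> range Dn = t \<inter> range Dn"
  by auto

lemma tonal_compose_diag:
  assumes "tonal l p" "tonal l q" shows "tonal l (compose_diag n m r p q)"
  unfolding tonal_def compose_diag_def using tonal_stack[OF assms] by (auto simp: minus_Mid)

text \<open>Without a propagating part of \<open>q\<close> inside \<open>t\<close>, the lower vertices of \<open>t\<close> would form a
  saturated set.\<close>

lemma stack_propagating_lower:
  assumes t: "t \<in> st" "propagating t"
  shows "\<exists>s\<in>lower t. propagating s"
proof (rule ccontr)
  assume no: "\<not> (\<exists>s\<in>lower t. propagating s)"
  have "dn_to_mid -` (t \<inter> range Dn) = {}"
  proof -
    have "dn_to_mid x \<notin> range Dn" for x by (cases x) auto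
    then show ?thesis by blast
  qed
  moreover have "saturated q (up_to_mid -` (t \<inter> range Dn))"
    unfolding saturated_def
  proof
    fix s assume s: "s \<in> q"
    show "s \<subseteq> up_to_mid -` (t \<inter> range Dn) \<or> s \<inter> up_to_mid -` (t \<inter> range Dn) = {}"
    proof (cases "up_to_mid ` s \<subseteq> t")
      case True
      then have "\<not> propagating s" using no s by blast
      then consider "s \<subseteq> range Up" | "s \<subseteq> range Dn" using diagrams_part_cases[OF q s] by blast
      then show ?thesis
      proof cases
        case 1 then show ?thesis by fastforce
      next
        case 2
        then have "up_to_mid x = x" if "x \<in> s" for x using that by auto
        then show ?thesis using True 2 by auto
      qed
    next
      case False
      obtain t' where t': "t' \<in> st" "up_to_mid ` s \<subseteq> t'" using stack_lower[OF p q s] by blast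
      then have "t' \<inter> t = {}" using stack_part_cong[OF t(1) t'(1)] False by blast
      then show ?thesis using t' by blast
    qed
  qed
  ultimately have "saturated st (t \<inter> range Dn)"
    unfolding saturated_stack[OF p q] by (simp add: saturated_def)
  then have "t \<subseteq> t \<inter> range Dn \<or> t \<inter> (t \<inter> range Dn) = {}" using t(1) by (auto simp: saturated_def)
  then show False using t(2) unfolding propagating_def by blast
qed

text \<open>Gluing happens along the middle row only. A part of \<open>q\<close> without upper
  vertices is therefore saturated for the stack and cannot grow.\<close>

lemma stack_lower_part:
  assumes s: "s \<in> q" "s \<subseteq> range Dn" shows "s \<in> st"
proof -
  have "dn_to_mid -` s = {}"
  proof -
    have "dn_to_mid x \<notin> range Dn" for x by (cases x) auto
    then show ?thesis using s by blast
  qed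
  moreover have "up_to_mid -` s = s"
  proof (rule Set.set_eqI)
    fix x show "x \<in> up_to_mid -` s \<longleftrightarrow> x \<in> s" using s(2) diagrams_part_subset[OF q s(1)] by (cases x) auto
  qed
  ultimately have sat: "saturated st s"
    unfolding saturated_stack[OF p q]
    using saturated_part[OF diagramsD[OF q] s(1)] by (simp add: saturated_def)
  have im: "up_to_mid ` s = s" using s(2) by force
  obtain t where t: "t \<in> st" "s \<subseteq> t" using stack_lower[OF p q s(1)] im by auto
  moreover have "s \<noteq> {}" using diagrams_part_ne[OF q s(1)] .
  ultimately have "t \<subseteq> s" using sat unfolding saturated_def by blast
  then show ?thesis using t by auto
qed

text \<open>Propagating parts keep vertices in the outer rows, so deleting the middle vertices
  neither identifies nor destroys them.\<close>

lemma bij_betw_prop_parts: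
  "bij_betw (\<lambda>t. t - range Mid) (prop_parts st) (prop_parts (compose_diag n m r p q))"
  unfolding bij_betw_def
proof
  show "inj_on (\<lambda>t. t - range Mid) (prop_parts st)"
  proof (rule inj_onI)
    fix t t' assume t: "t \<in> prop_parts st" "t' \<in> prop_parts st" "t - range Mid = t' - range Mid"
    then obtain x where "x \<in> t" "x \<in> range Up" by (auto simp: prop_parts_def propagating_def)
    then have "x \<in> t'" using t(3) by blast
    then show "t = t'" using stack_part_cong t \<open>x \<in> t\<close> by (auto simp: prop_parts_def)
  qed
  show "(\<lambda>t. t - range Mid) ` prop_parts st = prop_parts (compose_diag n m r p q)"
  proof (intro Set.set_eqI iffI)
    fix u assume "u \<in> (\<lambda>t. t - range Mid) ` prop_parts st"
    then obtain t where t: "t \<in> st" "propagating t" "u = t - range Mid" by (auto simp: prop_parts_def)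
    then have "propagating u" unfolding propagating_def by (simp add: minus_Mid)
    moreover then have "u \<noteq> {}" by (auto simp: propagating_def)
    ultimately show "u \<in> prop_parts (compose_diag n m r p q)"
      using t by (auto simp: prop_parts_def compose_diag_def)
  next
    fix u assume "u \<in> prop_parts (compose_diag n m r p q)"
    then show "u \<in> (\<lambda>t. t - range Mid) ` prop_parts st"
      by (auto simp: prop_parts_def compose_diag_def propagating_def minus_Mid)
  qed
qed

private lemma finite_st: "finite st"
  by (rule finite_elements[OF _ partition_on_stack[OF p q]]) auto

private lemma sum_prop_lower:
  "(\<Sum>s\<in>prop_parts q. g s) = (\<Sum>t\<in>st. \<Sum>s\<in>prop_parts (lower t). g s)"
proof -
  have "prop_parts q = (\<Union>t\<in>st. prop_parts (lower t))"
    using stack_lower[OF p q] by (auto simp: prop_parts_def)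
  moreover have "(\<Sum>s\<in>(\<Union>t\<in>st. prop_parts (lower t)). g s) =
      (\<Sum>t\<in>st. \<Sum>s\<in>prop_parts (lower t). g s)"
  proof (rule sum.UNION_disjoint[OF finite_st])
    show "\<forall>t\<in>st. finite (prop_parts (lower t))"
      using finite_diagram[OF q] by (simp add: prop_parts_def)
    show "\<forall>t\<in>st. \<forall>t'\<in>st. t \<noteq> t' \<longrightarrow> prop_parts (lower t) \<inter> prop_parts (lower t') = {}"
    proof (intro ballI impI, rule ccontr)
      fix t t' assume t: "t \<in> st" "t' \<in> st" "t \<noteq> t'"
        and "prop_parts (lower t) \<inter> prop_parts (lower t') \<noteq> {}"
      then obtain s where s: "s \<in> q" "up_to_mid ` s \<subseteq> t" "up_to_mid ` s \<subseteq> t'"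
        by (auto simp: prop_parts_def)
      then obtain x where "x \<in> s" using diagrams_part_ne[OF q] by blast
      then show False using stack_part_cong[OF t(1,2)] s t(3) by blast
    qed
  qed
  ultimately show ?thesis by simp
qed

text \<open>The difference of the two vectors is split over the parts \<open>t\<close> of the stack.
  A propagating \<open>t\<close> fuses the propagating parts of \<open>q\<close> inside it into one;
  any other \<open>t\<close> absorbs propagating parts of \<open>q\<close> of total residue 0. Both
  contributions lie in the cone.\<close>

lemma prop_vector_compose_lower:
  assumes l: "l \<ge> 1" and ton: "tonal l p" "tonal l q"
  shows "index_le l (prop_vector l (compose_diag n m r p q)) (prop_vector l q)"
proof -
  let ?g = "\<lambda>t k. std_vec l (card (t \<inter> range Dn)) k"
  have fin: "finite (lower t)" "finite (prop_parts (lower t))" for t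
    using finite_diagram[OF q] by (auto simp: prop_parts_def)
  \<comment> \<open>Non-propagating parts of \<open>q\<close> have a multiple of \<open>l\<close>
    lower vertices by tone, so only propagating ones matter for the residue.\<close>
  have cardDn: "[(\<Sum>s\<in>prop_parts (lower t). card (s \<inter> range Dn)) = card (t \<inter> range Dn)] (mod l)"
    if t: "t \<in> st" for t
  proof -
    have "card (t \<inter> range Dn) =
      (\<Sum>s\<in>lower t - prop_parts (lower t). card (s \<inter> range Dn)) +
      (\<Sum>s\<in>prop_parts (lower t). card (s \<inter> range Dn))"
      unfolding card_stack_lower(2)[OF t]
      by (rule sum.subset_diff) (use fin in \<open>auto simp: prop_parts_def\<close>)
    moreover have "[(\<Sum>s\<in>lower t - prop_parts (lower t). card (s \<inter> range Dn)) =
        (\<Sum>s\<in>lower t - prop_parts (lower t). 0)] (mod l)"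
      by (rule cong_sum) (use tonal_nonprop[OF q ton(2)] in \<open>auto simp: prop_parts_def\<close>)
    note cong_add[OF this cong_refl[of "\<Sum>s\<in>prop_parts (lower t). card (s \<inter> range Dn)"]]
    ultimately show ?thesis by (simp add: cong_sym_eq)
  qed
  \<comment> \<open>The contribution of \<open>t\<close>: what it adds to the vector of the product
    minus what it uses up from the vector of \<open>q\<close>.\<close>
  define v where "v = (\<lambda>t k. (if propagating t then ?g t k else 0) -
    (\<Sum>s\<in>prop_parts (lower t). ?g s k))"
  have cone: "v t \<in> fusion_cone l" if t: "t \<in> st" for t
  proof (cases "propagating t")
    case True
    then have "prop_parts (lower t) \<noteq> {}"
      using stack_propagating_lower[OF t] by (auto simp: prop_parts_def)
    from merge_in_cone[OF l fin(2) this, of "\<lambda>s. card (s \<inter> range Dn)"]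
    show ?thesis unfolding v_def std_vec_cong[OF cardDn[OF t]] using True by simp
  next
    case False
    then have "[card (t \<inter> range Dn) = 0] (mod l)"
      using tonal_stack[OF ton t] by (auto simp: propagating_def cong_sym_eq)
    then have "[(\<Sum>s\<in>prop_parts (lower t). card (s \<inter> range Dn)) = 0] (mod l)"
      using cardDn[OF t] cong_trans by blast
    from vanish_in_cone[OF l fin(2) this] show ?thesis using False by (simp add: v_def)
  qed
  show ?thesis
    unfolding index_le_iff
  proof (rule fusion_cone_cong[OF fusion_cone_sum[OF finite_st cone]])
    fix k assume k: "k \<in> {1..l}"
    have "int (prop_vector l (compose_diag n m r p q) k) = (\<Sum>t\<in>prop_parts st. ?g t k)"
      unfolding prop_vector_lower[OF finite_diagram[OF compose_diag_in_diagrams[OF p q]] k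
          tonal_compose_diag[OF ton]]
        sum.reindex_bij_betw[OF bij_betw_prop_parts, symmetric] minus_Mid ..
    also have "\<dots> = (\<Sum>t\<in>st. if propagating t then ?g t k else 0)"
      using finite_st by (simp add: sum.If_cases prop_parts_def Int_def)
    finally show "(\<Sum>t\<in>st. v t k) =
      int (prop_vector l (compose_diag n m r p q) k) - int (prop_vector l q k)"
      unfolding prop_vector_lower[OF finite_diagram[OF q] k ton(2)] v_def
      by (simp add: sum_subtractf sum_prop_lower)
  qed
qed

section \<open>The equality case, in which the bottom row is unchanged\<close>

context
  assumes l: "l \<ge> 1"
    and eq: "prop_vector l (compose_diag n m r p q) = prop_vector l q"
begin

text \<open>Each propagating part of the stack contains at least one propagating part of
  \<open>q\<close>. Equal vectors have equal coordinate sums, so the totals agree and every one of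
  these inequalities is an equality.\<close>

private lemma card_prop_lower:
  assumes t: "t \<in> st" shows "card (prop_parts (lower t)) = of_bool (propagating t)"
proof -
  have fin: "finite (prop_parts (lower t))" for t
    using finite_diagram[OF q] by (auto simp: prop_parts_def)
  have ge: "of_bool (propagating t) \<le> card (prop_parts (lower t))" if t: "t \<in> st" for t
  proof (cases "propagating t")
    case True
    then have "prop_parts (lower t) \<noteq> {}"
      using stack_propagating_lower[OF t] by (auto simp: prop_parts_def)
    then show ?thesis using fin True by (simp add: Suc_le_eq card_gt_0_iff)
  qed simp
  have "(\<Sum>t\<in>st. card (prop_parts (lower t))) = card (prop_parts q)"
    using sum_prop_lower[of "\<lambda>_. 1 :: nat"] by simp
  also have "\<dots> = card (prop_parts (compose_diag n m r p q))"
    using sum_prop_vector[OF l finite_diagram[OF q]]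
      sum_prop_vector[OF l finite_diagram[OF compose_diag_in_diagrams[OF p q]]] eq by simp
  also have "\<dots> = card (prop_parts st)"
    using bij_betw_same_card[OF bij_betw_prop_parts] by simp
  also have "\<dots> = (\<Sum>t\<in>st. of_bool (propagating t))"
    using finite_st by (simp add: prop_parts_def of_bool_def sum.If_cases Int_def)
  finally have sum: "(\<Sum>t\<in>st. of_bool (propagating t)) = (\<Sum>t\<in>st. card (prop_parts (lower t)))" ..
  have "\<forall>t\<in>st. of_bool (propagating t) = card (prop_parts (lower t))"
    by (rule sum_mono_inv[OF sum ge _ finite_st, rule_format, THEN ballI]) 
  then show ?thesis using t by simp
qed

private lemma lower_nonprop_stack:
  assumes "s \<in> q" "\<not> propagating s" "x \<in> s" "x \<in> range Dn" "t \<in> st" "x \<in> t"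
  shows "s = t"
proof -
  have "s \<subseteq> range Dn" using assms diagrams_part_cases[OF q assms(1,2)] by blast
  then show ?thesis using stack_lower_part stack_part_cong assms by blast
qed

private lemma lower_part_of:
  assumes t: "t \<in> st" and x: "x \<in> t" "x \<in> range Dn"
  obtains s where "s \<in> q" "x \<in> s" "up_to_mid ` s \<subseteq> t"
proof -
  obtain i where i: "x = Dn i" "i \<in> {1..r}" using x stack_part_subset[OF t] by blast
  then obtain s where s: "s \<in> q" "x \<in> s" using diagrams_ex_part(2)[OF q] by blast
  obtain t' where t': "t' \<in> st" "up_to_mid ` s \<subseteq> t'" using stack_lower[OF p q s(1)] by blast
  have "up_to_mid x = x" using i by simp
  then have "x \<in> t'" using t' s by (metis imageI subsetD)
  then have "t' = t" using stack_part_cong t t' x by blast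
  then show thesis using that s t' by blast
qed

text \<open>A new bottom part could only come from a propagating part of \<open>q\<close> that lost
  its connection to the top; the equality of counts rules this out.\<close>

lemma nonprop_bottom_compose:
  "nonprop_bottom (compose_diag n m r p q) = nonprop_bottom q"
proof (intro Set.set_eqI iffI)
  fix u assume "u \<in> nonprop_bottom (compose_diag n m r p q)"
  then obtain t where t: "t \<in> st" "u = t - range Mid" "u \<noteq> {}" "u \<subseteq> range Dn"
    by (auto simp: nonprop_bottom_def compose_diag_def)
  then obtain x where x: "x \<in> t" "x \<in> range Dn" by blast
  obtain s where s: "s \<in> q" "x \<in> s" "up_to_mid ` s \<subseteq> t" by (rule lower_part_of[OF t(1) x])
  have "\<not> propagating t" using t by (auto simp: propagating_def)
  then have "prop_parts (lower t) = {}"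
    using card_prop_lower[OF t(1)] finite_diagram[OF q] by (simp add: prop_parts_def)
  then have np: "\<not> propagating s" using s by (auto simp: prop_parts_def)
  then have "s = t" using lower_nonprop_stack s x t(1) by blast
  moreover have "s \<subseteq> range Dn" using diagrams_part_cases[OF q s(1) np] x s by blast
  moreover then have "s - range Mid = s" by auto
  ultimately show "u \<in> nonprop_bottom q" using s t by (auto simp: nonprop_bottom_def)
next
  fix s assume "s \<in> nonprop_bottom q"
  then have s: "s \<in> q" "s \<subseteq> range Dn" by (auto simp: nonprop_bottom_def)
  have "s - range Mid = s" using s(2) by auto
  then show "s \<in> nonprop_bottom (compose_diag n m r p q)"
    using stack_lower_part[OF s] s diagrams_part_ne[OF q s(1)]
    by (auto simp: nonprop_bottom_def compose_diag_def image_iff)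
qed

text \<open>A propagating part of the stack contains exactly one propagating part of
  \<open>q\<close>. Its lower vertices all come from that part, since a non-propagating part of
  \<open>q\<close> with lower vertices is by itself a part of the stack.\<close>

lemma prop_parts_lower_compose:
  "(\<lambda>s. s \<inter> range Dn) ` prop_parts (compose_diag n m r p q) = (\<lambda>s. s \<inter> range Dn) ` prop_parts q"
proof -
  have same: "t \<inter> range Dn = s \<inter> range Dn"
    if t: "t \<in> st" "propagating t" and s: "s \<in> prop_parts (lower t)" for t s
  proof (intro Set.set_eqI iffI)
    fix x assume x: "x \<in> t \<inter> range Dn"
    obtain s' where s': "s' \<in> q" "x \<in> s'" "up_to_mid ` s' \<subseteq> t"
      using lower_part_of[OF t(1)] x by blast
    have "propagating s'"
    proof (rule ccontr)
      assume np: "\<not> propagating s'"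
      then have "s' = t" using lower_nonprop_stack s' x t(1) by blast
      then show False using np t by simp
    qed
    then have "s' \<in> prop_parts (lower t)" using s' by (auto simp: prop_parts_def)
    moreover have "card (prop_parts (lower t)) = 1" using card_prop_lower[OF t(1)] t by simp
    ultimately have "s' = s" using s by (auto simp: card_1_singleton_iff)
    then show "x \<in> s \<inter> range Dn" using x s' by blast
  next
    fix x assume x: "x \<in> s \<inter> range Dn"
    then have "up_to_mid x = x" by auto
    then show "x \<in> t \<inter> range Dn" using x s by (force simp: prop_parts_def)
  qed
  have img: "(\<lambda>s. s \<inter> range Dn) ` prop_parts (compose_diag n m r p q) =
      (\<lambda>s. s \<inter> range Dn) ` prop_parts st"
    unfolding bij_betw_imp_surj_on[OF bij_betw_prop_parts, symmetric] image_image minus_Mid ..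
  show ?thesis
    unfolding img
  proof (intro Set.set_eqI iffI)
    fix u assume "u \<in> (\<lambda>s. s \<inter> range Dn) ` prop_parts st"
    then obtain t where t: "t \<in> st" "propagating t" "u = t \<inter> range Dn" by (auto simp: prop_parts_def)
    obtain s where s: "s \<in> lower t" "propagating s" using stack_propagating_lower[OF t(1,2)] by blast
    then have "u = s \<inter> range Dn" using same[OF t(1,2), of s] t by (auto simp: prop_parts_def)
    then show "u \<in> (\<lambda>s. s \<inter> range Dn) ` prop_parts q" using s by (auto simp: prop_parts_def)
  next
    fix u assume "u \<in> (\<lambda>s. s \<inter> range Dn) ` prop_parts q"
    then obtain s where s: "s \<in> q" "propagating s" "u = s \<inter> range Dn" by (auto simp: prop_parts_def)
    obtain t where t: "t \<in> st" "up_to_mid ` s \<subseteq> t" using stack_lower[OF p q s(1)] by blast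
    then have sl: "s \<in> prop_parts (lower t)" using s by (auto simp: prop_parts_def)
    then have "prop_parts (lower t) \<noteq> {}" by blast
    moreover have "finite (prop_parts (lower t))"
      using finite_diagram[OF q] by (simp add: prop_parts_def)
    ultimately have "card (prop_parts (lower t)) \<noteq> 0" by simp
    then have "propagating t" using card_prop_lower[OF t(1)] by simp
    then have "u = t \<inter> range Dn" "t \<in> prop_parts st"
      using same[OF t(1) _ sl] t(1) s(3) by (simp_all add: prop_parts_def)
    then show "u \<in> (\<lambda>s. s \<inter> range Dn) ` prop_parts st" by (rule image_eqI)
  qed
qed

end

end

lemma bottom_restriction_eq:
  assumes "p \<in> diagrams n m"
  shows "bottom_restriction p = (\<lambda>s. s \<inter> range Dn) ` prop_parts p \<union> nonprop_bottom p"
proof (intro Set.set_eqI iffI)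
  fix u assume "u \<in> bottom_restriction p"
  then obtain s where s: "s \<in> p" "u = s \<inter> range Dn" "u \<noteq> {}" by (auto simp: bottom_restriction_def)
  show "u \<in> (\<lambda>s. s \<inter> range Dn) ` prop_parts p \<union> nonprop_bottom p"
  proof (cases "propagating s")
    case True then show ?thesis using s by (auto simp: prop_parts_def)
  next
    case False
    then have "s \<subseteq> range Dn" using diagrams_part_cases[OF assms s(1)] s by blast
    moreover then have "u = s" using s by blast
    ultimately show ?thesis using s by (auto simp: nonprop_bottom_def)
  qed
next
  fix u assume "u \<in> (\<lambda>s. s \<inter> range Dn) ` prop_parts p \<union> nonprop_bottom p"
  then show "u \<in> bottom_restriction p"
  proof
    assume "u \<in> (\<lambda>s. s \<inter> range Dn) ` prop_parts p"
    then show ?thesis by (auto simp: prop_parts_def propagating_def bottom_restriction_def)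
  next
    assume "u \<in> nonprop_bottom p"
    then have "u \<in> p" "u \<inter> range Dn = u" "u \<noteq> {}"
      using diagrams_part_ne[OF assms] by (auto simp: nonprop_bottom_def)
    then show ?thesis unfolding bottom_restriction_def by (metis DiffI image_eqI singletonD)
  qed
qed

lemma bottom_restriction_compose:
  assumes "p \<in> diagrams n m" "q \<in> diagrams m r" "l \<ge> 1"
    and "prop_vector l (compose_diag n m r p q) = prop_vector l q"
  shows "bottom_restriction (compose_diag n m r p q) = bottom_restriction q"
  unfolding bottom_restriction_eq[OF compose_diag_in_diagrams[OF assms(1,2)]]
    bottom_restriction_eq[OF assms(2)]
    prop_parts_lower_compose[OF assms] nonprop_bottom_compose[OF assms] ..

section \<open>Flips of tonal diagrams, and the effect of the upper factor\<close>

lemma flip_vertex_range: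
  "flip_vertex ` s \<inter> range Up = flip_vertex ` (s \<inter> range Dn)"
  "flip_vertex ` s \<inter> range Dn = flip_vertex ` (s \<inter> range Up)"
proof -
  have "flip_vertex x \<in> range Up \<longleftrightarrow> x \<in> range Dn" "flip_vertex x \<in> range Dn \<longleftrightarrow> x \<in> range Up" for x
    by (cases x; auto)+
  moreover have "f ` s \<inter> A = f ` (s \<inter> B)" if "\<And>x. f x \<in> A \<longleftrightarrow> x \<in> B"
    for f :: "vertex \<Rightarrow> vertex" and A B using that by blast
  ultimately show "flip_vertex ` s \<inter> range Up = flip_vertex ` (s \<inter> range Dn)"
    "flip_vertex ` s \<inter> range Dn = flip_vertex ` (s \<inter> range Up)" by blast+
qed

lemma inj_flip_vertex: "inj flip_vertex"
  by (rule inj_on_inverseI[where g = flip_vertex]) simp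

lemma card_flip_vertex: "card (flip_vertex ` s) = card s"
  by (rule card_image) (meson inj_flip_vertex inj_on_subset subset_UNIV)

lemma propagating_flip: "propagating (flip_vertex ` s) \<longleftrightarrow> propagating s"
  unfolding propagating_def flip_vertex_range by auto

lemma tonal_flip: "tonal l p \<Longrightarrow> tonal l (flip_diag p)"
  by (auto simp: tonal_def flip_diag_def flip_vertex_range card_flip_vertex cong_sym_eq)

lemma prop_parts_flip: "prop_parts (flip_diag p) = flip_diag (prop_parts p)"
  by (auto simp: prop_parts_def flip_diag_def propagating_flip)

lemma inj_flip_image: "inj ((`) flip_vertex)"
  by (rule inj_on_inverseI[where g = "(`) flip_vertex"]) (simp add: image_image)

text \<open>The flip counts lower halves instead of upper ones; by tone both have the same
  residue.\<close>

lemma prop_vector_flip: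
  assumes "finite p" "tonal l p"
  shows "prop_vector l (flip_diag p) = prop_vector l p"
proof
  fix k show "prop_vector l (flip_diag p) k = prop_vector l p k"
  proof (cases "k \<in> {1..l}")
    case True
    have "finite (flip_diag p)" using assms(1) by (simp add: flip_diag_def)
    from prop_vector_upper[OF this True]
    have "int (prop_vector l (flip_diag p) k) =
        (\<Sum>s\<in>prop_parts p. std_vec l (card (flip_vertex ` s \<inter> range Up)) k)"
      unfolding prop_parts_flip unfolding flip_diag_def
      by (subst (asm) sum.reindex) (auto intro: inj_on_subset[OF inj_flip_image])
    also have "\<dots> = int (prop_vector l p k)"
      unfolding flip_vertex_range card_flip_vertex using prop_vector_lower[OF assms(1) True assms(2)]
      by simp
    finally show ?thesis by simp
  qed (simp add: prop_vector_zero)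
qed

lemma prop_vector_compose_upper:
  assumes p: "p \<in> diagrams n m" and q: "q \<in> diagrams m r"
    and l: "l \<ge> 1" and ton: "tonal l p" "tonal l q"
  shows "index_le l (prop_vector l (compose_diag n m r p q)) (prop_vector l p)"
  using prop_vector_compose_lower[OF flip_diag_in_diagrams[OF q] flip_diag_in_diagrams[OF p] l
      tonal_flip[OF ton(2)] tonal_flip[OF ton(1)]]
    prop_vector_flip[OF finite_diagram[OF p] ton(1)]
    prop_vector_flip[OF finite_diagram[OF compose_diag_in_diagrams[OF p q]]
      tonal_compose_diag[OF p q ton]]
  by (simp add: flip_compose_diag[OF p q])


section \<open>The diagrams \<open>a\<^sup>m\<close> in coordinates\<close>

text \<open>Blocks are handled as translates of \<open>{1..i}\<close>; rewriting them as intervals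
  would hide the offsets by which they are compared.\<close>

declare image_add_atLeastAtMost [simp del]

lemma shift_shift: "shift a a (shift b b v) = shift (a + b) (a + b) v"
  by (cases v) simp_all

lemma shift_zero [simp]: "shift 0 0 v = v"
  by (cases v) simp_all

lemma inj_shift: "inj (shift a a)"
proof (rule injI)
  fix v w assume "shift a a v = shift a a w" then show "v = w" by (cases v; cases w) simp_all
qed

lemma tensor_list_append:
  "tensor_list (ds @ es) = tensor_list ds \<union>
     (`) (shift (sum_list (map fst ds)) (sum_list (map fst ds))) ` tensor_list es"
  by (induction ds) (simp_all add: tensor_def image_Un image_image shift_shift Un_assoc)

lemma tensor_list_replicate:
  "tensor_list (replicate k (i, p)) = (\<Union>j<k. (`) (shift (j * i) (j * i)) ` p)"
proof (induction k)
  case (Suc k)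
  show ?case
    unfolding lessThan_Suc_eq_insert_0
    by (simp add: Suc tensor_def image_UN image_image shift_shift)
qed simp

lemma tensor_in_diagrams:
  assumes p: "p \<in> diagrams n n" and q: "q \<in> diagrams k k"
  shows "tensor n n p q \<in> diagrams (n + k) (n + k)"
proof -
  have img: "shift n n ` (Up ` {1..k} \<union> Dn ` {1..k}) = Up ` {n + 1..n + k} \<union> Dn ` {n + 1..n + k}"
  proof -
    have "{n + 1..n + k} = (+) n ` {1..k}" by (simp add: image_add_atLeastAtMost)
    then show ?thesis by (simp add: image_Un image_image)
  qed
  have "partition_on (shift n n ` (Up ` {1..k} \<union> Dn ` {1..k})) ((`) (shift n n) ` q)"
    using partition_on_inj_image[OF diagramsD[OF q] inj_on_subset[OF inj_shift]]
      diagrams_part_ne[OF q] by (auto simp: image_iff)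
  then have "partition_on (Up ` {n + 1..n + k} \<union> Dn ` {n + 1..n + k}) ((`) (shift n n) ` q)"
    unfolding img .
  then have "partition_on
      (Up ` {1..n} \<union> Dn ` {1..n} \<union> (Up ` {n + 1..n + k} \<union> Dn ` {n + 1..n + k})) (tensor n n p q)"
    using diagramsD[OF p] unfolding tensor_def partition_on_def
    by (intro conjI disjoint_union) auto
  moreover have "Up ` {1..n} \<union> Dn ` {1..n} \<union> (Up ` {n + 1..n + k} \<union> Dn ` {n + 1..n + k}) =
    Up ` {1..n + k} \<union> Dn ` {1..n + k}"
  proof -
    have "{1..n + k} = {1..n} \<union> {n + 1..n + k}" by auto
    then show ?thesis by auto
  qed
  ultimately show ?thesis by (simp add: diagrams_def)
qed

lemma tensor_list_in_diagrams:
  assumes "\<And>i p. (i, p) \<in> set ds \<Longrightarrow> p \<in> diagrams i i"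
  shows "tensor_list ds \<in> diagrams (sum_list (map fst ds)) (sum_list (map fst ds))"
  using assms
proof (induction ds)
  case Nil
  show ?case by (simp add: diagrams_def partition_on_empty)
next
  case (Cons d ds)
  then show ?case by (cases d) (auto intro: tensor_in_diagrams)
qed

section \<open>The columns of a^m: blocks and tails\<close>

definition block_start :: "nat \<Rightarrow> (nat \<Rightarrow> nat) \<Rightarrow> nat \<Rightarrow> nat" where
  "block_start l m i = (\<Sum>k\<in>{i<..l}. k * m k)"

definition block :: "nat \<Rightarrow> (nat \<Rightarrow> nat) \<Rightarrow> nat \<Rightarrow> nat \<Rightarrow> nat set" where
  "block l m i j = (\<lambda>t. block_start l m i + (j - 1) * i + t) ` {1..i}"

definition block_index :: "nat \<Rightarrow> (nat \<Rightarrow> nat) \<Rightarrow> (nat \<times> nat) set" where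
  "block_index l m = (SIGMA i:{1..l}. {1..m i})"

text \<open>The column sets of the factors built from \<open>w_diag\<close> and
  \<open>w_star_diag\<close>: consecutive runs of \<open>l\<close> columns to the right of all
  blocks, each forming one part in either row.\<close>

definition tails :: "nat \<Rightarrow> nat \<Rightarrow> (nat \<Rightarrow> nat) \<Rightarrow> nat set set" where
  "tails l n m = (\<lambda>k. (\<lambda>t. rank_vec l m + k * l + t) ` {1..l}) ` {..<(n - rank_vec l m) div l}"

lemma bottom_block_eq: "bottom_block l m i j = Dn ` block l m i j"
  by (simp add: bottom_block_def block_def block_start_def image_image)

lemma block_start_zero: "block_start l m 0 = rank_vec l m"
  by (auto simp: block_start_def rank_vec_def intro: sum.cong)

lemma block_start_step:
  assumes "i < i'" "i' \<le> l"
  shows "block_start l m i' + i' * m i' \<le> block_start l m i"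
proof -
  have "block_start l m i' + i' * m i' = (\<Sum>k\<in>insert i' {i'<..l}. k * m k)"
    by (simp add: block_start_def)
  also have "\<dots> \<le> block_start l m i"
    unfolding block_start_def by (rule sum_mono2) (use assms in auto)
  finally show ?thesis .
qed

lemma card_block [simp]: "card (block l m i j) = i"
  unfolding block_def by (subst card_image) (auto simp: inj_on_def)

lemma block_bounds:
  assumes "(i, j) \<in> block_index l m" "x \<in> block l m i j"
  shows "block_start l m i + (j - 1) * i < x" "x \<le> block_start l m i + j * i"
    "j * i \<le> i * m i" "x \<le> rank_vec l m" "1 \<le> x"
proof -
  have ij: "i \<in> {1..l}" "j \<in> {1..m i}" using assms(1) by (auto simp: block_index_def)
  obtain t where t: "t \<in> {1..i}" "x = block_start l m i + (j - 1) * i + t"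
    using assms(2) by (auto simp: block_def)
  show "block_start l m i + (j - 1) * i < x" "1 \<le> x" using t by auto
  have "j * i = (j - 1) * i + i" using ij by (cases j) auto
  then show le: "x \<le> block_start l m i + j * i" using t by simp
  show le': "j * i \<le> i * m i" using ij by (simp add: mult.commute)
  have "block_start l m i + i * m i \<le> block_start l m 0"
    by (rule block_start_step) (use ij in auto)
  then show "x \<le> rank_vec l m" using le le' unfolding block_start_zero by linarith
qed

lemma block_index_unique:
  assumes "(i, j) \<in> block_index l m" "(i', j') \<in> block_index l m"
    and "x \<in> block l m i j" "x \<in> block l m i' j'"
  shows "i = i'" "j = j'"
proof -
  have lt: False
    if "(i, j) \<in> block_index l m" "(i', j') \<in> block_index l m"
      "x \<in> block l m i j" "x \<in> block l m i' j'" "i < i'" for i j i' j'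
  proof -
    have "block_start l m i' + i' * m i' \<le> block_start l m i"
      by (rule block_start_step) (use that in \<open>auto simp: block_index_def\<close>)
    then show False using block_bounds[OF that(1,3)] block_bounds[OF that(2,4)] by linarith
  qed
  show i: "i = i'" using lt[OF assms] lt[OF assms(2,1,4,3)] by (meson nat_neq_iff)
  have lt: False
    if "(i, j) \<in> block_index l m" "(i, j') \<in> block_index l m"
      "x \<in> block l m i j" "x \<in> block l m i j'" "j < j'" for j j'
  proof -
    have "j * i \<le> (j' - 1) * i" using that(5) by (intro mult_le_mono1) simp
    then show False using block_bounds[OF that(1,3)] block_bounds[OF that(2,4)] by linarith
  qed
  show "j = j'" using lt[of j j'] lt[of j' j] assms i by (meson nat_neq_iff)
qed

lemma block_ne: "(i, j) \<in> block_index l m \<Longrightarrow> block l m i j \<noteq> {}"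
  by (auto simp: block_def block_index_def)

lemma block_inject:
  assumes "(i, j) \<in> block_index l m" "(i', j') \<in> block_index l m"
    "block l m i j = block l m i' j'"
  shows "i = i'" "j = j'"
  using block_index_unique[OF assms(1,2)] block_ne[OF assms(1)] assms(3) by blast+

lemma tail_bounds: "T \<in> tails l n m \<Longrightarrow> x \<in> T \<Longrightarrow> rank_vec l m < x"
  by (auto simp: tails_def)

lemma card_tail: "T \<in> tails l n m \<Longrightarrow> card T = l"
  by (auto simp: tails_def card_image inj_on_def)

lemma tail_block_disjoint:
  "(i, j) \<in> block_index l m \<Longrightarrow> x \<in> block l m i j \<Longrightarrow> T \<in> tails l n m \<Longrightarrow> x \<notin> T"
  using block_bounds(4) tail_bounds by fastforce

lemma shift_b_diag:
  "(`) (shift N N) ` b_diag i = {Up ` ((+) N ` {1..i}) \<union> Dn ` ((+) N ` {1..i})}"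
  by (simp add: b_diag_def image_Un image_image)

text \<open>The induction on \<open>l\<close> peels off the largest blocks, which stand leftmost.
  The shift that they impose on the rest is exactly the summand that \<open>block_start\<close>
  gains.\<close>

lemma tensor_list_blocks:
  "tensor_list (concat (map (\<lambda>i. replicate (m i) (i, b_diag i)) (rev [1..<Suc l]))) =
     (\<lambda>(i, j). Up ` block l m i j \<union> Dn ` block l m i j) ` block_index l m"
proof (induction l)
  case 0
  show ?case by (simp add: block_index_def)
next
  case (Suc l)
  let ?c = "\<lambda>N S. Up ` ((+) N ` S) \<union> Dn ` ((+) N ` S)"
  let ?f = "\<lambda>l (i, j). Up ` block l m i j \<union> Dn ` block l m i j"
  have rev: "rev [1..<Suc (Suc l)] = Suc l # rev [1..<Suc l]" by simp
  have "(\<Union>j<m (Suc l). (`) (shift (j * Suc l) (j * Suc l)) ` b_diag (Suc l)) =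
      ?f (Suc l) ` ({Suc l} \<times> {1..m (Suc l)})"
  proof -
    have c: "?f (Suc l) (Suc l, Suc j) = ?c (j * Suc l) {1..Suc l}" for j
      by (simp add: block_def block_start_def image_image)
    have "{1..m (Suc l)} = Suc ` {..<m (Suc l)}"
      using image_Suc_lessThan by simp
    then have "{Suc l} \<times> {1..m (Suc l)} = (\<lambda>j. (Suc l, Suc j)) ` {..<m (Suc l)}" by auto
    then show ?thesis unfolding shift_b_diag by (simp only: image_image c UNION_singleton_eq_range)
  qed
  moreover have "(`) (shift (m (Suc l) * Suc l) (m (Suc l) * Suc l)) ` (?f l ` block_index l m) =
      ?f (Suc l) ` block_index l m"
  proof -
    have "shift (m (Suc l) * Suc l) (m (Suc l) * Suc l) ` ?f l (i, j) = ?f (Suc l) (i, j)"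
      if "(i, j) \<in> block_index l m" for i j
    proof -
      have "{i<..Suc l} = insert (Suc l) {i<..l}" using that by (auto simp: block_index_def)
      then have "block_start (Suc l) m i = m (Suc l) * Suc l + block_start l m i"
        by (simp add: block_start_def)
      then show ?thesis by (simp add: block_def image_Un image_image add.assoc)
    qed
    then have "shift (m (Suc l) * Suc l) (m (Suc l) * Suc l) ` ?f l x = ?f (Suc l) x"
      if "x \<in> block_index l m" for x
      using that by (cases x) blast
    then show ?thesis unfolding image_image by (rule image_cong[OF refl])
  qed
  moreover have "block_index (Suc l) m = {Suc l} \<times> {1..m (Suc l)} \<union> block_index l m"
    by (auto simp: block_index_def le_Suc_eq)
  ultimately show ?case
    unfolding rev list.map concat.simps tensor_list_append
    by (simp add: Suc.IH[simplified] tensor_list_replicate sum_list_replicate image_Un)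
qed

lemma sum_list_blocks:
  "sum_list (map fst (concat (map (\<lambda>i. replicate (m i) (i, b_diag i)) (rev [1..<Suc l])))) =
     rank_vec l m"
proof (induction l)
  case (Suc l)
  have rev: "rev [1..<Suc (Suc l)] = Suc l # rev [1..<Suc l]" by simp
  show ?case unfolding rev list.map concat.simps map_append sum_list_append Suc.IH
    by (simp add: sum_list_replicate rank_vec_def)
qed (simp add: rank_vec_def)

lemma b_diag_in_diagrams: "i \<ge> 1 \<Longrightarrow> b_diag i \<in> diagrams i i"
  unfolding diagrams_def b_diag_def by (auto intro!: partition_on_space)

text \<open>The middle row is empty, so \<open>{}\<close> is the only intermediate set and the
  matrix entry factors into a condition on each row.\<close>

lemma compose_w_diag:
  assumes "l \<ge> 1"
  shows "compose_diag l 0 l (w_diag l) (w_star_diag l) = {Up ` {1..l}, Dn ` {1..l}}"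
    and "{Up ` {1..l}, Dn ` {1..l}} \<in> diagrams l l"
proof -
  have w: "w_diag l \<in> diagrams l 0" and w': "w_star_diag l \<in> diagrams 0 l"
    unfolding w_diag_def w_star_diag_def diagrams_def
    using assms by (auto intro!: partition_on_space)
  show ww: "{Up ` {1..l}, Dn ` {1..l}} \<in> diagrams l l"
    unfolding diagrams_def partition_on_def disjoint_def using assms by auto
  show "compose_diag l 0 l (w_diag l) (w_star_diag l) = {Up ` {1..l}, Dn ` {1..l}}"
  proof (rule compose_diag_eqI(1)[OF w w' ww, where k = 0])
    fix A C :: "nat set"
    have d: "dmat {Up ` {1..l}, Dn ` {1..l}} A C \<longleftrightarrow> dmat (w_diag l) A {} \<and> dmat (w_star_diag l) {} C"
      by (simp add: dmat_def saturated_iff w_diag_def w_star_diag_def image_iff)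
    have "{B. B \<subseteq> {1..0} \<and> dmat (w_diag l) A B \<and> dmat (w_star_diag l) B C} =
      (if dmat (w_diag l) A {} \<and> dmat (w_star_diag l) {} C then {{}} else {})"
      by auto
    then show "card {B. B \<subseteq> {1..0} \<and> dmat (w_diag l) A B \<and> dmat (w_star_diag l) B C} =
      2 ^ 0 * of_bool (dmat {Up ` {1..l}, Dn ` {1..l}} A C)"
      unfolding d by simp
  qed
qed

context
  fixes l n :: nat and m :: "nat \<Rightarrow> nat"
  assumes l: "l \<ge> 1" and m: "m \<in> index_set l n"
begin

lemma a_diag_eq:
  "a_diag l n m = (\<lambda>(i, j). Up ` block l m i j \<union> Dn ` block l m i j) ` block_index l m \<union>
     ((`) Up ` tails l n m \<union> (`) Dn ` tails l n m)"
proof -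
  let ?N = "(n - rank_vec l m) div l"
  have "(`) (shift (rank_vec l m) (rank_vec l m)) `
      tensor_list (replicate ?N (l, {Up ` {1..l}, Dn ` {1..l}})) =
    (`) Up ` tails l n m \<union> (`) Dn ` tails l n m"
    unfolding tensor_list_replicate
    by (auto simp: tails_def image_image shift_shift image_Un image_UN add.assoc)
  then show ?thesis
    unfolding a_diag_def compose_w_diag(1)[OF l] tensor_list_append sum_list_blocks
      tensor_list_blocks by simp
qed

lemma a_diag_in_diagrams: "a_diag l n m \<in> diagrams n n"
proof -
  let ?N = "(n - rank_vec l m) div l"
  let ?ds = "concat (map (\<lambda>i. replicate (m i) (i, b_diag i)) (rev [1..<Suc l])) @
    replicate ?N (l, compose_diag l 0 l (w_diag l) (w_star_diag l))"
  have "sum_list (map fst ?ds) = rank_vec l m + ?N * l"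
    unfolding map_append sum_list_append sum_list_blocks by (simp add: sum_list_replicate)
  also have "\<dots> = n" using m by (simp add: index_set_def)
  finally have "sum_list (map fst ?ds) = n" .
  moreover have "tensor_list ?ds \<in> diagrams (sum_list (map fst ?ds)) (sum_list (map fst ?ds))"
    by (rule tensor_list_in_diagrams)
      (use l compose_w_diag[OF l] b_diag_in_diagrams in \<open>auto split: if_splits\<close>)
  ultimately show ?thesis unfolding a_diag_def by simp
qed

lemma tail_subset: "T \<in> tails l n m \<Longrightarrow> T \<subseteq> {1..n}"
  using diagrams_part_subset[OF a_diag_in_diagrams, of "Up ` T"] unfolding a_diag_eq by auto

lemma tail_ne: "T \<in> tails l n m \<Longrightarrow> T \<noteq> {}"
  using l by (auto simp: tails_def)

lemma block_subset: "(i, j) \<in> block_index l m \<Longrightarrow> block l m i j \<subseteq> {1..n}"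
  using block_bounds(4,5) m by (fastforce simp: index_set_def)

lemma block_or_tail:
  assumes "x \<in> {1..n}"
  obtains (block) i j where "(i, j) \<in> block_index l m" "x \<in> block l m i j"
  | (tail) T where "T \<in> tails l n m" "x \<in> T"
  using diagrams_ex_part(1)[OF a_diag_in_diagrams assms] unfolding a_diag_eq by auto

lemma flip_a_diag: "flip_diag (a_diag l n m) = a_diag l n m"
  unfolding a_diag_eq flip_diag_def
  by (auto simp: image_Un image_image Un_commute split_beta)

lemma prop_parts_a_diag:
  "prop_parts (a_diag l n m) =
    (\<lambda>(i, j). Up ` block l m i j \<union> Dn ` block l m i j) ` block_index l m"
  unfolding a_diag_eq prop_parts_def propagating_def by (auto dest: block_ne)

lemma nonprop_bottom_a_diag: "nonprop_bottom (a_diag l n m) = (`) Dn ` tails l n m"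
proof (intro Set.set_eqI iffI)
  fix s assume "s \<in> nonprop_bottom (a_diag l n m)"
  then have s: "s \<in> a_diag l n m" "s \<subseteq> range Dn" by (auto simp: nonprop_bottom_def)
  from s(1) consider (b) i j where "(i, j) \<in> block_index l m"
      "s = Up ` block l m i j \<union> Dn ` block l m i j"
    | (u) T where "T \<in> tails l n m" "s = Up ` T" | (d) T where "T \<in> tails l n m" "s = Dn ` T"
    unfolding a_diag_eq by auto
  then show "s \<in> (`) Dn ` tails l n m"
  proof cases
    case b then show ?thesis using s(2) block_ne[OF b(1)] by auto
  next
    case u then show ?thesis using s(2) tail_ne[OF u(1)] by auto
  qed auto
qed (auto simp: nonprop_bottom_def a_diag_eq)

lemma bottom_restriction_a_diag:
  "bottom_restriction (a_diag l n m) =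
    (\<lambda>(i, j). bottom_block l m i j) ` block_index l m \<union> (`) Dn ` tails l n m"
proof -
  have "(Up ` S \<union> Dn ` S) \<inter> range Dn = Dn ` S" for S by auto
  then show ?thesis
    unfolding bottom_restriction_eq[OF a_diag_in_diagrams] nonprop_bottom_a_diag
      prop_parts_a_diag image_image by (simp add: split_beta bottom_block_eq)
qed

lemma tonal_a_diag: "tonal l (a_diag l n m)"
proof -
  have "card ((Up ` S \<union> Dn ` S) \<inter> range Up) = card S" "card ((Up ` S \<union> Dn ` S) \<inter> range Dn) = card S"
    for S :: "nat set"
  proof -
    have "(Up ` S \<union> Dn ` S) \<inter> range Up = Up ` S" "(Up ` S \<union> Dn ` S) \<inter> range Dn = Dn ` S" by auto
    then show "card ((Up ` S \<union> Dn ` S) \<inter> range Up) = card S"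
      "card ((Up ` S \<union> Dn ` S) \<inter> range Dn) = card S" by (simp_all add: card_image inj_on_def)
  qed
  moreover have "card (Up ` S \<inter> range Up) = card S" "Up ` S \<inter> range Dn = {}"
    "card (Dn ` S \<inter> range Dn) = card S" "Dn ` S \<inter> range Up = {}" for S :: "nat set"
  proof -
    have "Up ` S \<inter> range Up = Up ` S" "Dn ` S \<inter> range Dn = Dn ` S" by auto
    then show "card (Up ` S \<inter> range Up) = card S" "card (Dn ` S \<inter> range Dn) = card S"
      by (simp_all add: card_image inj_on_def)
  qed auto
  ultimately show ?thesis
    unfolding tonal_def a_diag_eq by (auto simp: card_tail cong_def)
qed

lemma a_diag_tonal_diagram: "a_diag l n m \<in> tonal_diagrams l n"
  by (simp add: tonal_diagrams_iff a_diag_in_diagrams tonal_a_diag)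

text \<open>The propagating parts are the blocks, and sizes in \<open>{1..l}\<close> are congruent
  modulo \<open>l\<close> only if they are equal.\<close>

lemma prop_vector_a_diag: "prop_vector l (a_diag l n m) = m"
proof
  fix k
  show "prop_vector l (a_diag l n m) k = m k"
  proof (cases "k \<in> {1..l}")
    case False
    then show ?thesis using m by (auto simp: prop_vector_zero index_set_def)
  next
    case True
    let ?f = "\<lambda>j. Up ` block l m k j \<union> Dn ` block l m k j"
    have cd: "card ((Up ` block l m i j \<union> Dn ` block l m i j) \<inter> range Up) = i" for i j
    proof -
      have "(Up ` block l m i j \<union> Dn ` block l m i j) \<inter> range Up = Up ` block l m i j" by auto
      then show ?thesis by (simp add: card_image inj_on_def)
    qed
    have idx: "(i, j) \<in> block_index l m \<and> [i = k] (mod l) \<longleftrightarrow> i = k \<and> j \<in> {1..m k}" for i j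
      using True residue_unique[of i l k] by (auto simp: block_index_def)
    have "{s \<in> prop_parts (a_diag l n m). [card (s \<inter> range Up) = k] (mod l)} = ?f ` {1..m k}"
    proof -
      have "{s \<in> prop_parts (a_diag l n m). [card (s \<inter> range Up) = k] (mod l)} =
        (\<lambda>(i, j). Up ` block l m i j \<union> Dn ` block l m i j) `
          {(i, j). (i, j) \<in> block_index l m \<and> [i = k] (mod l)}"
        unfolding prop_parts_a_diag by (auto simp: cd)
      also have "\<dots> = ?f ` {1..m k}" unfolding idx by auto
      finally show ?thesis .
    qed
    moreover have "card (?f ` {1..m k}) = m k"
    proof -
      have "inj_on ?f {1..m k}"
      proof (rule inj_onI)
        fix j j' assume j: "j \<in> {1..m k}" "j' \<in> {1..m k}" and eq: "?f j = ?f j'"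
        have "Dn -` ?f j = block l m k j" for j by auto
        then have "block l m k j = block l m k j'" using eq by metis
        then show "j = j'" using block_inject(2) j True by (auto simp: block_index_def)
      qed
      then show ?thesis by (simp add: card_image)
    qed
    ultimately show ?thesis using True by (simp add: prop_vector_def prop_parts_def)
  qed
qed

end


section \<open>Block permutations\<close>

text \<open>A translation of each block that keeps the position inside the block. The truncated
  subtraction is exact because a point of block \<open>(i, j)\<close> exceeds
  \<open>(j - 1) * i\<close>; tail columns are fixed.\<close>

definition block_perm :: "nat \<Rightarrow> (nat \<Rightarrow> nat) \<Rightarrow> (nat \<Rightarrow> nat \<Rightarrow> nat) \<Rightarrow> nat \<Rightarrow> nat" where
  "block_perm l m \<sigma> x =
     (if \<exists>ij\<in>block_index l m. x \<in> block l m (fst ij) (snd ij)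
      then let ij = (THE ij. ij \<in> block_index l m \<and> x \<in> block l m (fst ij) (snd ij))
           in x - (snd ij - 1) * fst ij + (\<sigma> (fst ij) (snd ij) - 1) * fst ij
      else x)"

lemma block_perm_block:
  assumes ij: "(i, j) \<in> block_index l m" and t: "t \<in> {1..i}"
  shows "block_perm l m \<sigma> (block_start l m i + (j - 1) * i + t) =
    block_start l m i + (\<sigma> i j - 1) * i + t"
proof -
  let ?x = "block_start l m i + (j - 1) * i + t"
  have x: "?x \<in> block l m i j" using t by (auto simp: block_def)
  have "(THE ij. ij \<in> block_index l m \<and> ?x \<in> block l m (fst ij) (snd ij)) = (i, j)"
    by (rule the_equality) (use ij x block_index_unique in \<open>auto simp del: One_nat_def\<close>)
  moreover have "\<exists>ij\<in>block_index l m. ?x \<in> block l m (fst ij) (snd ij)"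
    using ij x by (intro bexI[of _ "(i, j)"]) auto
  ultimately show ?thesis unfolding block_perm_def by (simp add: Let_def)
qed

lemma block_perm_outside:
  assumes "\<And>i j. (i, j) \<in> block_index l m \<Longrightarrow> x \<notin> block l m i j"
  shows "block_perm l m \<sigma> x = x"
  using assms unfolding block_perm_def by auto

lemma image_block_perm:
  assumes "(i, j) \<in> block_index l m"
  shows "block_perm l m \<sigma> ` block l m i j = block l m i (\<sigma> i j)"
  unfolding block_def image_image by (rule image_cong) (simp_all add: block_perm_block[OF assms] del: One_nat_def)

lemma sym_prod_index:
  assumes "\<sigma> \<in> sym_prod m" "(i, j) \<in> block_index l m" shows "(i, \<sigma> i j) \<in> block_index l m"
  using assms permutes_in_image[of "\<sigma> i" "{1..m i}" j] by (auto simp: sym_prod_def block_index_def)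

lemma block_perm_comp:
  assumes "\<tau> \<in> sym_prod m"
  shows "block_perm l m \<sigma> \<circ> block_perm l m \<tau> = block_perm l m (\<lambda>i. \<sigma> i \<circ> \<tau> i)"
proof
  fix x
  show "(block_perm l m \<sigma> \<circ> block_perm l m \<tau>) x = block_perm l m (\<lambda>i. \<sigma> i \<circ> \<tau> i) x"
  proof (cases "\<exists>i j. (i, j) \<in> block_index l m \<and> x \<in> block l m i j")
    case True
    then obtain i j t where ij: "(i, j) \<in> block_index l m" "t \<in> {1..i}"
      "x = block_start l m i + (j - 1) * i + t" by (auto simp: block_def)
    show ?thesis
      unfolding ij(3) comp_def block_perm_block[OF ij(1,2)]
        block_perm_block[OF sym_prod_index[OF assms ij(1)] ij(2)] ..
  next
    case False
    then show ?thesis by (simp add: block_perm_outside)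
  qed
qed

lemma block_perm_id: "block_perm l m (\<lambda>_. id) = id"
proof
  fix x
  show "block_perm l m (\<lambda>_. id) x = id x"
  proof (cases "\<exists>i j. (i, j) \<in> block_index l m \<and> x \<in> block l m i j")
    case True
    then obtain i j t where ij: "(i, j) \<in> block_index l m" "t \<in> {1..i}"
      "x = block_start l m i + (j - 1) * i + t" by (auto simp: block_def)
    show ?thesis unfolding ij(3) block_perm_block[OF ij(1,2)] by simp
  next
    case False
    then show ?thesis by (simp add: block_perm_outside)
  qed
qed

lemma sym_prod_inv: "\<sigma> \<in> sym_prod m \<Longrightarrow> (\<lambda>i. inv_into UNIV (\<sigma> i)) \<in> sym_prod m"
  by (simp add: sym_prod_def permutes_inv)

lemma sym_prod_comp: "\<sigma> \<in> sym_prod m \<Longrightarrow> \<tau> \<in> sym_prod m \<Longrightarrow> (\<lambda>i. \<sigma> i \<circ> \<tau> i) \<in> sym_prod m"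
  by (simp add: sym_prod_def permutes_compose)

lemma sym_prod_inv_comp:
  assumes "\<sigma> \<in> sym_prod m"
  shows "(\<lambda>i. inv_into UNIV (\<sigma> i) \<circ> \<sigma> i) = (\<lambda>_. id)" "(\<lambda>i. \<sigma> i \<circ> inv_into UNIV (\<sigma> i)) = (\<lambda>_. id)"
proof -
  have "\<sigma> i permutes {1..m i}" for i using assms by (simp add: sym_prod_def)
  from permutes_inv_o[OF this]
  show "(\<lambda>i. inv_into UNIV (\<sigma> i) \<circ> \<sigma> i) = (\<lambda>_. id)" "(\<lambda>i. \<sigma> i \<circ> inv_into UNIV (\<sigma> i)) = (\<lambda>_. id)"
    by simp_all
qed

lemma block_perm_inv:
  assumes "\<sigma> \<in> sym_prod m"
  shows "block_perm l m (\<lambda>i. inv_into UNIV (\<sigma> i)) \<circ> block_perm l m \<sigma> = id"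
    "block_perm l m \<sigma> \<circ> block_perm l m (\<lambda>i. inv_into UNIV (\<sigma> i)) = id"
  using block_perm_comp[OF assms] block_perm_comp[OF sym_prod_inv[OF assms]]
    sym_prod_inv_comp[OF assms] by (simp_all add: block_perm_id)

lemma inv_block_perm:
  assumes "\<sigma> \<in> sym_prod m"
  shows "inv_into UNIV (block_perm l m \<sigma>) = block_perm l m (\<lambda>i. inv_into UNIV (\<sigma> i))"
  using block_perm_inv[OF assms] by (intro inv_unique_comp)

text \<open>A member is a family over all of \<open>nat\<close>, but it is the identity outside
  \<open>{1..l}\<close>, where \<open>m\<close> vanishes.\<close>

lemma finite_sym_prod:
  assumes "m \<in> index_set l n" shows "finite (sym_prod m)"
proof -
  have fin: "finite (\<Union>i\<in>{1..l}. {\<pi>. \<pi> permutes {1..m i}})" by (auto intro: finite_permutations)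
  have "sym_prod m \<subseteq> {\<sigma>. \<forall>i. (i \<in> {1..l} \<longrightarrow> \<sigma> i \<in> (\<Union>i\<in>{1..l}. {\<pi>. \<pi> permutes {1..m i}})) \<and>
    (i \<notin> {1..l} \<longrightarrow> \<sigma> i = id)}"
  proof (intro subsetI CollectI allI conjI impI)
    fix \<sigma> i assume \<sigma>: "\<sigma> \<in> sym_prod m"
    show "i \<in> {1..l} \<Longrightarrow> \<sigma> i \<in> (\<Union>i\<in>{1..l}. {\<pi>. \<pi> permutes {1..m i}})"
      using \<sigma> by (auto simp: sym_prod_def)
    assume "i \<notin> {1..l}"
    then have "m i = 0" using assms by (simp add: index_set_def)
    then have "\<sigma> i permutes {}" using \<sigma> by (auto simp: sym_prod_def dest: spec[of _ i])
    then show "\<sigma> i = id" by simp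
  qed
  moreover have "finite {\<sigma>. \<forall>i. (i \<in> {1..l} \<longrightarrow> \<sigma> i \<in> (\<Union>i\<in>{1..l}. {\<pi>. \<pi> permutes {1..m i}})) \<and>
    (i \<notin> {1..l} \<longrightarrow> \<sigma> i = id)}"
    by (rule finite_set_of_finite_funs[OF _ fin]) simp
  ultimately show ?thesis by (rule finite_subset)
qed

primrec relabel_lower :: "(nat \<Rightarrow> nat) \<Rightarrow> vertex \<Rightarrow> vertex" where
  "relabel_lower f (Up i) = Up i"
| "relabel_lower f (Mid i) = Mid i"
| "relabel_lower f (Dn i) = Dn (f i)"

text \<open>The lower vertex \<open>k\<close> of \<open>p\<close> is glued to the upper vertex
  \<open>k\<close> of the permutation diagram, whose lower partner is the inverse image of
  \<open>k\<close>; hence the inverse.\<close>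

lemma compose_perm_diag_relabel:
  assumes p: "p \<in> diagrams m n" and \<pi>: "\<pi> permutes {1..n}"
  shows "compose_diag m n n p (perm_diag n \<pi>) = (`) (relabel_lower (inv_into UNIV \<pi>)) ` p"
    and "loops m n n p (perm_diag n \<pi>) = 0"
proof -
  let ?f = "relabel_lower (inv_into UNIV \<pi>)"
  have inv: "inv_into UNIV \<pi> permutes {1..n}" using \<pi> by (rule permutes_inv)
  have inj: "inj ?f"
  proof (rule injI)
    fix v w assume "?f v = ?f w"
    then show "v = w" using permutes_inj[OF inv] by (cases v; cases w) (auto dest: injD)
  qed
  have "?f ` (Up ` {1..m} \<union> Dn ` {1..n}) = Up ` {1..m} \<union> Dn ` (inv_into UNIV \<pi> ` {1..n})"
    by (simp add: image_Un image_image)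
  then have im: "?f ` (Up ` {1..m} \<union> Dn ` {1..n}) = Up ` {1..m} \<union> Dn ` {1..n}"
    using permutes_image[OF inv] by simp
  have "partition_on (?f ` (Up ` {1..m} \<union> Dn ` {1..n})) ((`) ?f ` p)"
    using partition_on_inj_image[OF diagramsD[OF p] inj_on_subset[OF inj]]
      diagrams_part_ne[OF p] by (auto simp: image_iff)
  then have s: "(`) ?f ` p \<in> diagrams m n" unfolding im by (simp add: diagrams_def)
  have d: "dmat ((`) ?f ` p) A C \<longleftrightarrow> dmat p A (\<pi> ` C)" for A C
  proof -
    have "?f -` (Up ` A \<union> Dn ` C) = Up ` A \<union> Dn ` (\<pi> ` C)"
    proof (rule Set.set_eqI)
      fix v
      have "inv_into UNIV \<pi> k \<in> C \<longleftrightarrow> k \<in> \<pi> ` C" for k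
        using permutes_inverses[OF \<pi>] by (metis image_iff)
      then show "v \<in> ?f -` (Up ` A \<union> Dn ` C) \<longleftrightarrow> v \<in> Up ` A \<union> Dn ` (\<pi> ` C)" by (cases v) auto
    qed
    then show ?thesis by (simp add: dmat_def saturated_image)
  qed
  show "compose_diag m n n p (perm_diag n \<pi>) = (`) ?f ` p" "loops m n n p (perm_diag n \<pi>) = 0"
    using compose_perm_diag_right[OF p \<pi> s d] by auto
qed

lemma flip_perm_diag:
  assumes "\<pi> permutes {1..n}" shows "flip_diag (perm_diag n \<pi>) = perm_diag n (inv_into UNIV \<pi>)"
proof -
  have "perm_diag n (inv_into UNIV \<pi>) = (\<lambda>i. {Up (inv_into UNIV \<pi> i), Dn i}) ` (\<pi> ` {1..n})"
    unfolding permutes_image[OF assms] perm_diag_def ..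
  also have "\<dots> = flip_diag (perm_diag n \<pi>)"
    by (simp add: flip_diag_def perm_diag_def image_image permutes_inverses[OF assms] insert_commute)
  finally show ?thesis ..
qed

lemma tonal_perm_diag: "tonal l (perm_diag n \<pi>)"
  by (auto simp: tonal_def perm_diag_def Int_insert_left)


section \<open>Factorization through \<open>a\<^sup>m\<close>\<close>

lemma dmat_compose_iff:
  assumes "p \<in> diagrams n m" "q \<in> diagrams m r" "A \<subseteq> {1..n}" "C \<subseteq> {1..r}"
  shows "dmat (compose_diag n m r p q) A C \<longleftrightarrow> (\<exists>B\<subseteq>{1..m}. dmat p A B \<and> dmat q B C)"
proof -
  let ?S = "{B. B \<subseteq> {1..m} \<and> dmat p A B \<and> dmat q B C}"
  have "finite ?S" by simp
  then have "card ?S \<noteq> 0 \<longleftrightarrow> (\<exists>B. B \<in> ?S)" by (simp only: card_0_eq) blast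
  moreover have "card ?S \<noteq> 0 \<longleftrightarrow> dmat (compose_diag n m r p q) A C"
    unfolding card_dmat_compose[OF assms] by simp
  ultimately show ?thesis by blast
qed

text \<open>The matrix product has the entry \<open>2 ^ loops\<close> at \<open>({}, {})\<close>, so
  a unique intermediate set there means that there is no loop.\<close>

lemma loops_zeroI:
  assumes "p \<in> diagrams n m" "q \<in> diagrams m r"
    and "\<And>B. B \<subseteq> {1..m} \<Longrightarrow> dmat p {} B \<Longrightarrow> dmat q B {} \<Longrightarrow> B = {}"
  shows "loops n m r p q = 0"
proof -
  have eq: "{B. B \<subseteq> {1..m} \<and> dmat p {} B \<and> dmat q B {}} = {{}}"
    using assms(3) by auto
  have "2 ^ loops n m r p q = (2 :: nat) ^ 0"
    using card_dmat_compose[OF assms(1,2), of "{}" "{}"] unfolding eq by simp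
  then show ?thesis by (simp only: power_inject_exp)
qed

text \<open>Saturation for the partition that \<open>q\<close> induces on its upper row
  alone.\<close>

definition upper_sat :: "diagram \<Rightarrow> nat set \<Rightarrow> bool" where
  "upper_sat q A \<longleftrightarrow> (\<forall>s\<in>q. \<forall>a b. Up a \<in> s \<longrightarrow> Up b \<in> s \<longrightarrow> (a \<in> A \<longleftrightarrow> b \<in> A))"

lemma card_upper_parts:
  assumes "q \<in> diagrams n k"
  shows "(\<Sum>s\<in>q. card (s \<inter> range Up)) = n"
proof -
  have "(\<Union>s\<in>q. s \<inter> range Up) = Up ` {1..n}"
    using diagrams_part_subset[OF assms] diagrams_ex_part(1)[OF assms] by fastforce
  moreover have "card (\<Union>s\<in>q. s \<inter> range Up) = (\<Sum>s\<in>q. card (s \<inter> range Up))"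
  proof (rule card_UN_disjoint)
    show "finite q" by (rule finite_diagram[OF assms])
    show "\<forall>s\<in>q. finite (s \<inter> range Up)" using finite_diagram_part[OF assms] by simp
    show "\<forall>s\<in>q. \<forall>t\<in>q. s \<noteq> t \<longrightarrow> s \<inter> range Up \<inter> (t \<inter> range Up) = {}"
      using diagrams_part_cong[OF assms] by blast
  qed
  ultimately show ?thesis by (simp add: card_image inj_on_def)
qed

text \<open>Count the upper row by parts. Non-propagating parts contribute multiples of
  \<open>l\<close>, and a propagating part contributes its residue in \<open>{1..l}\<close> plus a
  nonnegative multiple of \<open>l\<close>; the residues add up to the rank.\<close>

lemma prop_vector_in_index_set:
  assumes l: "l \<ge> 1" and q: "q \<in> tonal_diagrams l n"
  shows "prop_vector l q \<in> index_set l n"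
proof -
  have qd: "q \<in> diagrams n n" and ton: "tonal l q" using q by (auto simp: tonal_diagrams_iff)
  note fin = finite_diagram[OF qd]
  define \<rho> where "\<rho> s = (\<Sum>k\<in>{1..l}. int k * std_vec l (card (s \<inter> range Up)) k)" for s
  have rank: "int (rank_vec l (prop_vector l q)) = (\<Sum>s\<in>prop_parts q. \<rho> s)"
  proof -
    have "int (rank_vec l (prop_vector l q)) =
        (\<Sum>k\<in>{1..l}. int k * (\<Sum>s\<in>prop_parts q. std_vec l (card (s \<inter> range Up)) k))"
      unfolding rank_vec_def of_nat_sum of_nat_mult
      by (rule sum.cong[OF refl]) (simp only: prop_vector_upper[OF fin])
    also have "\<dots> = (\<Sum>s\<in>prop_parts q. \<rho> s)"
      unfolding \<rho>_def sum_distrib_left by (rule sum.swap)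
    finally show ?thesis .
  qed
  have \<rho>: "\<rho> s \<le> int (card (s \<inter> range Up)) \<and> int l dvd int (card (s \<inter> range Up)) - \<rho> s"
    if s: "s \<in> prop_parts q" for s
  proof -
    let ?c = "card (s \<inter> range Up)"
    obtain k where k: "k \<in> {1..l}" "[?c = k] (mod l)" using ex_residue[OF l] by blast
    have "\<rho> s = (\<Sum>k'\<in>{1..l}. if k' = k then int k else 0)"
      unfolding \<rho>_def
    proof (rule sum.cong[OF refl])
      fix k' assume k': "k' \<in> {1..l}"
      have "[k' = k] (mod l) \<longleftrightarrow> k' = k" using residue_unique[OF k' k(1)] by auto
      then show "int k' * std_vec l ?c k' = (if k' = k then int k else 0)"
        unfolding std_vec_cong[OF k(2)] by (simp add: std_vec_def)
    qed
    then have \<rho>s: "\<rho> s = int k" using k by simp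
    have "finite s" "s \<inter> range Up \<noteq> {}"
      using s finite_diagram_part[OF qd] by (auto simp: prop_parts_def propagating_def)
    then have "?c \<ge> 1" by (simp add: Suc_le_eq card_gt_0_iff)
    \<comment> \<open>A nonempty upper half with at most \<open>l\<close> vertices is its own
      residue; a larger one exceeds \<open>k\<close> anyway.\<close>
    then have "k \<le> ?c" using residue_unique[of ?c l k] k by (cases "?c \<le> l") auto
    moreover have "int l dvd int ?c - int k"
      using k(2) by (simp add: cong_int_iff flip: cong_iff_dvd_diff)
    ultimately show ?thesis using \<rho>s by simp
  qed
  have np: "int l dvd int (card (s \<inter> range Up))" if "s \<in> q - prop_parts q" for s
  proof -
    have s: "s \<in> q" "\<not> propagating s" using that by (auto simp: prop_parts_def)
    have "[card (s \<inter> range Up) = 0] (mod l)"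
      using cong_trans[OF tonalD[OF ton s(1)] tonal_nonprop[OF qd ton s]] .
    then show ?thesis by (simp add: cong_0_iff)
  qed
  have sub: "prop_parts q \<subseteq> q" by (auto simp: prop_parts_def)
  have "int n = (\<Sum>s\<in>q. int (card (s \<inter> range Up)))"
    using card_upper_parts[OF qd] by (simp flip: of_nat_sum)
  also have "\<dots> = (\<Sum>s\<in>q - prop_parts q. int (card (s \<inter> range Up))) +
      (\<Sum>s\<in>prop_parts q. int (card (s \<inter> range Up)))"
    by (rule sum.subset_diff[OF sub fin])
  finally have diff: "int n - int (rank_vec l (prop_vector l q)) =
      (\<Sum>s\<in>q - prop_parts q. int (card (s \<inter> range Up))) +
      (\<Sum>s\<in>prop_parts q. int (card (s \<inter> range Up)) - \<rho> s)"
    unfolding rank by (simp add: sum_subtractf)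
  have "0 \<le> int n - int (rank_vec l (prop_vector l q))"
    unfolding diff by (intro add_nonneg_nonneg sum_nonneg) (use \<rho> in auto)
  moreover have "int l dvd int n - int (rank_vec l (prop_vector l q))"
    unfolding diff by (intro dvd_add dvd_sum) (use \<rho> np in auto)
  ultimately have "rank_vec l (prop_vector l q) \<le> n" "l dvd n - rank_vec l (prop_vector l q)"
    by (auto simp flip: of_nat_diff)
  then show ?thesis by (simp add: index_set_def prop_vector_zero)
qed

text \<open>The lower vertices of the diagram constructed here are attached to the upper halves of
  parts of \<open>q\<close>: block \<open>(i, j)\<close> to \<open>\<beta> (i, j)\<close>, and all remaining vertices to the single part
  \<open>s0\<close>, so that no loops arise in a product with \<open>a\<^sup>m\<close>.\<close>

lemma ex_upper_half:
  assumes l: "l \<ge> 1" and m: "m \<in> index_set l n" and q: "q \<in> tonal_diagrams l n"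
    and \<beta>: "bij_betw \<beta> (block_index l m) (prop_parts q)"
    and res: "\<And>i j. (i, j) \<in> block_index l m \<Longrightarrow> [card (\<beta> (i, j) \<inter> range Up) = i] (mod l)"
    and s0: "n > 0 \<Longrightarrow> s0 \<in> q" "n > 0 \<Longrightarrow> s0 \<inter> range Up \<noteq> {}"
  shows "\<exists>x\<in>tonal_diagrams l n. \<forall>A\<subseteq>{1..n}. \<forall>B\<subseteq>{1..n}. dmat x A B \<longleftrightarrow>
    upper_sat q A \<and>
    (\<forall>i j k a. (i, j) \<in> block_index l m \<longrightarrow> k \<in> block l m i j \<longrightarrow> Up a \<in> \<beta> (i, j) \<longrightarrow>
      (k \<in> B \<longleftrightarrow> a \<in> A)) \<and>
    (\<forall>k a. k \<in> {rank_vec l m<..n} \<longrightarrow> Up a \<in> s0 \<longrightarrow> (k \<in> B \<longleftrightarrow> a \<in> A))"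
proof -
  have qd: "q \<in> diagrams n n" and ton: "tonal l q" using q by (auto simp: tonal_diagrams_iff)
  define f where "f k = (if \<exists>ij\<in>block_index l m. k \<in> block l m (fst ij) (snd ij)
      then \<beta> (THE ij. ij \<in> block_index l m \<and> k \<in> block l m (fst ij) (snd ij)) else s0)" for k
  have f_block: "f k = \<beta> (i, j)" if "(i, j) \<in> block_index l m" "k \<in> block l m i j" for i j k
  proof -
    have "(THE ij. ij \<in> block_index l m \<and> k \<in> block l m (fst ij) (snd ij)) = (i, j)"
      by (rule the_equality) (use that block_index_unique in auto)
    then show ?thesis using that unfolding f_def by force
  qed
  have f_tail: "f k = s0" if "k \<in> {rank_vec l m<..n}" for k
  proof -
    have "k \<notin> block l m i j" if "(i, j) \<in> block_index l m" for i j
      using block_bounds(4)[OF that, of k] \<open>k \<in> _\<close> by auto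
    then show ?thesis unfolding f_def by auto
  qed
  have cases: "(\<exists>i j. (i, j) \<in> block_index l m \<and> k \<in> block l m i j) \<or> k \<in> {rank_vec l m<..n}"
    if "k \<in> {1..n}" for k
    using block_or_tail[OF l m that] tail_bounds that by (metis atLeastAtMost_iff greaterThanAtMost_iff)
  have \<beta>q: "\<beta> (i, j) \<in> q" "propagating (\<beta> (i, j))" if "(i, j) \<in> block_index l m" for i j
    using bij_betw_apply[OF \<beta> that] by (auto simp: prop_parts_def)
  have f_part: "f k \<in> q" "f k \<inter> range Up \<noteq> {}" if "k \<in> {1..n}" for k
  proof -
    have "f k \<in> q \<and> f k \<inter> range Up \<noteq> {}"
      using cases[OF that]
    proof
      assume "\<exists>i j. (i, j) \<in> block_index l m \<and> k \<in> block l m i j"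
      then obtain i j where "(i, j) \<in> block_index l m" "k \<in> block l m i j" by blast
      then show ?thesis using f_block \<beta>q by (simp add: propagating_def)
    next
      assume "k \<in> {rank_vec l m<..n}"
      then show ?thesis using f_tail s0 that by simp
    qed
    then show "f k \<in> q" "f k \<inter> range Up \<noteq> {}" by auto
  qed
  let ?h = "\<lambda>s. (s \<inter> range Up) \<union> Dn ` {k \<in> {1..n}. f k = s}"
  define x where "x = ?h ` {s \<in> q. s \<inter> range Up \<noteq> {}}"
  have hUp: "?h s \<inter> range Up = s \<inter> range Up" "?h s \<inter> range Dn = Dn ` {k \<in> {1..n}. f k = s}" for s
    by auto
  have "\<Union>x = Up ` {1..n} \<union> Dn ` {1..n}"
  proof (intro Set.set_eqI iffI)
    fix v assume "v \<in> \<Union>x"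
    then show "v \<in> Up ` {1..n} \<union> Dn ` {1..n}"
      using diagrams_part_subset[OF qd] unfolding x_def by blast
  next
    fix v assume "v \<in> Up ` {1..n} \<union> Dn ` {1..n}"
    then consider (u) i where "i \<in> {1..n}" "v = Up i" | (d) i where "i \<in> {1..n}" "v = Dn i" by blast
    then show "v \<in> \<Union>x"
    proof cases
      case u
      then obtain s where "s \<in> q" "Up i \<in> s" using diagrams_ex_part(1)[OF qd] by blast
      then show ?thesis using u unfolding x_def by blast
    next
      case d
      then show ?thesis using f_part[OF d(1)] unfolding x_def by blast
    qed
  qed
  moreover have "disjoint x"
  proof (rule disjointI)
    fix t t' assume "t \<in> x" "t' \<in> x" "t \<noteq> t'"
    then obtain s s' where s: "s \<in> q" "s' \<in> q" "s \<noteq> s'" "t = ?h s" "t' = ?h s'"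
      unfolding x_def by blast
    then have "s \<inter> s' = {}" using diagrams_part_cong[OF qd] by blast
    then show "t \<inter> t' = {}" using s by auto
  qed
  moreover have "{} \<notin> x" unfolding x_def by auto
  ultimately have xd: "x \<in> diagrams n n" by (auto simp: diagrams_def partition_on_def)
  have tail_card: "l dvd card {rank_vec l m<..n}"
    using m by (simp add: index_set_def)
  have "tonal l x"
    unfolding tonal_def
  proof
    fix t assume "t \<in> x"
    then obtain s where s: "s \<in> q" "t = ?h s" unfolding x_def by blast
    have cDn: "card (t \<inter> range Dn) = card {k \<in> {1..n}. f k = s}"
      unfolding s(2) hUp by (simp add: card_image inj_on_def)
    \<comment> \<open>The tail columns are attached to \<open>s0\<close> all together. Their number
      is a multiple of \<open>l\<close>, so they do not disturb the tone of that part.\<close>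
    define W where "W = {k \<in> {rank_vec l m<..n}. s0 = s}"
    have W: "[card W = 0] (mod l)" 
    proof -
      have "W = (if s0 = s then {rank_vec l m<..n} else {})" by (auto simp: W_def)
      then show ?thesis using tail_card by (simp add: cong_0_iff)
    qed
    show "[card (t \<inter> range Up) = card (t \<inter> range Dn)] (mod l)"
    proof (cases "propagating s")
      case True
      then have "s \<in> prop_parts q" using s by (simp add: prop_parts_def)
      then obtain i j where ij: "(i, j) \<in> block_index l m" "s = \<beta> (i, j)"
        using bij_betw_imp_surj_on[OF \<beta>] by (metis imageE surj_pair)
      have "{k \<in> {1..n}. f k = s} = block l m i j \<union> W"
      proof (intro Set.set_eqI iffI)
        fix k assume k: "k \<in> {k \<in> {1..n}. f k = s}"
        then have "(\<exists>i j. (i, j) \<in> block_index l m \<and> k \<in> block l m i j) \<or> k \<in> {rank_vec l m<..n}"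
          using cases by blast
        then show "k \<in> block l m i j \<union> W"
        proof
          assume "\<exists>i j. (i, j) \<in> block_index l m \<and> k \<in> block l m i j"
          then obtain i' j' where k': "(i', j') \<in> block_index l m" "k \<in> block l m i' j'" by blast
          then have "\<beta> (i', j') = \<beta> (i, j)" using f_block k ij by simp
          then have "(i', j') = (i, j)"
            using bij_betw_imp_inj_on[OF \<beta>] k'(1) ij(1) by (meson inj_onD)
          then show ?thesis using k' by simp
        next
          assume "k \<in> {rank_vec l m<..n}"
          then show ?thesis using f_tail k by (simp add: W_def)
        qed
      next
        fix k assume "k \<in> block l m i j \<union> W"
        then show "k \<in> {k \<in> {1..n}. f k = s}"
        proof
          assume "k \<in> block l m i j"
          then show ?thesis using f_block[OF ij(1)] ij(2) block_subset[OF l m ij(1)] by auto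
        next
          assume "k \<in> W"
          then show ?thesis using f_tail unfolding W_def by auto
        qed
      qed
      moreover have "block l m i j \<inter> W = {}"
        using block_bounds(4)[OF ij(1)] by (fastforce simp: W_def)
      moreover have "finite W" "finite (block l m i j)" by (auto simp: W_def block_def)
      ultimately have "card (t \<inter> range Dn) = i + card W"
        using cDn by (simp add: card_Un_disjoint)
      moreover have "[i + card W = i + 0] (mod l)" by (rule cong_add[OF cong_refl W])
      moreover have "[card (t \<inter> range Up) = i] (mod l)"
        unfolding s(2) hUp ij(2) by (rule res[OF ij(1)])
      ultimately show ?thesis by (metis add.right_neutral cong_sym cong_trans)
    next
      case False
      have "{k \<in> {1..n}. f k = s} = W"
      proof (intro Set.set_eqI iffI)
        fix k assume k: "k \<in> {k \<in> {1..n}. f k = s}"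
        then have "(\<exists>i j. (i, j) \<in> block_index l m \<and> k \<in> block l m i j) \<or> k \<in> {rank_vec l m<..n}"
          using cases by blast
        then show "k \<in> W"
        proof
          assume "\<exists>i j. (i, j) \<in> block_index l m \<and> k \<in> block l m i j"
          then obtain i' j' where k': "(i', j') \<in> block_index l m" "k \<in> block l m i' j'" by blast
          then have "propagating s" using f_block k \<beta>q by auto
          then show ?thesis using False by simp
        next
          assume "k \<in> {rank_vec l m<..n}"
          then show ?thesis using f_tail k by (simp add: W_def)
        qed
      next
        fix k assume "k \<in> W"
        then show "k \<in> {k \<in> {1..n}. f k = s}" using f_tail unfolding W_def by auto
      qed
      then have "[card (t \<inter> range Dn) = 0] (mod l)" using cDn W by simp
      moreover have "[card (t \<inter> range Up) = 0] (mod l)"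
        unfolding s(2) hUp
        using cong_trans[OF tonalD[OF ton s(1)] tonal_nonprop[OF qd ton s(1) False]] .
      ultimately show ?thesis by (meson cong_sym cong_trans)
    qed
  qed
  then have xt: "x \<in> tonal_diagrams l n" using xd by (simp add: tonal_diagrams_iff)
  show ?thesis
  proof (intro bexI[OF _ xt] allI impI iffI conjI)
    fix A B assume A: "A \<subseteq> {1..n}" and B: "B \<subseteq> {1..n}" and d: "dmat x A B"
    have same: "v \<in> Up ` A \<union> Dn ` B \<longleftrightarrow> w \<in> Up ` A \<union> Dn ` B"
      if "s \<in> q" "s \<inter> range Up \<noteq> {}" "v \<in> ?h s" "w \<in> ?h s" for s v w
      by (rule saturatedD[OF d[unfolded dmat_def] _ that(3,4)]) (use that(1,2) in \<open>auto simp: x_def\<close>)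
    have low: "k \<in> B \<longleftrightarrow> a \<in> A" if k: "k \<in> {1..n}" and a: "Up a \<in> f k" for k a
      using same[OF f_part[OF k], of "Dn k" "Up a"] k a by auto
    show "upper_sat q A"
      unfolding upper_sat_def
    proof (intro ballI allI impI)
      fix s a b assume "s \<in> q" "Up a \<in> s" "Up b \<in> s"
      then show "a \<in> A \<longleftrightarrow> b \<in> A" using same[of s "Up a" "Up b"] by auto
    qed
    have blk: "k \<in> B \<longleftrightarrow> a \<in> A"
      if "(i, j) \<in> block_index l m" "k \<in> block l m i j" "Up a \<in> \<beta> (i, j)" for i j k a
      by (rule low) (use that block_subset[OF l m that(1)] f_block[OF that(1,2)] in auto)
    have tl: "k \<in> B \<longleftrightarrow> a \<in> A" if "k \<in> {rank_vec l m<..n}" "Up a \<in> s0" for k a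
      by (rule low) (use that f_tail in auto)
    fix i j k a
    show "(i, j) \<in> block_index l m \<Longrightarrow> k \<in> block l m i j \<Longrightarrow> Up a \<in> \<beta> (i, j) \<Longrightarrow> k \<in> B \<Longrightarrow> a \<in> A"
      "(i, j) \<in> block_index l m \<Longrightarrow> k \<in> block l m i j \<Longrightarrow> Up a \<in> \<beta> (i, j) \<Longrightarrow> a \<in> A \<Longrightarrow> k \<in> B"
      using blk by simp_all
    show "k \<in> {rank_vec l m<..n} \<Longrightarrow> Up a \<in> s0 \<Longrightarrow> k \<in> B \<Longrightarrow> a \<in> A"
      "k \<in> {rank_vec l m<..n} \<Longrightarrow> Up a \<in> s0 \<Longrightarrow> a \<in> A \<Longrightarrow> k \<in> B"
      using tl by simp_all
  next
    fix A B assume A: "A \<subseteq> {1..n}" and B: "B \<subseteq> {1..n}" and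
      *: "upper_sat q A \<and>
      (\<forall>i j k a. (i, j) \<in> block_index l m \<longrightarrow> k \<in> block l m i j \<longrightarrow> Up a \<in> \<beta> (i, j) \<longrightarrow>
        (k \<in> B \<longleftrightarrow> a \<in> A)) \<and>
      (\<forall>k a. k \<in> {rank_vec l m<..n} \<longrightarrow> Up a \<in> s0 \<longrightarrow> (k \<in> B \<longleftrightarrow> a \<in> A))"
    have low: "k \<in> B \<longleftrightarrow> a \<in> A" if k: "k \<in> {1..n}" and a: "Up a \<in> f k" for k a
      using cases[OF k] * a f_block f_tail by metis
    show "dmat x A B"
      unfolding dmat_def saturated_iff
    proof (intro ballI)
      fix t v w assume t: "t \<in> x" and vw: "v \<in> t" "w \<in> t"
      obtain s a where s: "s \<in> q" "Up a \<in> s" "t = ?h s" using t unfolding x_def by blast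
      have "v \<in> Up ` A \<union> Dn ` B \<longleftrightarrow> a \<in> A" if "v \<in> t" for v
      proof -
        consider (u) b where "v = Up b" "Up b \<in> s" | (d) k where "v = Dn k" "k \<in> {1..n}" "f k = s"
          using \<open>v \<in> t\<close> s(3) by auto
        then show ?thesis
        proof cases
          case u
          then have "b \<in> A \<longleftrightarrow> a \<in> A" using * s unfolding upper_sat_def by blast
          then show ?thesis using u by auto
        next
          case d
          then show ?thesis using low[OF d(2), of a] s by auto
        qed
      qed
      then show "v \<in> Up ` A \<union> Dn ` B \<longleftrightarrow> w \<in> Up ` A \<union> Dn ` B" using vw by simp
    qed
  qed
qed

text \<open>Numbering the propagating parts of each residue matches them with the blocks of that
  size in a^m; distinct sizes never compete for the same part.\<close>

lemma ex_block_labelling: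
  assumes l: "l \<ge> 1" and q: "finite q"
  shows "\<exists>\<beta>. bij_betw \<beta> (block_index l (prop_vector l q)) (prop_parts q) \<and>
    (\<forall>i j. (i, j) \<in> block_index l (prop_vector l q) \<longrightarrow> [card (\<beta> (i, j) \<inter> range Up) = i] (mod l))"
proof -
  let ?P = "\<lambda>i. {s \<in> prop_parts q. [card (s \<inter> range Up) = i] (mod l)}"
  have card: "card (?P i) = prop_vector l q i" if "i \<in> {1..l}" for i
    using that by (auto simp: prop_vector_def prop_parts_def intro: arg_cong[of _ _ card])
  have "\<forall>i. \<exists>h. bij_betw h {1..card (?P i)} (?P i)"
    using q by (intro allI ex_bij_betw_nat_finite_1) (simp add: prop_parts_def)
  from choice[OF this] obtain h where h: "\<And>i. bij_betw (h i) {1..card (?P i)} (?P i)" by blast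
  have h': "bij_betw (h i) {1..prop_vector l q i} (?P i)" if "i \<in> {1..l}" for i
    using h[of i] card[OF that] by simp
  have inP: "h i j \<in> ?P i" if "(i, j) \<in> block_index l (prop_vector l q)" for i j
    using bij_betw_apply[OF h', of i j] that by (auto simp: block_index_def)
  show ?thesis
  proof (intro exI[of _ "\<lambda>(i, j). h i j"] conjI allI impI)
    show "bij_betw (\<lambda>(i, j). h i j) (block_index l (prop_vector l q)) (prop_parts q)"
      unfolding bij_betw_def
    proof
      show "inj_on (\<lambda>(i, j). h i j) (block_index l (prop_vector l q))"
      proof (rule inj_onI, clarify)
        fix i j i' j' assume ij: "(i, j) \<in> block_index l (prop_vector l q)"
          "(i', j') \<in> block_index l (prop_vector l q)" and eq: "h i j = h i' j'"
        have "[i = i'] (mod l)"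
          using inP[OF ij(1)] inP[OF ij(2)] eq by (metis (mono_tags, lifting) cong_sym cong_trans mem_Collect_eq)
        then have "i = i'" using residue_unique[of i l i'] ij by (auto simp: block_index_def)
        moreover have "j = j'"
          using h'[of i] ij eq \<open>i = i'\<close> by (auto simp: block_index_def bij_betw_def dest: inj_onD)
        ultimately show "i = i' \<and> j = j'" by simp
      qed
      show "(\<lambda>(i, j). h i j) ` block_index l (prop_vector l q) = prop_parts q"
      proof (intro Set.set_eqI iffI)
        fix s assume "s \<in> (\<lambda>(i, j). h i j) ` block_index l (prop_vector l q)"
        then show "s \<in> prop_parts q" using inP by auto
      next
        fix s assume s: "s \<in> prop_parts q"
        obtain i where i: "i \<in> {1..l}" "[card (s \<inter> range Up) = i] (mod l)"
          using ex_residue[OF l] by blast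
        then have "s \<in> ?P i" using s by simp
        then obtain j where "j \<in> {1..prop_vector l q i}" "s = h i j"
          using bij_betw_imp_surj_on[OF h'[OF i(1)]] by blast
        then show "s \<in> (\<lambda>(i, j). h i j) ` block_index l (prop_vector l q)"
          using i(1) by (force simp: block_index_def)
      qed
    qed
  qed (use inP in auto)
qed

lemma upper_sat_flip_iff:
  "upper_sat (flip_diag q) D \<longleftrightarrow> (\<forall>s\<in>q. \<forall>a b. Dn a \<in> s \<longrightarrow> Dn b \<in> s \<longrightarrow> (a \<in> D \<longleftrightarrow> b \<in> D))"
proof -
  have "Up a \<in> flip_vertex ` s \<longleftrightarrow> Dn a \<in> s" for a s
    by (metis flip_vertex.simps(1,3) flip_vertex_flip image_iff)
  then show ?thesis by (simp add: upper_sat_def flip_diag_def)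
qed

text \<open>The entry is split into a condition on each row and one linking the rows through
  propagating parts. The outer factors of a factorization control the former, a^m transmits the
  latter.\<close>

lemma dmat_diagram_iff:
  assumes "q \<in> diagrams n k"
  shows "dmat q A D \<longleftrightarrow> upper_sat q A \<and> upper_sat (flip_diag q) D \<and>
    (\<forall>s\<in>prop_parts q. \<forall>a b. Up a \<in> s \<longrightarrow> Dn b \<in> s \<longrightarrow> (a \<in> A \<longleftrightarrow> b \<in> D))"
proof -
  have Up: "Up a \<in> Up ` A \<union> Dn ` D \<longleftrightarrow> a \<in> A" and Dn: "Dn a \<in> Up ` A \<union> Dn ` D \<longleftrightarrow> a \<in> D" for a
    by auto
  show ?thesis
  proof
    assume d: "dmat q A D"
    note same = saturatedD[OF d[unfolded dmat_def]]
    show "upper_sat q A \<and> upper_sat (flip_diag q) D \<and>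
      (\<forall>s\<in>prop_parts q. \<forall>a b. Up a \<in> s \<longrightarrow> Dn b \<in> s \<longrightarrow> (a \<in> A \<longleftrightarrow> b \<in> D))"
      unfolding upper_sat_flip_iff unfolding upper_sat_def prop_parts_def
    proof (intro conjI ballI allI impI)
      fix s a b assume s: "s \<in> q"
      show "Up a \<in> s \<Longrightarrow> Up b \<in> s \<Longrightarrow> a \<in> A \<longleftrightarrow> b \<in> A" using same[OF s, of "Up a" "Up b"] Up by simp
      show "Dn a \<in> s \<Longrightarrow> Dn b \<in> s \<Longrightarrow> a \<in> D \<longleftrightarrow> b \<in> D" using same[OF s, of "Dn a" "Dn b"] Dn by simp
    next
      fix s a b assume s: "s \<in> {s \<in> q. propagating s}"
      then show "Up a \<in> s \<Longrightarrow> Dn b \<in> s \<Longrightarrow> a \<in> A \<longleftrightarrow> b \<in> D"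
        using same[of s "Up a" "Dn b"] Up Dn by simp
    qed
  next
    assume *: "upper_sat q A \<and> upper_sat (flip_diag q) D \<and>
      (\<forall>s\<in>prop_parts q. \<forall>a b. Up a \<in> s \<longrightarrow> Dn b \<in> s \<longrightarrow> (a \<in> A \<longleftrightarrow> b \<in> D))"
    show "dmat q A D"
      unfolding dmat_def saturated_iff
    proof (intro ballI)
      fix s v w assume s: "s \<in> q" and vw: "v \<in> s" "w \<in> s"
      have mix: "a \<in> A \<longleftrightarrow> b \<in> D" if "Up a \<in> s" "Dn b \<in> s" for a b
      proof -
        have "s \<in> prop_parts q" using s that by (auto simp: prop_parts_def propagating_def)
        then show ?thesis using * that by blast
      qed
      have u: "a \<in> A \<longleftrightarrow> b \<in> A" if "Up a \<in> s" "Up b \<in> s" for a b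
        using * s that unfolding upper_sat_def by blast
      have d: "a \<in> D \<longleftrightarrow> b \<in> D" if "Dn a \<in> s" "Dn b \<in> s" for a b
        using * s that unfolding upper_sat_flip_iff by blast
      have "v \<in> range Up \<union> range Dn" "w \<in> range Up \<union> range Dn"
        using diagrams_part_subset[OF assms s] vw by auto
      then consider (uu) a b where "v = Up a" "w = Up b" | (ud) a b where "v = Up a" "w = Dn b"
        | (du) a b where "v = Dn a" "w = Up b" | (dd) a b where "v = Dn a" "w = Dn b"
        by blast
      then show "v \<in> Up ` A \<union> Dn ` D \<longleftrightarrow> w \<in> Up ` A \<union> Dn ` D"
      proof cases
        case uu then show ?thesis using u[of a b] vw Up by simp
      next
        case ud then show ?thesis using mix[of a b] vw Up Dn by simp
      next
        case du then show ?thesis using mix[of b a] vw Up Dn by simp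
      next
        case dd then show ?thesis using d[of a b] vw Dn by simp
      qed
    qed
  qed
qed

text \<open>The upper half of \<open>q\<close> and the upper half of its flip are attached to a^m
  from above and below, with every inner vertex tied to an outer row. An empty outer set therefore
  forces an empty inner set, which excludes loops.\<close>

lemma diagram_factorization:
  assumes l: "l \<ge> 1" and q: "q \<in> tonal_diagrams l n"
  defines "m \<equiv> prop_vector l q"
  obtains x y where "x \<in> tonal_diagrams l n" "y \<in> tonal_diagrams l n"
    "compose_diag n n n (compose_diag n n n x (a_diag l n m)) y = q"
    "loops n n n x (a_diag l n m) = 0"
    "loops n n n (compose_diag n n n x (a_diag l n m)) y = 0"
proof -
  have qd: "q \<in> diagrams n n" and ton: "tonal l q" using q by (auto simp: tonal_diagrams_iff)
  have m: "m \<in> index_set l n" unfolding m_def by (rule prop_vector_in_index_set[OF l q])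
  let ?a = "a_diag l n m"
  note ad = a_diag_in_diagrams[OF l m]
  obtain \<beta> where \<beta>: "bij_betw \<beta> (block_index l m) (prop_parts q)"
    and res: "\<And>i j. (i, j) \<in> block_index l m \<Longrightarrow> [card (\<beta> (i, j) \<inter> range Up) = i] (mod l)"
    using ex_block_labelling[OF l finite_diagram[OF qd]] unfolding m_def by blast
  have \<beta>q: "\<beta> (i, j) \<in> prop_parts q" if "(i, j) \<in> block_index l m" for i j
    by (rule bij_betw_apply[OF \<beta> that])
  have fqd: "flip_diag q \<in> diagrams n n" by (rule flip_diag_in_diagrams[OF qd])
  have fq: "flip_diag q \<in> tonal_diagrams l n"
    by (simp add: tonal_diagrams_iff fqd tonal_flip[OF ton])
  have f\<beta>: "bij_betw (\<lambda>ij. flip_vertex ` \<beta> ij) (block_index l m) (prop_parts (flip_diag q))"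
  proof -
    have "bij_betw ((`) flip_vertex) (prop_parts q) (prop_parts (flip_diag q))"
      unfolding prop_parts_flip unfolding flip_diag_def bij_betw_def
      by (auto intro: inj_on_subset[OF inj_flip_image])
    from bij_betw_trans[OF \<beta> this] show ?thesis by (simp add: comp_def)
  qed
  have fres: "[card (flip_vertex ` \<beta> (i, j) \<inter> range Up) = i] (mod l)"
    if ij: "(i, j) \<in> block_index l m" for i j
  proof -
    have "\<beta> (i, j) \<in> q" using \<beta>q[OF ij] by (simp add: prop_parts_def)
    from cong_trans[OF cong_sym[OF tonalD[OF ton this]] res[OF ij]]
    show ?thesis by (simp add: flip_vertex_range card_flip_vertex)
  qed
  \<comment> \<open>For \<open>n = 0\<close> no part exists to hold tail columns, hence the
    conditional choice.\<close>
  have top: "\<exists>s0. n > 0 \<longrightarrow> s0 \<in> q \<and> s0 \<inter> range Up \<noteq> {}" if q: "q \<in> diagrams n n" for q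
  proof (cases "n > 0")
    case True
    then obtain s where "s \<in> q" "Up 1 \<in> s" using diagrams_ex_part(1)[OF q, of 1] by auto
    then show ?thesis by blast
  qed simp
  obtain s0 where s0: "n > 0 \<Longrightarrow> s0 \<in> q" "n > 0 \<Longrightarrow> s0 \<inter> range Up \<noteq> {}" using top[OF qd] by blast
  obtain s1 where s1: "n > 0 \<Longrightarrow> s1 \<in> flip_diag q" "n > 0 \<Longrightarrow> s1 \<inter> range Up \<noteq> {}"
    using top[OF fqd] by blast
  obtain x where xt: "x \<in> tonal_diagrams l n"
    and x': "\<forall>A\<subseteq>{1..n}. \<forall>B\<subseteq>{1..n}. dmat x A B \<longleftrightarrow>
      upper_sat q A \<and>
      (\<forall>i j k a. (i, j) \<in> block_index l m \<longrightarrow> k \<in> block l m i j \<longrightarrow> Up a \<in> \<beta> (i, j) \<longrightarrow>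
        (k \<in> B \<longleftrightarrow> a \<in> A)) \<and>
      (\<forall>k a. k \<in> {rank_vec l m<..n} \<longrightarrow> Up a \<in> s0 \<longrightarrow> (k \<in> B \<longleftrightarrow> a \<in> A))"
    by (rule bexE[OF ex_upper_half[OF l m q \<beta> res s0]])
  note x = x'[THEN spec, THEN mp, THEN spec, THEN mp]
  \<comment> \<open>\<open>y\<close> is an upper half of the flipped diagram; turned over, it
    becomes the lower factor.\<close>
  obtain y where yt: "y \<in> tonal_diagrams l n"
    and y': "\<forall>A\<subseteq>{1..n}. \<forall>B\<subseteq>{1..n}. dmat y A B \<longleftrightarrow>
      upper_sat (flip_diag q) A \<and>
      (\<forall>i j k a. (i, j) \<in> block_index l m \<longrightarrow> k \<in> block l m i j \<longrightarrow>
        Up a \<in> flip_vertex ` \<beta> (i, j) \<longrightarrow> (k \<in> B \<longleftrightarrow> a \<in> A)) \<and>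
      (\<forall>k a. k \<in> {rank_vec l m<..n} \<longrightarrow> Up a \<in> s1 \<longrightarrow> (k \<in> B \<longleftrightarrow> a \<in> A))"
    by (rule bexE[OF ex_upper_half[OF l m fq f\<beta> fres s1]])
  note y = y'[THEN spec, THEN mp, THEN spec, THEN mp]
  have xd: "x \<in> diagrams n n" and yd: "flip_diag y \<in> diagrams n n"
    using xt yt flip_diag_in_diagrams by (auto simp: tonal_diagrams_iff)
  note xad = compose_diag_in_diagrams[OF xd ad]
  have fUp: "Up a \<in> flip_vertex ` s \<longleftrightarrow> Dn a \<in> s" for a s
    by (metis flip_vertex.simps(1,3) flip_vertex_flip image_iff)
  have rng: "k \<in> {rank_vec l m<..n} \<Longrightarrow> n > 0" for k by auto
  have cases: "(\<exists>i j. (i, j) \<in> block_index l m \<and> k \<in> block l m i j) \<or> k \<in> {rank_vec l m<..n}"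
    if "k \<in> {1..n}" for k
    using block_or_tail[OF l m that] tail_bounds that by (metis atLeastAtMost_iff greaterThanAtMost_iff)
  have x0: "B = {}" if B: "B \<subseteq> {1..n}" "dmat x {} B" for B
  proof -
    note X0 = x[THEN iffD1, OF empty_subsetI B]
    have "k \<notin> B" if k: "k \<in> {1..n}" for k
      using cases[OF k]
    proof
      assume "\<exists>i j. (i, j) \<in> block_index l m \<and> k \<in> block l m i j"
      then obtain i j where ij: "(i, j) \<in> block_index l m" "k \<in> block l m i j" by blast
      then obtain a where "Up a \<in> \<beta> (i, j)" using \<beta>q[OF ij(1)] by (auto simp: prop_parts_def propagating_def)
      then show ?thesis using X0 ij by blast
    next
      assume kr: "k \<in> {rank_vec l m<..n}"
      then obtain a where "Up a \<in> s0" using s0(2) by auto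
      then show ?thesis using X0 kr by blast
    qed
    then show ?thesis using B(1) by blast
  qed
  have y0: "B = {}" if B: "B \<subseteq> {1..n}" "dmat y {} B" for B
  proof -
    note Y0 = y[THEN iffD1, OF empty_subsetI B]
    have "k \<notin> B" if k: "k \<in> {1..n}" for k
      using cases[OF k]
    proof
      assume "\<exists>i j. (i, j) \<in> block_index l m \<and> k \<in> block l m i j"
      then obtain i j where ij: "(i, j) \<in> block_index l m" "k \<in> block l m i j" by blast
      then obtain a where "Dn a \<in> \<beta> (i, j)" using \<beta>q[OF ij(1)] by (auto simp: prop_parts_def propagating_def)
      then have "Up a \<in> flip_vertex ` \<beta> (i, j)" by (simp only: fUp)
      with Y0[THEN conjunct2, THEN conjunct1, rule_format, OF ij] have "k \<in> B \<longleftrightarrow> a \<in> {}" .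
      then show ?thesis by simp
    next
      assume kr: "k \<in> {rank_vec l m<..n}"
      then obtain a where "Up a \<in> s1" using s1(2) by auto
      then show ?thesis using Y0 kr by blast
    qed
    then show ?thesis using B(1) by blast
  qed
  show thesis
  proof (rule that[OF xt, of "flip_diag y"])
    show "flip_diag y \<in> tonal_diagrams l n"
      using yt yd by (auto simp: tonal_diagrams_iff tonal_flip)
    show "loops n n n x ?a = 0"
      by (rule loops_zeroI[OF xd ad]) (use x0 in blast)
    show "loops n n n (compose_diag n n n x ?a) (flip_diag y) = 0"
      by (rule loops_zeroI[OF xad yd]) (use y0 in \<open>auto simp: dmat_flip\<close>)
    show "compose_diag n n n (compose_diag n n n x ?a) (flip_diag y) = q"
    proof (rule diagram_eqI[OF compose_diag_in_diagrams[OF xad yd] qd])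
      fix A D assume A: "A \<subseteq> {1..n}" and D: "D \<subseteq> {1..n}"
      have "dmat (compose_diag n n n (compose_diag n n n x ?a) (flip_diag y)) A D \<longleftrightarrow>
        (\<exists>C\<subseteq>{1..n}. \<exists>B\<subseteq>{1..n}. dmat x A B \<and> dmat ?a B C \<and> dmat y D C)"
        unfolding dmat_compose_iff[OF xad yd A D] dmat_flip
        by (rule ex_cong1) (use dmat_compose_iff[OF xd ad A] in blast)
      also have "\<dots> \<longleftrightarrow> dmat q A D"
      proof
        assume "\<exists>C\<subseteq>{1..n}. \<exists>B\<subseteq>{1..n}. dmat x A B \<and> dmat ?a B C \<and> dmat y D C"
        then obtain B C where B: "B \<subseteq> {1..n}" and C: "C \<subseteq> {1..n}"
          and d: "dmat x A B" "dmat ?a B C" "dmat y D C" by blast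
        note X = x[OF A B, THEN iffD1, OF d(1)] and Y = y[OF D C, THEN iffD1, OF d(3)]
        have "a \<in> A \<longleftrightarrow> b \<in> D" if s: "s \<in> prop_parts q" "Up a \<in> s" "Dn b \<in> s" for s a b
        proof -
          obtain i j where ij: "(i, j) \<in> block_index l m" "s = \<beta> (i, j)"
            using bij_betw_imp_surj_on[OF \<beta>] s(1) by (metis imageE surj_pair)
          \<comment> \<open>One column of the block carries the value from the top row to the bottom
            row: through the upper factor, then a^m, then the lower factor.\<close>
          obtain k where k: "k \<in> block l m i j" using block_ne[OF ij(1)] by blast
          have part: "Up ` block l m i j \<union> Dn ` block l m i j \<in> ?a"
            unfolding a_diag_eq[OF l m] using ij(1) by force
          have "Up k \<in> Up ` B \<union> Dn ` C \<longleftrightarrow> Dn k \<in> Up ` B \<union> Dn ` C"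
            by (rule saturatedD[OF d(2)[unfolded dmat_def] part]) (use k in auto)
          then have "k \<in> B \<longleftrightarrow> k \<in> C" by auto
          moreover have "k \<in> B \<longleftrightarrow> a \<in> A" using X ij k s(2) by blast
          moreover have "Up b \<in> flip_vertex ` \<beta> (i, j)" using s(3) ij(2) by (simp only: fUp)
          note Y[THEN conjunct2, THEN conjunct1, rule_format, OF ij(1) k this]
          ultimately show ?thesis by simp
        qed
        then show "dmat q A D" unfolding dmat_diagram_iff[OF qd] using X Y by blast
      next
        assume dq: "dmat q A D"
        note Q = dq[unfolded dmat_diagram_iff[OF qd]]
        \<comment> \<open>Conversely, the inner sets are dictated by the outer ones: a column
          belongs to \<open>B\<close> or \<open>C\<close> according to the value on the part of
          \<open>q\<close> it is attached to. \<open>tB\<close> and \<open>tC\<close> are the values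
          on the parts that hold the tails.\<close>
        define tB where "tB \<longleftrightarrow> (\<exists>a\<in>A. Up a \<in> s0)"
        define tC where "tC \<longleftrightarrow> (\<exists>a\<in>D. Up a \<in> s1)"
        define B where "B = {k. (\<exists>i j. (i, j) \<in> block_index l m \<and> k \<in> block l m i j \<and>
          (\<exists>a\<in>A. Up a \<in> \<beta> (i, j))) \<or> k \<in> {rank_vec l m<..n} \<and> tB}"
        define C where "C = {k. (\<exists>i j. (i, j) \<in> block_index l m \<and> k \<in> block l m i j \<and>
          (\<exists>a\<in>D. Dn a \<in> \<beta> (i, j))) \<or> k \<in> {rank_vec l m<..n} \<and> tC}"
        have Bs: "B \<subseteq> {1..n}" and Cs: "C \<subseteq> {1..n}"
          unfolding B_def C_def using block_subset[OF l m] by auto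
        have kB: "k \<in> B \<longleftrightarrow> (\<exists>a\<in>A. Up a \<in> \<beta> (i, j))" and kC: "k \<in> C \<longleftrightarrow> (\<exists>a\<in>D. Dn a \<in> \<beta> (i, j))"
          if ij: "(i, j) \<in> block_index l m" "k \<in> block l m i j" for i j k
        proof -
          have "k \<notin> {rank_vec l m<..n}" using block_bounds(4)[OF ij] by simp
          then show "k \<in> B \<longleftrightarrow> (\<exists>a\<in>A. Up a \<in> \<beta> (i, j))" "k \<in> C \<longleftrightarrow> (\<exists>a\<in>D. Dn a \<in> \<beta> (i, j))"
            unfolding B_def C_def using ij block_index_unique by blast+
        qed
        have kt: "k \<in> B \<longleftrightarrow> tB" "k \<in> C \<longleftrightarrow> tC" if "k \<in> {rank_vec l m<..n}" for k
          unfolding B_def C_def using that block_bounds(4) by fastforce+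
        have uA: "a \<in> A \<longleftrightarrow> b \<in> A" if "s \<in> q" "Up a \<in> s" "Up b \<in> s" for s a b
          using Q that unfolding upper_sat_def by blast
        have uD: "a \<in> D \<longleftrightarrow> b \<in> D" if "s \<in> q" "Dn a \<in> s" "Dn b \<in> s" for s a b
          using Q that unfolding upper_sat_flip_iff by blast
        have uD': "a \<in> D \<longleftrightarrow> b \<in> D" if "s \<in> flip_diag q" "Up a \<in> s" "Up b \<in> s" for s a b
          using Q that unfolding upper_sat_def by blast
        have \<beta>q': "\<beta> (i, j) \<in> q" if "(i, j) \<in> block_index l m" for i j
          using \<beta>q[OF that] by (simp add: prop_parts_def)
        have "dmat x A B"
          unfolding x[OF A Bs]
        proof (intro conjI allI impI)
          show "upper_sat q A" using Q by blast
          show "k \<in> B \<longleftrightarrow> a \<in> A"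
            if "(i, j) \<in> block_index l m" "k \<in> block l m i j" "Up a \<in> \<beta> (i, j)" for i j k a
            unfolding kB[OF that(1,2)] using uA[OF \<beta>q'[OF that(1)]] that(3) by blast
          show "k \<in> B \<longleftrightarrow> a \<in> A" if "k \<in> {rank_vec l m<..n}" "Up a \<in> s0" for k a
            unfolding kt(1)[OF that(1)] tB_def using uA[OF s0(1)[OF rng[OF that(1)]]] that(2) by blast
        qed
        moreover have "dmat y D C"
          unfolding y[OF D Cs]
        proof (intro conjI allI impI)
          show "upper_sat (flip_diag q) D" using Q by blast
          show "k \<in> C \<longleftrightarrow> a \<in> D" if "(i, j) \<in> block_index l m" "k \<in> block l m i j"
            "Up a \<in> flip_vertex ` \<beta> (i, j)" for i j k a
            unfolding kC[OF that(1,2)] using uD[OF \<beta>q'[OF that(1)]] that(3)[unfolded fUp] by blast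
          show "k \<in> C \<longleftrightarrow> a \<in> D" if "k \<in> {rank_vec l m<..n}" "Up a \<in> s1" for k a
            unfolding kt(2)[OF that(1)] tC_def using uD'[OF s1(1)[OF rng[OF that(1)]]] that(2) by blast
        qed
        moreover have "dmat ?a B C"
          unfolding dmat_def saturated_def
        proof
          fix s assume "s \<in> ?a"
          then consider (b) i j where "(i, j) \<in> block_index l m"
              "s = Up ` block l m i j \<union> Dn ` block l m i j"
            | (u) T where "T \<in> tails l n m" "s = Up ` T" | (d) T where "T \<in> tails l n m" "s = Dn ` T"
            unfolding a_diag_eq[OF l m] by auto
          then show "s \<subseteq> Up ` B \<union> Dn ` C \<or> s \<inter> (Up ` B \<union> Dn ` C) = {}"
          proof cases
            case b
            have "(\<exists>a\<in>A. Up a \<in> \<beta> (i, j)) \<longleftrightarrow> (\<exists>a\<in>D. Dn a \<in> \<beta> (i, j))"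
            proof -
              have "\<exists>a. Up a \<in> \<beta> (i, j)" "\<exists>a. Dn a \<in> \<beta> (i, j)"
                using \<beta>q[OF b(1)] by (auto simp: prop_parts_def propagating_def)
              moreover have "a \<in> A \<longleftrightarrow> b \<in> D" if "Up a \<in> \<beta> (i, j)" "Dn b \<in> \<beta> (i, j)" for a b
                using Q \<beta>q[OF b(1)] that by blast
              ultimately show ?thesis by metis
            qed
            then have "(block l m i j \<subseteq> B \<and> block l m i j \<subseteq> C) \<or>
              (block l m i j \<inter> B = {} \<and> block l m i j \<inter> C = {})"
              using kB[OF b(1)] kC[OF b(1)] by auto
            then show ?thesis unfolding b(2) by auto
          next
            case u
            have "T \<subseteq> {rank_vec l m<..n}" using tail_bounds[OF u(1)] tail_subset[OF l m u(1)] by auto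
            then have "T \<subseteq> B \<or> T \<inter> B = {}" using kt(1) by blast
            then show ?thesis unfolding u(2) by auto
          next
            case d
            have "T \<subseteq> {rank_vec l m<..n}" using tail_bounds[OF d(1)] tail_subset[OF l m d(1)] by auto
            then have "T \<subseteq> C \<or> T \<inter> C = {}" using kt(2) by blast
            then show ?thesis unfolding d(2) by auto
          qed
        qed
        ultimately show "\<exists>C\<subseteq>{1..n}. \<exists>B\<subseteq>{1..n}. dmat x A B \<and> dmat ?a B C \<and> dmat y D C"
          using Bs Cs by blast
      qed
      finally show "dmat (compose_diag n n n (compose_diag n n n x ?a) (flip_diag y)) A D \<longleftrightarrow>
        dmat q A D" .
    qed
  qed
qed


section \<open>Standard diagrams and the action of the symmetric groups\<close>

definition below :: "nat \<Rightarrow> nat \<Rightarrow> (nat \<Rightarrow> nat) \<Rightarrow> diagram set" where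
  "below l n m = {p \<in> tonal_diagrams l n. index_less l (prop_vector l p) m}"

definition block_diag :: "nat \<Rightarrow> nat \<Rightarrow> (nat \<Rightarrow> nat) \<Rightarrow> (nat \<Rightarrow> nat \<Rightarrow> nat) \<Rightarrow> diagram" where
  "block_diag l n m \<sigma> = perm_diag n (block_perm l m \<sigma>)"

lemma tonal_diagramsD: "p \<in> tonal_diagrams l n \<Longrightarrow> p \<in> diagrams n n"
  by (simp add: tonal_diagrams_iff)

lemma compose_tonal_diagrams:
  "p \<in> tonal_diagrams l n \<Longrightarrow> q \<in> tonal_diagrams l n \<Longrightarrow> compose_diag n n n p q \<in> tonal_diagrams l n"
  by (simp add: tonal_diagrams_iff tonal_compose_diag)

lemma flip_tonal_diagrams: "p \<in> tonal_diagrams l n \<Longrightarrow> flip_diag p \<in> tonal_diagrams l n"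
  by (simp add: tonal_diagrams_iff tonal_flip flip_diag_in_diagrams)

lemma id_diag_tonal: "id_diag n \<in> tonal_diagrams l n"
  using id_diag_in_diagrams tonal_perm_diag[of l n id] by (simp add: tonal_diagrams_iff id_diag_eq)

lemma prop_vector_flip_tonal:
  "p \<in> tonal_diagrams l n \<Longrightarrow> prop_vector l (flip_diag p) = prop_vector l p"
  by (rule prop_vector_flip) (auto simp: tonal_diagrams_iff intro: finite_diagram)

lemma std_diagrams_tonal: "d \<in> std_diagrams l n m \<Longrightarrow> d \<in> tonal_diagrams l n"
  by (simp add: std_diagrams_def)

lemma std_not_below: "d \<in> std_diagrams l n m \<Longrightarrow> d \<notin> below l n m"
  by (simp add: std_diagrams_def below_def index_less_def)

lemma below_flip: "p \<in> below l n m \<Longrightarrow> flip_diag p \<in> below l n m"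
  by (auto simp: below_def flip_tonal_diagrams prop_vector_flip_tonal)

context
  fixes l n :: nat and m :: "nat \<Rightarrow> nat"
  assumes l: "l \<ge> 1" and m: "m \<in> index_set l n"
begin

text \<open>Antisymmetry of the order speaks about coordinates in \<open>{1..l}\<close> only;
  strictness compares whole functions, so vanishing outside \<open>{1..l}\<close> closes the
  gap.\<close>

lemma index_less_le_trans:
  assumes "index_le l m'' m'" "index_less l m' m" "\<And>k. k \<notin> {1..l} \<Longrightarrow> m' k = 0"
  shows "index_less l m'' m"
proof -
  have le: "index_le l m'' m" using assms index_le_trans unfolding index_less_def by blast
  have "m'' \<noteq> m"
  proof
    assume eq: "m'' = m"
    have "m' k = m k" for k
    proof (cases "k \<in> {1..l}")
      case True
      then show ?thesis
        using index_le_antisym[OF l, of m' m k] assms(1,2) eq by (auto simp: index_less_def)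
    next
      case False
      then show ?thesis using assms(3) m by (simp add: index_set_def)
    qed
    then show False using assms(2) by (auto simp: index_less_def)
  qed
  then show ?thesis using le by (simp add: index_less_def)
qed

lemma below_compose:
  assumes p: "p \<in> tonal_diagrams l n" and q: "q \<in> below l n m"
  shows "compose_diag n n n p q \<in> below l n m" "compose_diag n n n q p \<in> below l n m"
proof -
  have pd: "p \<in> diagrams n n" "tonal l p" and qt: "q \<in> tonal_diagrams l n"
    and qd: "q \<in> diagrams n n" "tonal l q" and less: "index_less l (prop_vector l q) m"
    using p q by (auto simp: below_def tonal_diagrams_iff)
  show "compose_diag n n n p q \<in> below l n m"
    using compose_tonal_diagrams[OF p qt] index_less_le_trans[OF
        prop_vector_compose_lower[OF pd(1) qd(1) l pd(2) qd(2)] less prop_vector_zero]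
    by (simp add: below_def)
  show "compose_diag n n n q p \<in> below l n m"
    using compose_tonal_diagrams[OF qt p] index_less_le_trans[OF
        prop_vector_compose_upper[OF qd(1) pd(1) l qd(2) pd(2)] less prop_vector_zero]
    by (simp add: below_def)
qed

lemma a_diag_std: "a_diag l n m \<in> std_diagrams l n m"
  by (simp add: std_diagrams_def a_diag_tonal_diagram[OF l m] prop_vector_a_diag[OF l m])

text \<open>Either the propagating vector drops, or the equality case applies and the bottom row is
  still that of a^m.\<close>

lemma compose_a_diag_cases:
  assumes p: "p \<in> tonal_diagrams l n"
  shows "compose_diag n n n p (a_diag l n m) \<in> std_diagrams l n m \<union> below l n m"
proof -
  let ?a = "a_diag l n m"
  have pd: "p \<in> diagrams n n" "tonal l p" using p by (auto simp: tonal_diagrams_iff)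
  note ad = a_diag_in_diagrams[OF l m] tonal_a_diag[OF l m]
  note pa = compose_tonal_diagrams[OF p a_diag_tonal_diagram[OF l m]]
  have le: "index_le l (prop_vector l (compose_diag n n n p ?a)) m"
    using prop_vector_compose_lower[OF pd(1) ad(1) l pd(2) ad(2)]
    by (simp add: prop_vector_a_diag[OF l m])
  show ?thesis
  proof (cases "prop_vector l (compose_diag n n n p ?a) = m")
    case True
    then have eq: "prop_vector l (compose_diag n n n p ?a) = prop_vector l ?a"
      by (simp add: prop_vector_a_diag[OF l m])
    show ?thesis
      using pa True bottom_restriction_compose[OF pd(1) ad(1) l eq]
        nonprop_bottom_compose[OF pd(1) ad(1) l eq] by (simp add: std_diagrams_def)
  next
    case False
    then show ?thesis using pa le by (simp add: below_def index_less_def)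
  qed
qed

text \<open>The lower half is a bottom block or a tail of a^m. A tail is already a complete part of
  \<open>d\<close>, so it cannot be half of a propagating one.\<close>

lemma std_lower:
  assumes d: "d \<in> std_diagrams l n m" and s: "s \<in> prop_parts d"
  obtains i j where "(i, j) \<in> block_index l m" "s \<inter> range Dn = bottom_block l m i j"
proof -
  have dd: "d \<in> diagrams n n" using d by (simp add: std_diagrams_def tonal_diagrams_iff)
  have "s \<inter> range Dn \<in> bottom_restriction (a_diag l n m)"
    using d s bottom_restriction_eq[OF dd] by (auto simp: std_diagrams_def)
  then consider (b) i j where "(i, j) \<in> block_index l m" "s \<inter> range Dn = bottom_block l m i j"
    | (t) T where "T \<in> tails l n m" "s \<inter> range Dn = Dn ` T"
    unfolding bottom_restriction_a_diag[OF l m] by auto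
  then show thesis
  proof cases
    case b then show thesis by (rule that)
  next
    case t
    then have "Dn ` T \<in> nonprop_bottom d"
      using d nonprop_bottom_a_diag[OF l m] by (simp add: std_diagrams_def)
    then have "Dn ` T \<in> d" by (simp add: nonprop_bottom_def)
    moreover obtain x where "x \<in> T" using tail_ne[OF l m t(1)] by blast
    moreover have "s \<in> d" using s by (simp add: prop_parts_def)
    ultimately have "s = Dn ` T" using diagrams_part_cong[OF dd, of s "Dn ` T" "Dn x"] t(2) by blast
    then show thesis using s by (auto simp: prop_parts_def propagating_def)
  qed
qed

lemma std_ex_part:
  assumes d: "d \<in> std_diagrams l n m" and ij: "(i, j) \<in> block_index l m"
  obtains s where "s \<in> prop_parts d" "s \<inter> range Dn = bottom_block l m i j"
proof -
  have dd: "d \<in> diagrams n n" using d by (simp add: std_diagrams_def tonal_diagrams_iff)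
  have "bottom_block l m i j \<in> bottom_restriction d"
    using d ij bottom_restriction_a_diag[OF l m] by (auto simp: std_diagrams_def)
  then consider (p) s where "s \<in> prop_parts d" "bottom_block l m i j = s \<inter> range Dn"
    | (t) "bottom_block l m i j \<in> nonprop_bottom d"
    unfolding bottom_restriction_eq[OF dd] by auto
  then show thesis
  proof cases
    case p then show thesis using that by simp
  next
    case t
    then obtain T where T: "T \<in> tails l n m" "bottom_block l m i j = Dn ` T"
      using d nonprop_bottom_a_diag[OF l m] by (auto simp: std_diagrams_def)
    then have "block l m i j = T" by (simp add: bottom_block_eq inj_image_eq_iff inj_def)
    then show thesis using block_ne[OF ij] tail_block_disjoint[OF ij _ T(1)] by blast
  qed
qed

lemma std_nonprop:
  assumes d: "d \<in> std_diagrams l n m" and s: "s \<in> d" "\<not> propagating s"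
  shows "s \<subseteq> range Up \<or> s \<in> (`) Dn ` tails l n m"
proof -
  have dd: "d \<in> diagrams n n" using d by (simp add: std_diagrams_def tonal_diagrams_iff)
  have "s \<in> (`) Dn ` tails l n m" if "s \<subseteq> range Dn"
  proof -
    have "s \<in> nonprop_bottom d" using s that by (simp add: nonprop_bottom_def)
    then show ?thesis using d nonprop_bottom_a_diag[OF l m] by (simp add: std_diagrams_def)
  qed
  then show ?thesis using diagrams_part_cases[OF dd s] by blast
qed

section \<open>Block permutations as diagrams, and their action on standard diagrams\<close>

lemma block_perm_permutes:
  assumes "\<sigma> \<in> sym_prod m" shows "block_perm l m \<sigma> permutes {1..n}"
proof -
  have "bij (block_perm l m \<sigma>)" using block_perm_inv[OF assms] by (intro o_bij)
  moreover have "block_perm l m \<sigma> x = x" if "x \<notin> {1..n}" for x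
    by (rule block_perm_outside) (use block_subset[OF l m] that in blast)
  ultimately show ?thesis by (auto simp: permutes_def bij_iff)
qed

lemma block_diag_in_diagrams: "\<sigma> \<in> sym_prod m \<Longrightarrow> block_diag l n m \<sigma> \<in> diagrams n n"
  unfolding block_diag_def by (intro perm_diag_in_diagrams block_perm_permutes)

lemma block_diag_tonal: "\<sigma> \<in> sym_prod m \<Longrightarrow> block_diag l n m \<sigma> \<in> tonal_diagrams l n"
  unfolding tonal_diagrams_iff using block_diag_in_diagrams
  by (simp add: block_diag_def tonal_perm_diag)

lemma flip_block_diag:
  "\<sigma> \<in> sym_prod m \<Longrightarrow> flip_diag (block_diag l n m \<sigma>) = block_diag l n m (\<lambda>i. inv_into UNIV (\<sigma> i))"
  unfolding block_diag_def by (simp add: flip_perm_diag[OF block_perm_permutes] inv_block_perm)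

lemma compose_block_diag:
  assumes \<sigma>: "\<sigma> \<in> sym_prod m" and \<tau>: "\<tau> \<in> sym_prod m"
  shows "compose_diag n n n (block_diag l n m \<sigma>) (block_diag l n m \<tau>) =
      block_diag l n m (\<lambda>i. \<sigma> i \<circ> \<tau> i)"
    and "loops n n n (block_diag l n m \<sigma>) (block_diag l n m \<tau>) = 0"
proof -
  note P\<sigma> = block_perm_permutes[OF \<sigma>] and P\<tau> = block_perm_permutes[OF \<tau>]
  note P = block_perm_permutes[OF sym_prod_comp[OF \<sigma> \<tau>]]
  have d: "dmat (perm_diag n (block_perm l m (\<lambda>i. \<sigma> i \<circ> \<tau> i))) A C \<longleftrightarrow>
      dmat (perm_diag n (block_perm l m \<sigma>)) A (block_perm l m \<tau> ` C)"
    if A: "A \<subseteq> {1..n}" and C: "C \<subseteq> {1..n}" for A C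
  proof -
    have C': "block_perm l m \<tau> ` C \<subseteq> {1..n}" using C permutes_image[OF P\<tau>] by blast
    have "block_perm l m (\<lambda>i. \<sigma> i \<circ> \<tau> i) ` C = block_perm l m \<sigma> ` block_perm l m \<tau> ` C"
      unfolding block_perm_comp[OF \<tau>, symmetric] image_comp ..
    then show ?thesis unfolding dmat_perm_diag[OF P A C] dmat_perm_diag[OF P\<sigma> A C'] by simp
  qed
  note * = compose_perm_diag_right[OF perm_diag_in_diagrams[OF P\<sigma>] P\<tau> perm_diag_in_diagrams[OF P] d]
  show "compose_diag n n n (block_diag l n m \<sigma>) (block_diag l n m \<tau>) =
      block_diag l n m (\<lambda>i. \<sigma> i \<circ> \<tau> i)"
    "loops n n n (block_diag l n m \<sigma>) (block_diag l n m \<tau>) = 0"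
    unfolding block_diag_def using * by auto
qed

text \<open>This turns the action by relabelling bottom blocks into a multiplication. Upper parts
  and tails do not move under a block permutation, so only propagating parts change.\<close>

lemma std_compose_block_diag:
  assumes d: "d \<in> std_diagrams l n m" and \<sigma>: "\<sigma> \<in> sym_prod m"
  shows "compose_diag n n n d (block_diag l n m \<sigma>) = permute_bottom l m d \<sigma>"
    and "loops n n n d (block_diag l n m \<sigma>) = 0"
proof -
  let ?\<pi> = "block_perm l m \<sigma>"
  let ?f = "relabel_lower (inv_into UNIV ?\<pi>)"
  have dd: "d \<in> diagrams n n" using d by (simp add: std_diagrams_def tonal_diagrams_iff)
  note P = block_perm_permutes[OF \<sigma>]
  show "loops n n n d (block_diag l n m \<sigma>) = 0"
    unfolding block_diag_def by (rule compose_perm_diag_relabel(2)[OF dd P])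
  have fUp: "?f ` s = s" if "s \<subseteq> range Up" for s
    using that by (force simp: image_iff)
  have f_tail: "?f ` (Dn ` T) = Dn ` T" if "T \<in> tails l n m" for T
  proof -
    have "inv_into UNIV ?\<pi> k = k" if "k \<in> T" for k
    proof -
      have "?\<pi> k = k"
        by (rule block_perm_outside) (use tail_block_disjoint \<open>T \<in> _\<close> that in blast)
      then show ?thesis using permutes_inverses(2)[OF P] by metis
    qed
    then show ?thesis by (simp add: image_image)
  qed
  have f_np: "?f ` s = s" if "s \<in> d" "\<not> propagating s" for s
    using std_nonprop[OF d that]
  proof
    assume "s \<in> (`) Dn ` tails l n m"
    then obtain T where "T \<in> tails l n m" "s = Dn ` T" by blast
    then show ?thesis using f_tail by simp
  qed (rule fUp)
  \<comment> \<open>The relabelling uses the inverse permutation, so the part over block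
    \<open>\<sigma> i j\<close> receives block \<open>j\<close>, as the convention for the right
    action demands.\<close>
  have f_prop: "?f ` s = (s \<inter> range Up) \<union> bottom_block l m i j"
    if s: "s \<in> d" and ij: "(i, j) \<in> block_index l m"
      and b: "s \<inter> range Dn = bottom_block l m i (\<sigma> i j)" for s i j
  proof -
    have "s \<subseteq> range Up \<union> range Dn" using diagrams_part_subset[OF dd s] by auto
    then have "s = (s \<inter> range Up) \<union> (s \<inter> range Dn)" by blast
    then have "?f ` s = ?f ` (s \<inter> range Up) \<union> ?f ` (s \<inter> range Dn)" by (metis image_Un)
    moreover have "?f ` (s \<inter> range Dn) = bottom_block l m i j"
    proof -
      have "?f ` (s \<inter> range Dn) = Dn ` (inv_into UNIV ?\<pi> ` (?\<pi> ` block l m i j))"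
        unfolding b bottom_block_eq image_block_perm[OF ij] by (simp add: image_image)
      also have "\<dots> = bottom_block l m i j"
        unfolding bottom_block_eq by (simp add: image_image permutes_inverses[OF P])
      finally show ?thesis .
    qed
    ultimately show ?thesis using fUp[of "s \<inter> range Up"] by simp
  qed
  have idx: "(i, j) \<in> block_index l m \<longleftrightarrow> i \<in> {1..l} \<and> j \<in> {1..m i}" for i j
    by (simp add: block_index_def)
  have "(`) ?f ` d = permute_bottom l m d \<sigma>"
  proof (intro Set.set_eqI iffI)
    fix u assume "u \<in> (`) ?f ` d"
    then obtain s where s: "s \<in> d" "u = ?f ` s" by blast
    show "u \<in> permute_bottom l m d \<sigma>"
    proof (cases "propagating s")
      case False
      then show ?thesis using s f_np by (auto simp: permute_bottom_def)
    next
      case True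
      then obtain i j' where ij': "(i, j') \<in> block_index l m" "s \<inter> range Dn = bottom_block l m i j'"
        using std_lower[OF d] s by (metis (mono_tags, lifting) mem_Collect_eq prop_parts_def)
      have "\<sigma> i permutes {1..m i}" using \<sigma> by (simp add: sym_prod_def)
      then obtain j where j: "j \<in> {1..m i}" "\<sigma> i j = j'"
        using ij' permutes_image[of "\<sigma> i" "{1..m i}"] by (metis idx imageE)
      then have "(i, j) \<in> block_index l m" using ij' by (simp add: idx)
      then have "u = (s \<inter> range Up) \<union> bottom_block l m i j" using f_prop s ij' j by simp
      then show ?thesis using s True ij' j unfolding permute_bottom_def idx by blast
    qed
  next
    fix u assume "u \<in> permute_bottom l m d \<sigma>"
    then consider (np) "u \<in> d" "\<not> propagating u"
      | (p) s i j where "s \<in> d" "i \<in> {1..l}" "j \<in> {1..m i}" "s \<inter> range Dn = bottom_block l m i (\<sigma> i j)"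
        "u = (s \<inter> range Up) \<union> bottom_block l m i j"
      unfolding permute_bottom_def by blast
    then show "u \<in> (`) ?f ` d"
    proof cases
      case np then show ?thesis using f_np by (metis image_eqI)
    next
      case p
      have "(i, j) \<in> block_index l m" using p(2,3) by (simp add: idx)
      then have "u = ?f ` s" using f_prop[OF p(1) _ p(4)] p(5) by simp
      then show ?thesis using p(1) by blast
    qed
  qed
  then show "compose_diag n n n d (block_diag l n m \<sigma>) = permute_bottom l m d \<sigma>"
    unfolding block_diag_def using compose_perm_diag_relabel(1)[OF dd P] by simp
qed

lemma permute_bottom_a_diag:
  assumes \<sigma>: "\<sigma> \<in> sym_prod m"
  shows "permute_bottom l m (a_diag l n m) \<sigma> =
    (\<lambda>(i, j). Up ` block l m i (\<sigma> i j) \<union> Dn ` block l m i j) ` block_index l m \<union>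
    ((`) Up ` tails l n m \<union> (`) Dn ` tails l n m)"
proof -
  let ?s = "\<lambda>i j. Up ` block l m i j \<union> Dn ` block l m i j"
  have int: "?s i j \<inter> range Up = Up ` block l m i j" "?s i j \<inter> range Dn = Dn ` block l m i j" for i j
    by auto
  have prp: "propagating (?s i j)" if "(i, j) \<in> block_index l m" for i j
    unfolding propagating_def int using block_ne[OF that] by simp
  have np: "\<not> propagating (Up ` T)" "\<not> propagating (Dn ` T)" for T by (auto simp: propagating_def)
  have idx: "(i, j) \<in> block_index l m \<longleftrightarrow> i \<in> {1..l} \<and> j \<in> {1..m i}" for i j
    by (simp add: block_index_def)
  show ?thesis
  proof (intro Set.set_eqI iffI)
    fix u assume "u \<in> permute_bottom l m (a_diag l n m) \<sigma>"
    then consider (np) "u \<in> a_diag l n m" "\<not> propagating u"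
      | (p) s i j where "s \<in> prop_parts (a_diag l n m)" "(i, j) \<in> block_index l m"
        "s \<inter> range Dn = bottom_block l m i (\<sigma> i j)" "u = (s \<inter> range Up) \<union> bottom_block l m i j"
      unfolding permute_bottom_def prop_parts_def idx by blast
    then show "u \<in> (\<lambda>(i, j). Up ` block l m i (\<sigma> i j) \<union> Dn ` block l m i j) ` block_index l m \<union>
      ((`) Up ` tails l n m \<union> (`) Dn ` tails l n m)"
    proof cases
      case np then show ?thesis unfolding a_diag_eq[OF l m] using prp by auto
    next
      case p
      then obtain i' j' where ij': "(i', j') \<in> block_index l m" "s = ?s i' j'"
        unfolding prop_parts_a_diag[OF l m] by auto
      then have "block l m i' j' = block l m i (\<sigma> i j)"
        using p(3) by (simp add: int bottom_block_eq inj_image_eq_iff inj_def)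
      then have "u = Up ` block l m i (\<sigma> i j) \<union> Dn ` block l m i j"
        using p(4) ij' by (simp add: int bottom_block_eq)
      then show ?thesis using p(2) by force
    qed
  next
    fix u assume "u \<in> (\<lambda>(i, j). Up ` block l m i (\<sigma> i j) \<union> Dn ` block l m i j) ` block_index l m \<union>
      ((`) Up ` tails l n m \<union> (`) Dn ` tails l n m)"
    then consider (b) i j where "(i, j) \<in> block_index l m"
        "u = Up ` block l m i (\<sigma> i j) \<union> Dn ` block l m i j"
      | (t) "u \<in> (`) Up ` tails l n m \<union> (`) Dn ` tails l n m" by auto
    then show "u \<in> permute_bottom l m (a_diag l n m) \<sigma>"
    proof cases
      case b
      note ij = sym_prod_index[OF \<sigma> b(1)]
      have "?s i (\<sigma> i j) \<in> a_diag l n m" unfolding a_diag_eq[OF l m] using ij by force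
      then have "(?s i (\<sigma> i j) \<inter> range Up) \<union> bottom_block l m i j \<in> permute_bottom l m (a_diag l n m) \<sigma>"
        unfolding permute_bottom_def
        by (intro UnI2 CollectI exI[of _ "?s i (\<sigma> i j)"] exI[of _ i] exI[of _ j])
          (use prp[OF ij] b(1)[unfolded idx] int(2)[of i "\<sigma> i j"] in
            \<open>simp add: bottom_block_eq\<close>)
      then show ?thesis using b(2) by (simp add: int bottom_block_eq)
    next
      case t
      then show ?thesis unfolding permute_bottom_def a_diag_eq[OF l m] using np by auto
    qed
  qed
qed

text \<open>Both products join the top block \<open>\<sigma> i j\<close> to the bottom block
  \<open>j\<close>. The left product is obtained from the right one by flipping and inverting
  \<sigma>.\<close>

lemma compose_a_block_diag:
  assumes \<sigma>: "\<sigma> \<in> sym_prod m"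
  shows "compose_diag n n n (a_diag l n m) (block_diag l n m \<sigma>) =
      compose_diag n n n (block_diag l n m \<sigma>) (a_diag l n m)"
    and "loops n n n (a_diag l n m) (block_diag l n m \<sigma>) = 0"
    and "loops n n n (block_diag l n m \<sigma>) (a_diag l n m) = 0"
proof -
  let ?a = "a_diag l n m" and ?\<sigma>' = "\<lambda>i. inv_into UNIV (\<sigma> i)"
  note \<sigma>' = sym_prod_inv[OF \<sigma>]
  note fl = flip_compose_diag[OF a_diag_in_diagrams[OF l m] block_diag_in_diagrams[OF \<sigma>']]
  have ff: "flip_diag (block_diag l n m ?\<sigma>') = block_diag l n m \<sigma>"
    using flip_block_diag[OF \<sigma>] by (metis flip_diag_flip)
  show "loops n n n ?a (block_diag l n m \<sigma>) = 0"
    by (rule std_compose_block_diag(2)[OF a_diag_std \<sigma>])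
  show "loops n n n (block_diag l n m \<sigma>) ?a = 0"
    using fl(2) std_compose_block_diag(2)[OF a_diag_std \<sigma>'] by (simp add: ff flip_a_diag[OF l m])
  have \<sigma>i: "\<sigma> i permutes {1..m i}" for i using \<sigma> by (simp add: sym_prod_def)
  have "compose_diag n n n (block_diag l n m \<sigma>) ?a = flip_diag (permute_bottom l m ?a ?\<sigma>')"
    using fl(1) std_compose_block_diag(1)[OF a_diag_std \<sigma>'] by (simp add: ff flip_a_diag[OF l m])
  also have "\<dots> = permute_bottom l m ?a \<sigma>"
  proof -
    \<comment> \<open>The same set of parts, indexed by top blocks on one side and by bottom blocks
      on the other.\<close>
    have "(\<lambda>(i, j). Up ` block l m i j \<union> Dn ` block l m i (?\<sigma>' i j)) ` block_index l m =
      (\<lambda>(i, j). Up ` block l m i (\<sigma> i j) \<union> Dn ` block l m i j) ` block_index l m"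
    proof (intro Set.set_eqI iffI)
      fix u assume "u \<in> (\<lambda>(i, j). Up ` block l m i j \<union> Dn ` block l m i (?\<sigma>' i j)) ` block_index l m"
      then obtain i j where ij: "(i, j) \<in> block_index l m"
        "u = Up ` block l m i j \<union> Dn ` block l m i (?\<sigma>' i j)" by auto
      then show "u \<in> (\<lambda>(i, j). Up ` block l m i (\<sigma> i j) \<union> Dn ` block l m i j) ` block_index l m"
        using sym_prod_index[OF \<sigma>' ij(1)]
        by (intro image_eqI[of _ _ "(i, ?\<sigma>' i j)"]) (simp_all add: permutes_inverses[OF \<sigma>i])
    next
      fix u assume "u \<in> (\<lambda>(i, j). Up ` block l m i (\<sigma> i j) \<union> Dn ` block l m i j) ` block_index l m"
      then obtain i j where ij: "(i, j) \<in> block_index l m"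
        "u = Up ` block l m i (\<sigma> i j) \<union> Dn ` block l m i j" by auto
      then show "u \<in> (\<lambda>(i, j). Up ` block l m i j \<union> Dn ` block l m i (?\<sigma>' i j)) ` block_index l m"
        using sym_prod_index[OF \<sigma> ij(1)]
        by (intro image_eqI[of _ _ "(i, \<sigma> i j)"]) (simp_all add: permutes_inverses[OF \<sigma>i])
    qed
    moreover have "flip_diag (permute_bottom l m ?a ?\<sigma>') =
      (\<lambda>(i, j). Up ` block l m i j \<union> Dn ` block l m i (?\<sigma>' i j)) ` block_index l m \<union>
      ((`) Up ` tails l n m \<union> (`) Dn ` tails l n m)"
      unfolding permute_bottom_a_diag[OF \<sigma>'] flip_diag_def
      by (simp add: image_Un image_image split_beta Un_commute)
    ultimately show ?thesis unfolding permute_bottom_a_diag[OF \<sigma>] by simp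
  qed
  finally show "compose_diag n n n ?a (block_diag l n m \<sigma>) = compose_diag n n n (block_diag l n m \<sigma>) ?a"
    using std_compose_block_diag(1)[OF a_diag_std \<sigma>] by simp
qed

text \<open>Block diagrams are invertible. If the product had a smaller vector, multiplying back
  would give a^m a smaller vector than its own.\<close>

lemma compose_a_block_diag_std:
  assumes \<sigma>: "\<sigma> \<in> sym_prod m"
  shows "compose_diag n n n (a_diag l n m) (block_diag l n m \<sigma>) \<in> std_diagrams l n m"
proof -
  let ?a = "a_diag l n m" and ?\<sigma>' = "\<lambda>i. inv_into UNIV (\<sigma> i)"
  note \<sigma>' = sym_prod_inv[OF \<sigma>]
  have "compose_diag n n n ?a (block_diag l n m \<sigma>) \<notin> below l n m"
  proof
    assume "compose_diag n n n ?a (block_diag l n m \<sigma>) \<in> below l n m"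
    from below_compose(2)[OF block_diag_tonal[OF \<sigma>'] this]
    have "compose_diag n n n ?a (compose_diag n n n (block_diag l n m \<sigma>) (block_diag l n m ?\<sigma>')) \<in> below l n m"
      by (simp add: compose_diag_assoc(1)[OF a_diag_in_diagrams[OF l m]
            block_diag_in_diagrams[OF \<sigma>] block_diag_in_diagrams[OF \<sigma>']])
    moreover have "block_diag l n m (\<lambda>i. \<sigma> i \<circ> ?\<sigma>' i) = id_diag n"
      unfolding sym_prod_inv_comp(2)[OF \<sigma>] block_diag_def block_perm_id id_diag_eq ..
    ultimately have "?a \<in> below l n m"
      by (simp add: compose_block_diag(1)[OF \<sigma> \<sigma>']
          compose_id_diag_right(1)[OF a_diag_in_diagrams[OF l m]])
    then show False using std_not_below[OF a_diag_std] by blast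
  qed
  then show ?thesis
    using compose_a_diag_cases[OF block_diag_tonal[OF \<sigma>]] by (simp add: compose_a_block_diag(1)[OF \<sigma>])
qed

text \<open>The part over the bottom block \<open>j\<close> of size \<open>i\<close> shows
  \<open>\<sigma> i j\<close> in its top block; outside the blocks both families are the
  identity.\<close>

lemma inj_on_compose_a_block_diag:
  "inj_on (\<lambda>\<sigma>. compose_diag n n n (a_diag l n m) (block_diag l n m \<sigma>)) (sym_prod m)"
proof (rule inj_onI)
  fix \<sigma> \<tau> assume \<sigma>: "\<sigma> \<in> sym_prod m" and \<tau>: "\<tau> \<in> sym_prod m"
    and eq: "compose_diag n n n (a_diag l n m) (block_diag l n m \<sigma>) =
      compose_diag n n n (a_diag l n m) (block_diag l n m \<tau>)"
  let ?p = "\<lambda>\<sigma>. permute_bottom l m (a_diag l n m) \<sigma>"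
  let ?s = "\<lambda>\<sigma> i j. Up ` block l m i (\<sigma> i j) \<union> Dn ` block l m i j"
  have eq': "?p \<sigma> = ?p \<tau>"
    using eq std_compose_block_diag(1)[OF a_diag_std \<sigma>] std_compose_block_diag(1)[OF a_diag_std \<tau>]
    by simp
  have pd: "?p \<sigma> \<in> diagrams n n"
    using compose_diag_in_diagrams[OF a_diag_in_diagrams[OF l m] block_diag_in_diagrams[OF \<sigma>]]
      std_compose_block_diag(1)[OF a_diag_std \<sigma>] by simp
  show "\<sigma> = \<tau>"
  proof (intro ext)
    fix i j
    show "\<sigma> i j = \<tau> i j"
    proof (cases "(i, j) \<in> block_index l m")
      case True
      have "?s \<sigma> i j \<in> ?p \<sigma>" unfolding permute_bottom_a_diag[OF \<sigma>] using True by force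
      moreover have "?s \<tau> i j \<in> ?p \<sigma>"
        unfolding eq' permute_bottom_a_diag[OF \<tau>] using True by force
      moreover obtain x where "x \<in> block l m i j" using block_ne[OF True] by blast
      ultimately have "?s \<sigma> i j = ?s \<tau> i j"
        using diagrams_part_cong[OF pd, of "?s \<sigma> i j" "?s \<tau> i j" "Dn x"] by blast
      moreover have "Up -` ?s \<rho> i j = block l m i (\<rho> i j)" for \<rho> by auto
      ultimately have "block l m i (\<sigma> i j) = block l m i (\<tau> i j)" by metis
      then show ?thesis
        using block_inject(2)[OF sym_prod_index[OF \<sigma> True] sym_prod_index[OF \<tau> True]] by simp
    next
      case False
      have "j \<notin> {1..m i}"
        using False m by (auto simp: block_index_def index_set_def)
      then show ?thesis
        using \<sigma> \<tau> permutes_not_in[of "\<sigma> i"] permutes_not_in[of "\<tau> i"]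
        by (metis (no_types, lifting) mem_Collect_eq sym_prod_def)
    qed
  qed
qed

text \<open>Both rows of \<open>q\<close> carry the blocks and tails of a^m, so its propagating
  parts match top blocks with bottom blocks. By tone the sizes agree, and the matching is a family
  of permutations.\<close>

lemma std_flip_std:
  assumes q: "q \<in> std_diagrams l n m" and fq: "flip_diag q \<in> std_diagrams l n m"
  obtains \<sigma> where "\<sigma> \<in> sym_prod m"
    "q = compose_diag n n n (a_diag l n m) (block_diag l n m \<sigma>)"
proof -
  let ?s = "\<lambda>i j' j. Up ` block l m i j' \<union> Dn ` block l m i j"
  have qd: "q \<in> diagrams n n" and ton: "tonal l q"
    using q by (auto simp: std_diagrams_def tonal_diagrams_iff)
  have ex: "\<exists>j'. (i, j') \<in> block_index l m \<and> ?s i j' j \<in> q" if ij: "(i, j) \<in> block_index l m" for i j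
  proof -
    obtain s where s: "s \<in> prop_parts q" "s \<inter> range Dn = bottom_block l m i j"
      using std_ex_part[OF q ij] by blast
    have sq: "s \<in> q" using s by (simp add: prop_parts_def)
    have "flip_vertex ` s \<in> prop_parts (flip_diag q)"
      unfolding prop_parts_flip using s(1) by (simp add: flip_diag_def)
    then obtain i' j' where ij': "(i', j') \<in> block_index l m"
      "flip_vertex ` s \<inter> range Dn = bottom_block l m i' j'"
      using std_lower[OF fq] by blast
    then have "flip_vertex ` (s \<inter> range Up) = flip_vertex ` (Up ` block l m i' j')"
      by (simp add: flip_vertex_range bottom_block_eq image_image)
    then have up: "s \<inter> range Up = Up ` block l m i' j'"
      by (rule inj_image_eq_iff[OF inj_flip_vertex, THEN iffD1])
    have dn: "s \<inter> range Dn = Dn ` block l m i j" using s by (simp add: bottom_block_eq)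
    \<comment> \<open>Tone gives only a congruence, which is an equality because block sizes lie in
      \<open>{1..l}\<close>.\<close>
    have "[i' = i] (mod l)"
      using tonalD[OF ton sq] unfolding up dn by (simp add: card_image inj_on_def)
    then have "i' = i" using residue_unique[of i' l i] ij ij' by (auto simp: block_index_def)
    moreover have "s = (s \<inter> range Up) \<union> (s \<inter> range Dn)"
      using diagrams_part_subset[OF qd sq] by auto
    ultimately have "?s i j' j \<in> q" "(i, j') \<in> block_index l m" using sq up dn ij' by auto
    then show ?thesis by blast
  qed
  \<comment> \<open>The default \<open>j\<close> makes each \<open>\<sigma> i\<close> the identity
    outside \<open>{1..m i}\<close>, as \<open>permutes\<close> requires.\<close>
  define \<sigma> where "\<sigma> i j = (if (i, j) \<in> block_index l m
    then SOME j'. (i, j') \<in> block_index l m \<and> ?s i j' j \<in> q else j)" for i j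
  have \<sigma>: "(i, \<sigma> i j) \<in> block_index l m" "?s i (\<sigma> i j) j \<in> q" if "(i, j) \<in> block_index l m" for i j
    using someI_ex[OF ex[OF that]] that by (simp_all add: \<sigma>_def)
  have inj: "j = k" if ij: "(i, j) \<in> block_index l m" "(i, k) \<in> block_index l m" "\<sigma> i j = \<sigma> i k" for i j k
  proof -
    obtain x where "x \<in> block l m i (\<sigma> i j)" using block_ne[OF \<sigma>(1)[OF ij(1)]] by blast
    then have "?s i (\<sigma> i j) j = ?s i (\<sigma> i k) k"
      using diagrams_part_cong[OF qd \<sigma>(2)[OF ij(1)] \<sigma>(2)[OF ij(2)], of "Up x"] ij(3) by auto
    moreover have "Dn -` ?s i j' j = block l m i j" for j' j by auto
    ultimately have "block l m i j = block l m i k" by metis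
    then show ?thesis using block_inject(2)[OF ij(1,2)] by simp
  qed
  have sym: "\<sigma> \<in> sym_prod m"
    unfolding sym_prod_def
  proof (intro CollectI allI)
    fix i
    have idx: "(i, j) \<in> block_index l m \<longleftrightarrow> j \<in> {1..m i}" for j
      using m by (auto simp: block_index_def index_set_def)
    have "\<sigma> i ` {1..m i} \<subseteq> {1..m i}" using \<sigma>(1) idx by blast
    moreover have "inj_on (\<sigma> i) {1..m i}" by (rule inj_onI) (rule inj, simp_all add: idx)
    ultimately have "bij_betw (\<sigma> i) {1..m i} {1..m i}"
      using endo_inj_surj[of "{1..m i}" "\<sigma> i"] by (auto simp: bij_betw_def)
    then show "\<sigma> i permutes {1..m i}" by (rule bij_imp_permutes) (auto simp: \<sigma>_def idx)
  qed
  have sub: "permute_bottom l m (a_diag l n m) \<sigma> \<subseteq> q"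
  proof -
    have "nonprop_bottom q = (`) Dn ` tails l n m" "nonprop_bottom (flip_diag q) = (`) Dn ` tails l n m"
      using q fq nonprop_bottom_a_diag[OF l m] by (simp_all add: std_diagrams_def)
    then have dn: "Dn ` T \<in> q" and "Dn ` T \<in> flip_diag q" if "T \<in> tails l n m" for T
      using that by (auto simp: nonprop_bottom_def)
    moreover have "Up ` T \<in> q" if T: "Dn ` T \<in> flip_diag q" for T
    proof -
      obtain s where "s \<in> q" "Dn ` T = flip_vertex ` s"
        using T unfolding flip_diag_def by blast
      moreover have "Dn ` T = flip_vertex ` (Up ` T)" by (simp add: image_image)
      ultimately show ?thesis using inj_image_eq_iff[OF inj_flip_vertex] by metis
    qed
    ultimately show ?thesis unfolding permute_bottom_a_diag[OF sym] using \<sigma>(2) by auto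
  qed
  \<comment> \<open>Of two partitions of the same set, neither can properly contain the
    other.\<close>
  have "permute_bottom l m (a_diag l n m) \<sigma> = q"
  proof (rule subset_antisym[OF sub subsetI])
    let ?p = "permute_bottom l m (a_diag l n m) \<sigma>"
    have pd: "?p \<in> diagrams n n"
      using compose_diag_in_diagrams[OF a_diag_in_diagrams[OF l m] block_diag_in_diagrams[OF sym]]
        std_compose_block_diag(1)[OF a_diag_std sym] by simp
    fix s assume s: "s \<in> q"
    obtain v where v: "v \<in> s" using diagrams_part_ne[OF qd s] by blast
    then have "v \<in> Up ` {1..n} \<union> Dn ` {1..n}" by (rule subsetD[OF diagrams_part_subset[OF qd s]])
    then obtain t where t: "t \<in> ?p" "v \<in> t" using partition_on_ex_part[OF diagramsD[OF pd]] by blast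
    then have "t = s" using diagrams_part_cong[OF qd _ s, of t v] sub v by blast
    then show "s \<in> ?p" using t by simp
  qed
  then show thesis using that[OF sym] std_compose_block_diag(1)[OF a_diag_std sym] by simp
qed

text \<open>The flip of the product has the same shape, with \<open>p\<close> flipped. As
  \<open>below\<close> is stable under flips, either the product lies there or both it and its flip
  are standard.\<close>

lemma a_compose_a_cases:
  assumes p: "p \<in> tonal_diagrams l n"
  shows "compose_diag n n n (compose_diag n n n (a_diag l n m) p) (a_diag l n m) \<in> below l n m \<or>
    (\<exists>\<sigma>\<in>sym_prod m. compose_diag n n n (compose_diag n n n (a_diag l n m) p) (a_diag l n m) =
      compose_diag n n n (a_diag l n m) (block_diag l n m \<sigma>))"
proof -
  let ?a = "a_diag l n m"
  let ?q = "compose_diag n n n (compose_diag n n n ?a p) ?a"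
  note a = a_diag_tonal_diagram[OF l m] and ad = a_diag_in_diagrams[OF l m]
  note pd = tonal_diagramsD[OF p] and ap = compose_tonal_diagrams[OF a p]
  have fl: "flip_diag ?q = compose_diag n n n (compose_diag n n n ?a (flip_diag p)) ?a"
    using flip_compose_diag(1)[OF compose_diag_in_diagrams[OF ad pd] ad]
      flip_compose_diag(1)[OF ad pd]
      compose_diag_assoc(1)[OF ad flip_diag_in_diagrams[OF pd] ad]
    by (simp add: flip_a_diag[OF l m])
  have f: "flip_diag ?q \<in> std_diagrams l n m \<union> below l n m"
    unfolding fl by (rule compose_a_diag_cases[OF compose_tonal_diagrams[OF a flip_tonal_diagrams[OF p]]])
  from compose_a_diag_cases[OF ap] show ?thesis
  proof
    assume q: "?q \<in> std_diagrams l n m"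
    have "flip_diag ?q \<notin> below l n m"
      using below_flip[of "flip_diag ?q" l n m] std_not_below[OF q] by auto
    then have "flip_diag ?q \<in> std_diagrams l n m" using f by blast
    from std_flip_std[OF q this] show ?thesis by metis
  qed blast
qed

end


section \<open>The tonal algebra and its quotients\<close>

text \<open>Change of variables for the push-forward of the coefficients \<open>x\<close> along
  \<open>u\<close>; coefficients with the same image add up.\<close>

lemma sum_delta_image:
  fixes \<phi> :: "'b \<Rightarrow> 'k::comm_ring_1"
  assumes "finite T" "\<And>\<sigma>. \<sigma> \<in> S \<Longrightarrow> u \<sigma> \<in> T"
  shows "(\<Sum>r\<in>T. (\<Sum>\<sigma>\<in>S. if u \<sigma> = r then x \<sigma> else 0) * \<phi> r) = (\<Sum>\<sigma>\<in>S. x \<sigma> * \<phi> (u \<sigma>))"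
proof -
  have "(\<Sum>r\<in>T. (\<Sum>\<sigma>\<in>S. if u \<sigma> = r then x \<sigma> else 0) * \<phi> r) =
      (\<Sum>r\<in>T. \<Sum>\<sigma>\<in>S. if u \<sigma> = r then x \<sigma> * \<phi> (u \<sigma>) else 0)"
    unfolding sum_distrib_right by (intro sum.cong) auto
  also have "\<dots> = (\<Sum>\<sigma>\<in>S. \<Sum>r\<in>T. if u \<sigma> = r then x \<sigma> * \<phi> (u \<sigma>) else 0)" by (rule sum.swap)
  also have "\<dots> = (\<Sum>\<sigma>\<in>S. x \<sigma> * \<phi> (u \<sigma>))"
    by (intro sum.cong refl) (use assms in simp)
  finally show ?thesis .
qed

text \<open>Congruence modulo the functions supported in \<open>X\<close>. With \<open>X\<close> the
  diagrams of smaller vector, this is equality in the quotient algebra.\<close>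

definition agree_off :: "'a set \<Rightarrow> ('a \<Rightarrow> 'b) \<Rightarrow> ('a \<Rightarrow> 'b) \<Rightarrow> bool" where
  "agree_off X f g \<longleftrightarrow> (\<forall>p. p \<notin> X \<longrightarrow> f p = g p)"

lemma agree_off_refl [simp]: "agree_off X f f"
  by (simp add: agree_off_def)

lemma agree_off_sym: "agree_off X f g \<Longrightarrow> agree_off X g f"
  by (simp add: agree_off_def)

lemma agree_off_trans: "agree_off X f g \<Longrightarrow> agree_off X g h \<Longrightarrow> agree_off X f h"
  by (simp add: agree_off_def)

definition struct_const ::
  "nat \<Rightarrow> 'k::comm_ring_1 \<Rightarrow> diagram \<Rightarrow> diagram \<Rightarrow> diagram \<Rightarrow> 'k" where
  "struct_const n \<delta> p q r = (if compose_diag n n n p q = r then \<delta> ^ loops n n n p q else 0)"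

text \<open>The linear extension of the map from \<sigma> to its block diagram, as a push-forward of
  coefficients.\<close>

definition galg_embed ::
  "nat \<Rightarrow> nat \<Rightarrow> (nat \<Rightarrow> nat) \<Rightarrow> ((nat \<Rightarrow> nat \<Rightarrow> nat) \<Rightarrow> 'k::comm_ring_1) \<Rightarrow> diagram \<Rightarrow> 'k" where
  "galg_embed l n m x r = (\<Sum>\<sigma>\<in>sym_prod m. if block_diag l n m \<sigma> = r then x \<sigma> else 0)"

lemma galg_embed_scale: "galg_embed l n m (\<lambda>\<sigma>. c * x \<sigma>) = (\<lambda>r. c * galg_embed l n m x r)"
  unfolding galg_embed_def sum_distrib_left by (intro ext sum.cong) auto

section \<open>Multiplication, unit and flip in the tonal algebra\<close>

context
  fixes l n :: nat and \<delta> :: "'k::comm_ring_1"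
begin

private abbreviation (input) "T \<equiv> tonal_diagrams l n"
private abbreviation (input) "cmp \<equiv> compose_diag n n n"
private abbreviation (input) "lps \<equiv> loops n n n"
private abbreviation (input) mul (infixl "\<star>" 70) where
  "f \<star> g \<equiv> f \<otimes>\<^bsub>tonal_algebra l n \<delta>\<^esub> g"

private abbreviation (input) "K \<equiv> struct_const n \<delta>"

lemma finite_tonal_diagrams: "finite T"
  by (rule finite_subset[OF _ finite_diagrams[of n n]]) (auto simp: tonal_diagrams_iff)

lemma mult_apply: "(f \<star> g) r = (\<Sum>p\<in>T. \<Sum>q\<in>T. f p * g q * K p q r)"
  unfolding tonal_algebra_def bilin_def struct_const_def
  by (auto intro!: sum.cong simp: mult_ac)

lemma sum_struct_const:
  assumes "p \<in> T" "q \<in> T"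
  shows "(\<Sum>s\<in>T. K p q s * \<phi> s) = \<delta> ^ lps p q * \<phi> (cmp p q)"
proof -
  have "(\<Sum>s\<in>T. K p q s * \<phi> s) = (\<Sum>s\<in>T. if cmp p q = s then \<delta> ^ lps p q * \<phi> (cmp p q) else 0)"
    by (rule sum.cong) (auto simp: struct_const_def)
  then show ?thesis using finite_tonal_diagrams compose_tonal_diagrams[OF assms] by simp
qed

lemma struct_const_assoc:
  assumes p: "p \<in> T" and q: "q \<in> T" and w: "w \<in> T"
  shows "\<delta> ^ lps p q * K (cmp p q) w r = \<delta> ^ lps q w * K p (cmp q w) r"
  using compose_diag_assoc[OF tonal_diagramsD[OF p] tonal_diagramsD[OF q] tonal_diagramsD[OF w]]
  by (simp add: struct_const_def add.commute flip: power_add)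

text \<open>Both sides are brought to the same triple sum over basis diagrams, where the two powers
  of \<delta> agree by the loop count of diagram associativity.\<close>

lemma mult_assoc: "f \<star> g \<star> h = f \<star> (g \<star> h)"
proof
  fix r
  have "(f \<star> g \<star> h) r =
      (\<Sum>s\<in>T. \<Sum>w\<in>T. (\<Sum>p\<in>T. \<Sum>q\<in>T. f p * g q * K p q s) * h w * K s w r)"
    by (simp only: mult_apply)
  also have "\<dots> = (\<Sum>s\<in>T. \<Sum>w\<in>T. \<Sum>p\<in>T. \<Sum>q\<in>T. f p * g q * h w * (K p q s * K s w r))"
    unfolding sum_distrib_right by (intro sum.cong refl) (simp add: mult_ac)
  also have "\<dots> = (\<Sum>w\<in>T. \<Sum>s\<in>T. \<Sum>p\<in>T. \<Sum>q\<in>T. f p * g q * h w * (K p q s * K s w r))"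
    by (rule sum.swap)
  also have "\<dots> = (\<Sum>w\<in>T. \<Sum>p\<in>T. \<Sum>s\<in>T. \<Sum>q\<in>T. f p * g q * h w * (K p q s * K s w r))"
    by (rule sum.cong[OF refl sum.swap])
  also have "\<dots> = (\<Sum>w\<in>T. \<Sum>p\<in>T. \<Sum>q\<in>T. \<Sum>s\<in>T. f p * g q * h w * (K p q s * K s w r))"
    by (intro sum.cong[OF refl] sum.swap)
  also have "\<dots> = (\<Sum>w\<in>T. \<Sum>p\<in>T. \<Sum>q\<in>T. f p * g q * h w * (\<delta> ^ lps p q * K (cmp p q) w r))"
    by (intro sum.cong[OF refl]) (simp only: sum_struct_const flip: sum_distrib_left)
  also have "\<dots> = (\<Sum>w\<in>T. \<Sum>p\<in>T. \<Sum>q\<in>T. f p * g q * h w * (\<delta> ^ lps q w * K p (cmp q w) r))"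
    by (intro sum.cong[OF refl]) (simp only: struct_const_assoc)
  finally have L: "(f \<star> g \<star> h) r =
    (\<Sum>w\<in>T. \<Sum>p\<in>T. \<Sum>q\<in>T. f p * g q * h w * (\<delta> ^ lps q w * K p (cmp q w) r))" .
  have "(f \<star> (g \<star> h)) r =
      (\<Sum>p\<in>T. \<Sum>s\<in>T. f p * (\<Sum>q\<in>T. \<Sum>w\<in>T. g q * h w * K q w s) * K p s r)"
    by (simp only: mult_apply)
  also have "\<dots> = (\<Sum>p\<in>T. \<Sum>s\<in>T. \<Sum>q\<in>T. \<Sum>w\<in>T. f p * g q * h w * (K q w s * K p s r))"
    unfolding sum_distrib_left sum_distrib_right by (intro sum.cong refl) (simp add: mult_ac)
  also have "\<dots> = (\<Sum>p\<in>T. \<Sum>q\<in>T. \<Sum>s\<in>T. \<Sum>w\<in>T. f p * g q * h w * (K q w s * K p s r))"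
    by (rule sum.cong[OF refl sum.swap])
  also have "\<dots> = (\<Sum>p\<in>T. \<Sum>q\<in>T. \<Sum>w\<in>T. \<Sum>s\<in>T. f p * g q * h w * (K q w s * K p s r))"
    by (intro sum.cong[OF refl] sum.swap)
  also have "\<dots> = (\<Sum>p\<in>T. \<Sum>q\<in>T. \<Sum>w\<in>T. f p * g q * h w * (\<delta> ^ lps q w * K p (cmp q w) r))"
    by (intro sum.cong[OF refl]) (simp only: sum_struct_const flip: sum_distrib_left)
  also have "\<dots> = (\<Sum>p\<in>T. \<Sum>w\<in>T. \<Sum>q\<in>T. f p * g q * h w * (\<delta> ^ lps q w * K p (cmp q w) r))"
    by (rule sum.cong[OF refl sum.swap])
  also have "\<dots> = (\<Sum>w\<in>T. \<Sum>p\<in>T. \<Sum>q\<in>T. f p * g q * h w * (\<delta> ^ lps q w * K p (cmp q w) r))"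
    by (rule sum.swap)
  finally show "(f \<star> g \<star> h) r = (f \<star> (g \<star> h)) r" using L by simp
qed

lemma mult_nonzeroE:
  assumes "(f \<star> g) r \<noteq> 0"
  obtains p q where "p \<in> T" "q \<in> T" "f p \<noteq> 0" "g q \<noteq> 0" "cmp p q = r"
proof -
  obtain p where p: "p \<in> T" "(\<Sum>q\<in>T. f p * g q * K p q r) \<noteq> 0"
    using assms unfolding mult_apply by (rule sum.not_neutral_contains_not_neutral)
  obtain q where q: "q \<in> T" "f p * g q * K p q r \<noteq> 0"
    using p(2) by (rule sum.not_neutral_contains_not_neutral)
  have "f p \<noteq> 0" "g q \<noteq> 0" "cmp p q = r"
    using q(2) by (auto simp: struct_const_def split: if_splits)
  then show thesis using that p(1) q(1) by blast
qed

lemma mult_add_left: "(\<lambda>p. f p + f' p) \<star> g = (\<lambda>p. (f \<star> g) p + (f' \<star> g) p)"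
  by (rule ext) (simp add: mult_apply distrib_right sum.distrib)

lemma mult_add_right: "g \<star> (\<lambda>p. f p + f' p) = (\<lambda>p. (g \<star> f) p + (g \<star> f') p)"
  by (rule ext) (simp add: mult_apply distrib_left distrib_right sum.distrib)

lemma mult_scale_left: "(\<lambda>p. c * f p) \<star> g = (\<lambda>p. c * (f \<star> g) p)"
  by (rule ext) (simp add: mult_apply sum_distrib_left mult_ac)

lemma mult_scale_right: "g \<star> (\<lambda>p. c * f p) = (\<lambda>p. c * (g \<star> f) p)"
  by (rule ext) (simp add: mult_apply sum_distrib_left mult_ac)

lemma sum_basis_vec:
  fixes \<phi> :: "diagram \<Rightarrow> 'k"
  assumes "p \<in> T" shows "(\<Sum>q\<in>T. basis_vec p q * \<phi> q) = \<phi> p"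
proof -
  have "(\<Sum>q\<in>T. basis_vec p q * \<phi> q) = (\<Sum>q\<in>T. if p = q then \<phi> p else 0)"
    by (rule sum.cong) (auto simp: basis_vec_def)
  then show ?thesis using assms finite_tonal_diagrams by simp
qed

lemma mult_basis_right:
  assumes "q \<in> T" shows "(f \<star> basis_vec q) r = (\<Sum>p\<in>T. f p * K p q r)"
proof -
  have "(f \<star> basis_vec q) r = (\<Sum>p\<in>T. f p * (\<Sum>w\<in>T. basis_vec q w * K p w r))"
    by (simp add: mult_apply sum_distrib_left mult_ac)
  then show ?thesis by (simp only: sum_basis_vec[OF assms])
qed

lemma mult_basis_left:
  assumes "q \<in> T" shows "(basis_vec q \<star> f) r = (\<Sum>p\<in>T. f p * K q p r)"
proof -
  have "(basis_vec q \<star> f) r = (\<Sum>w\<in>T. basis_vec q w * (\<Sum>p\<in>T. f p * K w p r))"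
    by (simp add: mult_apply sum_distrib_left mult_ac)
  then show ?thesis by (simp only: sum_basis_vec[OF assms])
qed

lemma basis_mult_basis:
  assumes "p \<in> T" "q \<in> T"
  shows "basis_vec p \<star> basis_vec q = (\<lambda>r. \<delta> ^ lps p q * basis_vec (cmp p q) r)"
proof
  fix r
  have "(basis_vec p \<star> basis_vec q) r = (\<Sum>p'\<in>T. basis_vec p p' * K p' q r)"
    by (rule mult_basis_right[OF assms(2)])
  also have "\<dots> = K p q r" by (rule sum_basis_vec[OF assms(1)])
  finally show "(basis_vec p \<star> basis_vec q) r = \<delta> ^ lps p q * basis_vec (cmp p q) r"
    by (auto simp: struct_const_def basis_vec_def)
qed

lemma basis_vec_supported: "p \<in> T \<Longrightarrow> basis_vec p \<in> supported T"
  by (auto simp: supported_def basis_vec_def)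

lemma one_mult:
  assumes f: "f \<in> supported T"
  shows "basis_vec (id_diag n) \<star> f = f"
proof
  fix r
  have "(basis_vec (id_diag n) \<star> f) r = (\<Sum>p\<in>T. f p * K (id_diag n) p r)"
    by (rule mult_basis_left[OF id_diag_tonal])
  also have "\<dots> = (\<Sum>p\<in>T. if p = r then f r else 0)"
    by (rule sum.cong[OF refl])
      (auto simp: struct_const_def compose_id_diag_left[OF tonal_diagramsD])
  also have "\<dots> = f r"
    using f finite_tonal_diagrams by (auto simp: supported_def)
  finally show "(basis_vec (id_diag n) \<star> f) r = f r" .
qed

lemma struct_const_flip:
  assumes "p \<in> T" "q \<in> T"
  shows "K (flip_diag q) (flip_diag p) r = K p q (flip_diag r)"
  using flip_compose_diag[OF tonal_diagramsD[OF assms(1)] tonal_diagramsD[OF assms(2)]]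
  by (auto simp: struct_const_def)

lemma bij_flip_tonal: "bij_betw flip_diag T T"
  by (rule bij_betwI[where g = flip_diag]) (auto intro: flip_tonal_diagrams)

lemma op_mult: "alg_op (f \<star> g) = alg_op g \<star> alg_op f"
proof
  fix r
  have "(alg_op g \<star> alg_op f) r =
      (\<Sum>q\<in>T. \<Sum>p\<in>T. g (flip_diag q) * f (flip_diag p) * K q p r)"
    by (simp add: mult_apply alg_op_def)
  also have "\<dots> = (\<Sum>q\<in>T. \<Sum>p\<in>T. g (flip_diag (flip_diag q)) * f (flip_diag p) * K (flip_diag q) p r)"
    by (rule sum.reindex_bij_betw[OF bij_flip_tonal, symmetric])
  also have "\<dots> = (\<Sum>q\<in>T. \<Sum>p\<in>T. g (flip_diag (flip_diag q)) * f (flip_diag (flip_diag p)) *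
      K (flip_diag q) (flip_diag p) r)"
    by (rule sum.cong[OF refl], rule sum.reindex_bij_betw[OF bij_flip_tonal, symmetric])
  also have "\<dots> = (\<Sum>q\<in>T. \<Sum>p\<in>T. f p * g q * K p q (flip_diag r))"
    by (intro sum.cong refl) (simp add: struct_const_flip)
  also have "\<dots> = alg_op (f \<star> g) r"
    by (subst sum.swap) (simp add: alg_op_def mult_apply)
  finally show "alg_op (f \<star> g) r = (alg_op g \<star> alg_op f) r" ..
qed

lemma alg_op_alg_op [simp]: "alg_op (alg_op f) = f"
  by (simp add: alg_op_def)

section \<open>Computing modulo diagrams of smaller propagating vector\<close>

context
  fixes m :: "nat \<Rightarrow> nat"
  assumes l: "l \<ge> 1" and m: "m \<in> index_set l n"
begin

private abbreviation (input) "L \<equiv> below l n m"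

private abbreviation (input) eqv :: "(diagram \<Rightarrow> 'k) \<Rightarrow> (diagram \<Rightarrow> 'k) \<Rightarrow> bool" where
  "eqv \<equiv> agree_off L"

text \<open>A term with a factor in \<open>below\<close> only affects coefficients in
  \<open>below\<close>, so coefficients elsewhere see the inputs outside \<open>below\<close>
  only.\<close>

lemma agree_off_mult:
  assumes "eqv f f'" "eqv g g'" shows "eqv (f \<star> g) (f' \<star> g')"
  unfolding agree_off_def
proof (intro allI impI)
  fix r assume r: "r \<notin> L"
  show "(f \<star> g) r = (f' \<star> g') r"
    unfolding mult_apply
  proof (intro sum.cong refl)
    fix p q assume p: "p \<in> T" and q: "q \<in> T"
    show "f p * g q * K p q r = f' p * g' q * K p q r"
    proof (cases "p \<in> L \<or> q \<in> L")
      case True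
      then have "cmp p q \<in> L" using below_compose[OF l m] p q by blast
      then show ?thesis using r by (auto simp: struct_const_def)
    next
      case False
      then show ?thesis using assms by (simp add: agree_off_def)
    qed
  qed
qed

lemma agree_off_op: "eqv f g \<Longrightarrow> eqv (alg_op f) (alg_op g)"
  using below_flip[of _ l n m] unfolding agree_off_def alg_op_def by (metis flip_diag_flip)

text \<open>Since the factorization of the diagram creates no loops, it holds with coefficient 1 for
  every value of \<delta>, including non-units and 0.\<close>

lemma basis_vec_in_ideal_below:
  assumes p: "p \<in> L"
  shows "\<exists>x y m'. basis_vec p = x \<star> basis_vec (a_diag l n m') \<star> y \<and>
    x \<in> carrier (tonal_algebra l n \<delta>) \<and> y \<in> carrier (tonal_algebra l n \<delta>) \<and>
    m' \<in> index_set l n \<and> index_less l m' m"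
proof -
  have pt: "p \<in> T" and less: "index_less l (prop_vector l p) m" using p by (auto simp: below_def)
  let ?m = "prop_vector l p"
  have m': "?m \<in> index_set l n" by (rule prop_vector_in_index_set[OF l pt])
  have a: "a_diag l n ?m \<in> T" by (rule a_diag_tonal_diagram[OF l m'])
  obtain x y where xy: "x \<in> T" "y \<in> T" "cmp (cmp x (a_diag l n ?m)) y = p"
    "lps x (a_diag l n ?m) = 0" "lps (cmp x (a_diag l n ?m)) y = 0"
    by (rule diagram_factorization[OF l pt])
  have "basis_vec x \<star> basis_vec (a_diag l n ?m) = (basis_vec (cmp x (a_diag l n ?m)) :: diagram \<Rightarrow> 'k)"
    unfolding basis_mult_basis[OF xy(1) a] xy(4) by simp
  moreover have "basis_vec (cmp x (a_diag l n ?m)) \<star> basis_vec y = (basis_vec p :: diagram \<Rightarrow> 'k)"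
    unfolding basis_mult_basis[OF compose_tonal_diagrams[OF xy(1) a] xy(2)] xy(3,5) by simp
  ultimately have "basis_vec p = basis_vec x \<star> basis_vec (a_diag l n ?m) \<star> basis_vec y" by simp
  moreover have "basis_vec x \<in> carrier (tonal_algebra l n \<delta>)" "basis_vec y \<in> carrier (tonal_algebra l n \<delta>)"
    using basis_vec_supported xy by (auto simp: tonal_algebra_def)
  ultimately show ?thesis using m' less by blast
qed

lemma ideal_below_eq: "ideal_below l n \<delta> m = supported L"
proof (intro Set.set_eqI iffI)
  let ?G = "{x \<star> basis_vec (a_diag l n m') \<star> y | x y m'.
    x \<in> carrier (tonal_algebra l n \<delta>) \<and> y \<in> carrier (tonal_algebra l n \<delta>) \<and>
    m' \<in> index_set l n \<and> index_less l m' m}"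
  fix f :: "diagram \<Rightarrow> 'k"
  show "f \<in> supported L" if f: "f \<in> ideal_below l n \<delta> m"
  proof -
    have zero: "g r = 0" if g: "g \<in> ?G" and r: "r \<notin> L" for g r
    proof (rule ccontr)
      assume nz: "g r \<noteq> 0"
      obtain x y m' where g': "g = x \<star> basis_vec (a_diag l n m') \<star> y"
        and m': "m' \<in> index_set l n" "index_less l m' m" using g by blast
      obtain p q where pq: "p \<in> T" "q \<in> T" "(x \<star> basis_vec (a_diag l n m')) p \<noteq> 0" "cmp p q = r"
        using nz unfolding g' by (rule mult_nonzeroE)
      obtain p' a where p': "p' \<in> T" "basis_vec (a_diag l n m') a \<noteq> (0::'k)" "cmp p' a = p"
        using pq(3) by (rule mult_nonzeroE)
      have "a = a_diag l n m'" using p'(2) by (auto simp: basis_vec_def split: if_splits)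
      then have "a \<in> L"
        using a_diag_tonal_diagram[OF l m'(1)] prop_vector_a_diag[OF l m'(1)] m'(2)
        by (simp add: below_def)
      then have "p \<in> L" using below_compose(1)[OF l m p'(1)] p'(3) by blast
      then show False using below_compose(2)[OF l m pq(2)] pq(4) r by blast
    qed
    obtain F c where F: "F \<subseteq> ?G" "f = (\<lambda>r. \<Sum>g\<in>F. c g * g r)"
      using f[unfolded ideal_below_def lin_span_def, THEN CollectD] by (elim exE conjE)
    have "c g * g r = 0" if "g \<in> F" "r \<notin> L" for g r
      by (simp only: zero[OF subsetD[OF F(1) that(1)] that(2)] mult_zero_right)
    then show ?thesis unfolding supported_def F(2) by (intro CollectI allI impI sum.neutral) blast
  qed
  show "f \<in> ideal_below l n \<delta> m" if f: "f \<in> supported L"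
  proof -
    let ?b = "basis_vec :: diagram \<Rightarrow> diagram \<Rightarrow> 'k"
    have fin: "finite L"
      by (rule finite_subset[OF _ finite_tonal_diagrams]) (auto simp: below_def)
    have inj: "inj_on ?b L"
      by (auto simp: inj_on_def basis_vec_def fun_eq_iff split: if_splits)
    \<comment> \<open>\<open>lin_span\<close> indexes coefficients by the generators themselves, so
      those of \<open>f\<close> are transported along the injective map
      \<open>basis_vec\<close>.\<close>
    define c where "c g = f (inv_into L ?b g)" for g
    have "f r = (\<Sum>g\<in>?b ` L. c g * g r)" for r
    proof -
      have "(\<Sum>g\<in>?b ` L. c g * g r) = (\<Sum>p\<in>L. f p * ?b p r)"
        by (subst sum.reindex[OF inj]) (auto simp: c_def inj intro: sum.cong)
      also have "\<dots> = (\<Sum>p\<in>L. if r = p then f r else 0)"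
        by (rule sum.cong) (auto simp: basis_vec_def)
      also have "\<dots> = f r" using f fin by (auto simp: supported_def)
      finally show ?thesis ..
    qed
    then have "f = (\<lambda>r. \<Sum>g\<in>?b ` L. c g * g r)" by (rule ext)
    moreover have "?b ` L \<subseteq> ?G" using basis_vec_in_ideal_below by blast
    ultimately show ?thesis
      unfolding ideal_below_def lin_span_def using fin by (intro CollectI exI conjI) auto
  qed
qed

section \<open>Arithmetic of classes in the quotient algebra\<close>

private abbreviation (input) "cls \<equiv> quot_class l n \<delta> m"
private abbreviation (input) "Q \<equiv> quot_tonal l n \<delta> m"

lemma class_eq: "cls g = {h. eqv h g}"
proof (intro Set.set_eqI iffI)
  fix h assume "h \<in> cls g"
  then show "h \<in> {h. eqv h g}"
    by (auto simp: quot_class_def a_r_coset_def' ideal_below_eq tonal_algebra_def supported_def agree_off_def)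
next
  fix h assume h: "h \<in> {h. eqv h g}"
  have "h = (\<lambda>p. (h p - g p) + g p)" by simp
  moreover have "(\<lambda>p. h p - g p) \<in> supported L" using h by (auto simp: supported_def agree_off_def)
  ultimately show "h \<in> cls g"
    unfolding quot_class_def a_r_coset_def' ideal_below_eq tonal_algebra_def by force
qed

lemma class_eq_iff: "cls f = cls g \<longleftrightarrow> eqv f g"
  unfolding class_eq using agree_off_refl agree_off_sym agree_off_trans by blast

lemma carrier_quot: "carrier Q = cls ` supported T"
  by (auto simp: quot_tonal_def quotient_algebra_def ring.extend_def module.fields_def FactRing_def
      A_RCOSETS_def' quot_class_def tonal_algebra_def)

lemma mult_quot: "cls f \<otimes>\<^bsub>Q\<^esub> cls g = cls (f \<star> g)"
proof -
  have "cls f \<otimes>\<^bsub>Q\<^esub> cls g = (\<Union>a\<in>cls f. \<Union>b\<in>cls g. cls (a \<star> b))"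
    by (simp add: quot_tonal_def quotient_algebra_def ring.extend_def module.fields_def FactRing_def
        rcoset_mult_def quot_class_def)
  moreover have "cls (a \<star> b) = cls (f \<star> g)" if "a \<in> cls f" "b \<in> cls g" for a b
    using that agree_off_mult unfolding class_eq_iff by (simp add: class_eq)
  moreover have "f \<in> cls f" "g \<in> cls g" by (simp_all add: class_eq)
  ultimately show ?thesis by blast
qed

lemma add_quot: "cls f \<oplus>\<^bsub>Q\<^esub> cls g = cls (\<lambda>p. f p + g p)"
proof -
  have "cls f \<oplus>\<^bsub>Q\<^esub> cls g = (\<Union>h\<in>cls f. \<Union>k\<in>cls g. {\<lambda>p. h p + k p})"
    by (simp add: quot_tonal_def quotient_algebra_def ring.extend_def module.fields_def FactRing_def
        set_add_def' tonal_algebra_def)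
  also have "\<dots> = cls (\<lambda>p. f p + g p)"
  proof (intro Set.set_eqI iffI)
    fix h assume "h \<in> (\<Union>h\<in>cls f. \<Union>k\<in>cls g. {\<lambda>p. h p + k p})"
    then show "h \<in> cls (\<lambda>p. f p + g p)" by (auto simp: class_eq agree_off_def)
  next
    fix h assume h: "h \<in> cls (\<lambda>p. f p + g p)"
    then have "(\<lambda>p. h p - g p) \<in> cls f" "g \<in> cls g" by (auto simp: class_eq agree_off_def)
    moreover have "h = (\<lambda>p. (h p - g p) + g p)" by simp
    ultimately show "h \<in> (\<Union>h\<in>cls f. \<Union>k\<in>cls g. {\<lambda>p. h p + k p})" by blast
  qed
  finally show ?thesis .
qed

text \<open>If \<open>c\<close> is not a unit, scaling a coset elementwise may miss elements of the
  scaled coset; adding the ideal fills it up.\<close>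

lemma scale_quot: "c \<odot>\<^bsub>Q\<^esub> cls f = cls (\<lambda>p. c * f p)"
proof -
  have "c \<odot>\<^bsub>Q\<^esub> cls f = (\<Union>h\<in>supported L. \<Union>k\<in>cls f. {\<lambda>p. h p + c * k p})"
    by (simp add: quot_tonal_def quotient_algebra_def ring.extend_def module.fields_def FactRing_def
        set_add_def' tonal_algebra_def flip: ideal_below_eq)
  also have "\<dots> = cls (\<lambda>p. c * f p)"
  proof (intro Set.set_eqI iffI)
    fix h assume "h \<in> (\<Union>h\<in>supported L. \<Union>k\<in>cls f. {\<lambda>p. h p + c * k p})"
    then show "h \<in> cls (\<lambda>p. c * f p)" by (auto simp: class_eq agree_off_def supported_def)
  next
    fix h assume h: "h \<in> cls (\<lambda>p. c * f p)"
    then have "(\<lambda>p. h p - c * f p) \<in> supported L" "f \<in> cls f"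
      by (auto simp: class_eq agree_off_def supported_def)
    moreover have "h = (\<lambda>p. (h p - c * f p) + c * f p)" by simp
    ultimately show "h \<in> (\<Union>h\<in>supported L. \<Union>k\<in>cls f. {\<lambda>p. h p + c * k p})" by blast
  qed
  finally show ?thesis .
qed

lemma op_quot: "quot_op (cls f) = cls (alg_op f)"
  unfolding quot_op_def
proof (intro Set.set_eqI iffI)
  fix h assume "h \<in> alg_op ` cls f"
  then show "h \<in> cls (alg_op f)" using agree_off_op by (auto simp: class_eq)
next
  fix h assume "h \<in> cls (alg_op f)"
  then have "alg_op h \<in> cls f" using agree_off_op[of h "alg_op f"] by (simp add: class_eq)
  then show "h \<in> alg_op ` cls f" by (metis alg_op_alg_op image_eqI)
qed

subsection \<open>The group algebra inside the tonal algebra\<close>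

private abbreviation (input) "SG \<equiv> sym_prod m"
private abbreviation (input) "u \<equiv> block_diag l n m"

private abbreviation (input) U :: "((nat \<Rightarrow> nat \<Rightarrow> nat) \<Rightarrow> 'k) \<Rightarrow> diagram \<Rightarrow> 'k" where
  "U \<equiv> galg_embed l n m"
private abbreviation (input) a_vec :: "diagram \<Rightarrow> 'k" where "a_vec \<equiv> basis_vec (a_diag l n m)"

lemma sum_embed: "(\<Sum>r\<in>T. U x r * \<phi> r) = (\<Sum>\<sigma>\<in>SG. x \<sigma> * \<phi> (u \<sigma>))"
  unfolding galg_embed_def
  by (rule sum_delta_image[OF finite_tonal_diagrams]) (rule block_diag_tonal[OF l m])

lemma mult_embed_right: "(f \<star> U x) r = (\<Sum>p\<in>T. f p * (\<Sum>\<sigma>\<in>SG. x \<sigma> * K p (u \<sigma>) r))"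
proof -
  have "(\<Sum>\<sigma>\<in>SG. x \<sigma> * K p (u \<sigma>) r) = (\<Sum>q\<in>T. U x q * K p q r)" for p
    by (rule sum_embed[symmetric])
  then show ?thesis by (simp add: mult_apply sum_distrib_left mult_ac)
qed

lemma mult_embed_left: "(U x \<star> f) r = (\<Sum>p\<in>T. f p * (\<Sum>\<sigma>\<in>SG. x \<sigma> * K (u \<sigma>) p r))"
proof -
  have "(\<Sum>\<sigma>\<in>SG. x \<sigma> * K (u \<sigma>) p r) = (\<Sum>q\<in>T. U x q * K q p r)" for p
    by (rule sum_embed[symmetric])
  then show ?thesis unfolding mult_apply by (subst sum.swap) (simp add: sum_distrib_left mult_ac)
qed

lemma a_mult_embed: "(a_vec \<star> U x) r = (\<Sum>\<sigma>\<in>SG. x \<sigma> * K (a_diag l n m) (u \<sigma>) r)"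
  unfolding mult_embed_right by (rule sum_basis_vec[OF a_diag_tonal_diagram[OF l m]])

lemma a_embed_commute: "a_vec \<star> U x = U x \<star> a_vec"
proof
  fix r
  have "(U x \<star> a_vec) r = (\<Sum>\<sigma>\<in>SG. x \<sigma> * K (u \<sigma>) (a_diag l n m) r)"
    unfolding mult_embed_left by (rule sum_basis_vec[OF a_diag_tonal_diagram[OF l m]])
  also have "\<dots> = (a_vec \<star> U x) r"
    unfolding a_mult_embed
    by (rule sum.cong) (simp_all add: struct_const_def compose_a_block_diag[OF l m])
  finally show "(a_vec \<star> U x) r = (U x \<star> a_vec) r" ..
qed

lemma embed_mult: "U x \<star> U y = U (galg_mult m x y)"
proof
  fix r
  note fin = finite_sym_prod[OF m]
  have K: "K (u \<sigma>) (u \<tau>) r = (if u (\<lambda>i. \<sigma> i \<circ> \<tau> i) = r then 1 else 0)"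
    if "\<sigma> \<in> SG" "\<tau> \<in> SG" for \<sigma> \<tau>
    unfolding struct_const_def compose_block_diag[OF l m that] by simp
  have "(U x \<star> U y) r = (\<Sum>\<sigma>\<in>SG. x \<sigma> * (\<Sum>\<tau>\<in>SG. y \<tau> * K (u \<sigma>) (u \<tau>) r))"
    unfolding mult_embed_right by (rule sum_embed)
  also have "\<dots> = (\<Sum>\<sigma>\<in>SG. \<Sum>\<tau>\<in>SG. x \<sigma> * y \<tau> * (if u (\<lambda>i. \<sigma> i \<circ> \<tau> i) = r then 1 else 0))"
    unfolding sum_distrib_left by (intro sum.cong refl) (simp only: K mult.assoc)
  also have "\<dots> = (\<Sum>\<rho>\<in>SG. galg_mult m x y \<rho> * (if u \<rho> = r then 1 else 0))"
  proof -
    let ?\<phi> = "\<lambda>\<rho>. if u \<rho> = r then 1 else (0 :: 'k)"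
    have "(\<Sum>\<rho>\<in>SG. galg_mult m x y \<rho> * ?\<phi> \<rho>) =
      (\<Sum>\<rho>\<in>SG. \<Sum>\<sigma>\<in>SG. (\<Sum>\<tau>\<in>SG. if (\<lambda>i. \<sigma> i \<circ> \<tau> i) = \<rho> then x \<sigma> * y \<tau> else 0) * ?\<phi> \<rho>)"
      by (simp add: galg_mult_def bilin_def sum_distrib_right cong: if_cong)
    also have "\<dots> = (\<Sum>\<sigma>\<in>SG. \<Sum>\<rho>\<in>SG. (\<Sum>\<tau>\<in>SG. if (\<lambda>i. \<sigma> i \<circ> \<tau> i) = \<rho> then x \<sigma> * y \<tau> else 0) * ?\<phi> \<rho>)"
      by (rule sum.swap)
    also have "\<dots> = (\<Sum>\<sigma>\<in>SG. \<Sum>\<tau>\<in>SG. x \<sigma> * y \<tau> * ?\<phi> (\<lambda>i. \<sigma> i \<circ> \<tau> i))"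
      by (intro sum.cong refl sum_delta_image[OF fin] sym_prod_comp)
    finally show ?thesis ..
  qed
  also have "\<dots> = U (galg_mult m x y) r"
    unfolding galg_embed_def by (rule sum.cong) auto
  finally show "(U x \<star> U y) r = U (galg_mult m x y) r" .
qed

text \<open>Flipping a block diagram inverts its permutation, so the two sums differ by the
  reindexing of the group by inversion.\<close>

lemma op_embed: "alg_op (U x) = U (galg_op x)"
proof
  fix r
  let ?inv = "\<lambda>\<sigma> i. inv_into UNIV (\<sigma> i)"
  have invinv: "?inv (?inv \<sigma>) = \<sigma>" if "\<sigma> \<in> SG" for \<sigma>
    using that by (auto simp: sym_prod_def intro!: ext inv_inv_eq[THEN fun_cong] dest: permutes_bij)
  have "bij_betw ?inv SG SG"
    by (rule bij_betwI[where g = ?inv]) (auto intro: sym_prod_inv simp: invinv)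
  then have "U (galg_op x) r = (\<Sum>\<sigma>\<in>SG. if u (?inv \<sigma>) = r then galg_op x (?inv \<sigma>) else 0)"
    unfolding galg_embed_def by (rule sum.reindex_bij_betw[symmetric])
  also have "\<dots> = (\<Sum>\<sigma>\<in>SG. if u \<sigma> = flip_diag r then x \<sigma> else 0)"
  proof (rule sum.cong[OF refl])
    fix \<sigma> assume \<sigma>: "\<sigma> \<in> SG"
    have "galg_op x (?inv \<sigma>) = x \<sigma>" using invinv[OF \<sigma>] by (simp add: galg_op_def)
    moreover have "u (?inv \<sigma>) = r \<longleftrightarrow> u \<sigma> = flip_diag r"
      using flip_block_diag[OF l m \<sigma>] by (metis flip_diag_flip)
    ultimately show "(if u (?inv \<sigma>) = r then galg_op x (?inv \<sigma>) else 0) =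
      (if u \<sigma> = flip_diag r then x \<sigma> else 0)" by simp
  qed
  also have "\<dots> = alg_op (U x) r" by (simp add: alg_op_def galg_embed_def)
  finally show "alg_op (U x) r = U (galg_op x) r" ..
qed

lemma op_a: "alg_op a_vec = a_vec"
proof
  fix p
  have "flip_diag p = a_diag l n m \<longleftrightarrow> p = a_diag l n m"
    using flip_a_diag[OF l m] by (metis flip_diag_flip)
  then show "alg_op a_vec p = a_vec p" by (simp add: alg_op_def basis_vec_def)
qed

lemma mult_a_nonzero:
  assumes "(f \<star> a_vec) r \<noteq> 0" shows "r \<in> std_diagrams l n m \<union> L"
  using assms
proof (rule mult_nonzeroE)
  fix p q assume p: "p \<in> T" and "a_vec q \<noteq> 0" "cmp p q = r"
  then have "r = cmp p (a_diag l n m)" by (auto simp: basis_vec_def split: if_splits)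
  then show ?thesis using compose_a_diag_cases[OF l m p] by simp
qed

lemma diag_right_act_eq:
  assumes v: "v \<in> supported (std_diagrams l n m)"
  shows "diag_right_act l n m v x = v \<star> U x"
proof
  fix r
  have "(v \<star> U x) r = (\<Sum>p\<in>std_diagrams l n m. v p * (\<Sum>\<sigma>\<in>SG. x \<sigma> * K p (u \<sigma>) r))"
    unfolding mult_embed_right
    by (rule sum.mono_neutral_right[OF finite_tonal_diagrams])
      (use v std_diagrams_tonal in \<open>auto simp: supported_def\<close>)
  also have "\<dots> = diag_right_act l n m v x r"
    unfolding diag_right_act_def bilin_def sum_distrib_left
    by (intro sum.cong refl)
      (simp add: struct_const_def std_compose_block_diag[OF l m])
  finally show "diag_right_act l n m v x r = (v \<star> U x) r" ..
qed

text \<open>The representative chosen in \<open>right_act\<close> is unique because no standard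
  diagram lies in \<open>below\<close>; after that, the action is multiplication by the image of
  \<open>x\<close>.\<close>

lemma right_act_class: "right_act l n \<delta> m (cls (f \<star> a_vec)) x = cls (f \<star> a_vec \<star> U x)"
proof -
  let ?S = "std_diagrams l n m"
  \<comment> \<open>A product ending in a^m is supported on standard diagrams and on
    \<open>below\<close>, so cutting it down to the former leaves the class unchanged.\<close>
  define v where "v p = (if p \<in> ?S then (f \<star> a_vec) p else 0)" for p
  have v: "v \<in> supported ?S" by (simp add: v_def supported_def)
  have eq: "eqv v (f \<star> a_vec)"
    using mult_a_nonzero[of f] by (auto simp: agree_off_def v_def)
  have "(THE v. v \<in> supported ?S \<and> cls v = cls (f \<star> a_vec)) = v"
  proof (rule the_equality)
    show "v \<in> supported ?S \<and> cls v = cls (f \<star> a_vec)" using v eq by (simp add: class_eq_iff)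
  next
    fix v' assume v': "v' \<in> supported ?S \<and> cls v' = cls (f \<star> a_vec)"
    then have "eqv v' v" using eq unfolding class_eq_iff by (meson agree_off_sym agree_off_trans)
    show "v' = v"
    proof
      fix p show "v' p = v p"
      proof (cases "p \<in> ?S")
        case True
        then show ?thesis using std_not_below \<open>eqv v' v\<close> by (auto simp: agree_off_def)
      next
        case False
        then show ?thesis using v v' by (simp add: supported_def)
      qed
    qed
  qed
  then show ?thesis
    unfolding right_act_def using agree_off_mult[OF eq agree_off_refl] by (simp add: diag_right_act_eq[OF v] class_eq_iff)
qed

lemma left_act_class:
  "left_act l n \<delta> m x (cls (a_vec \<star> f)) = cls (U x \<star> (a_vec \<star> f))"
proof -
  \<comment> \<open>Double inversion is the identity only on families of permutations, whereas
    \<open>x\<close> is an arbitrary function; the embedding sees just the coefficients on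
    \<open>sym_prod m\<close>.\<close>
  have opop: "U (galg_op (galg_op x)) = U x"
    using op_embed[of x] op_embed[of "galg_op x"] by (metis alg_op_alg_op)
  have "left_act l n \<delta> m x (cls (a_vec \<star> f)) = cls (alg_op (alg_op f \<star> a_vec \<star> U (galg_op x)))"
    by (simp add: left_act_def op_quot op_mult op_a right_act_class)
  then show ?thesis by (simp add: op_mult op_a op_embed opop)
qed

text \<open>Outside \<open>below\<close> only products of a^m with block diagrams occur. They are
  distinct for distinct \<sigma>, so the coefficients of \<open>z\<close> can be read off at
  them.\<close>

lemma a_mult_a_embed:
  obtains z where "z \<in> supported SG" "eqv (a_vec \<star> f \<star> a_vec) (a_vec \<star> U z)"
proof -
  let ?a = "a_diag l n m"
  note at = a_diag_tonal_diagram[OF l m]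
  define z where "z \<sigma> = (if \<sigma> \<in> SG then (a_vec \<star> f \<star> a_vec) (cmp ?a (u \<sigma>)) else 0)" for \<sigma>
  have "(a_vec \<star> f \<star> a_vec) r = (a_vec \<star> U z) r" if r: "r \<notin> L" for r
  proof (cases "\<exists>\<sigma>\<in>SG. cmp ?a (u \<sigma>) = r")
    case True
    then obtain \<sigma> where \<sigma>: "\<sigma> \<in> SG" "cmp ?a (u \<sigma>) = r" by blast
    have "(a_vec \<star> U z) r = (\<Sum>\<tau>\<in>SG. if \<tau> = \<sigma> then z \<sigma> else 0)"
      unfolding a_mult_embed
    proof (rule sum.cong[OF refl])
      fix \<tau> assume \<tau>: "\<tau> \<in> SG"
      have "cmp ?a (u \<tau>) = r \<longleftrightarrow> \<tau> = \<sigma>"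
        using \<sigma> inj_onD[OF inj_on_compose_a_block_diag[OF l m] _ \<tau> \<sigma>(1)] by auto
      then show "z \<tau> * K ?a (u \<tau>) r = (if \<tau> = \<sigma> then z \<sigma> else 0)"
        using compose_a_block_diag(2)[OF l m \<tau>]
        by (cases "\<tau> = \<sigma>") (simp_all add: struct_const_def)
    qed
    then show ?thesis using \<sigma> finite_sym_prod[OF m] by (simp add: z_def)
  next
    case False
    then have "(a_vec \<star> U z) r = 0"
      unfolding a_mult_embed by (intro sum.neutral) (auto simp: struct_const_def)
    moreover have "(a_vec \<star> f \<star> a_vec) r = 0"
    proof (rule ccontr)
      assume "(a_vec \<star> f \<star> a_vec) r \<noteq> 0"
      then obtain p q where pq: "(a_vec \<star> f) p \<noteq> 0" "a_vec q \<noteq> 0" "cmp p q = r"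
        by (rule mult_nonzeroE)
      obtain p1 p2 where p: "p2 \<in> T" "a_vec p1 \<noteq> 0" "cmp p1 p2 = p"
        using pq(1) by (rule mult_nonzeroE)
      have "q = ?a" "p1 = ?a" using pq p by (auto simp: basis_vec_def split: if_splits)
      then have "r = cmp (cmp ?a p2) ?a" using pq p by simp
      then show False using a_compose_a_cases[OF l m p(1)] r False by metis
    qed
    ultimately show ?thesis by simp
  qed
  moreover have "z \<in> supported SG" by (simp add: z_def supported_def)
  ultimately show thesis using that by (simp add: agree_off_def)
qed

text \<open>The coefficient of the product at the diagram belonging to \<sigma> is
  \<open>e \<sigma>\<close>, and that diagram is not in \<open>below\<close>. So no coefficient of
  \<open>e\<close> is lost in the quotient, and \<open>c - d\<close> annihilates
  \<open>e\<close>.\<close>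

lemma a_embed_scale_inject:
  assumes e: "e \<in> supported SG" and ann: "\<And>c. (\<lambda>\<sigma>. c * e \<sigma>) = (\<lambda>_. 0) \<Longrightarrow> c = 0"
    and eq: "eqv (\<lambda>p. c * (a_vec \<star> U e) p) (\<lambda>p. d * (a_vec \<star> U e) p)"
  shows "c = d"
proof -
  let ?a = "a_diag l n m"
  have val: "(a_vec \<star> U e) (cmp ?a (u \<sigma>)) = e \<sigma>" if \<sigma>: "\<sigma> \<in> SG" for \<sigma>
  proof -
    have "(a_vec \<star> U e) (cmp ?a (u \<sigma>)) = (\<Sum>\<tau>\<in>SG. if \<tau> = \<sigma> then e \<sigma> else 0)"
      unfolding a_mult_embed
    proof (rule sum.cong[OF refl])
      fix \<tau> assume \<tau>: "\<tau> \<in> SG"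
      have "cmp ?a (u \<tau>) = cmp ?a (u \<sigma>) \<longleftrightarrow> \<tau> = \<sigma>"
        using inj_onD[OF inj_on_compose_a_block_diag[OF l m] _ \<tau> \<sigma>] by auto
      then show "e \<tau> * K ?a (u \<tau>) (cmp ?a (u \<sigma>)) = (if \<tau> = \<sigma> then e \<sigma> else 0)"
        using compose_a_block_diag(2)[OF l m \<tau>]
        by (cases "\<tau> = \<sigma>") (simp_all add: struct_const_def)
    qed
    then show ?thesis using \<sigma> finite_sym_prod[OF m] by simp
  qed
  have "(c - d) * e \<sigma> = 0" for \<sigma>
  proof (cases "\<sigma> \<in> SG")
    case True
    have "cmp ?a (u \<sigma>) \<notin> L"
      by (rule std_not_below[OF compose_a_block_diag_std[OF l m True]])
    then have "c * e \<sigma> = d * e \<sigma>"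
      using eq[unfolded agree_off_def, THEN spec, of "cmp ?a (u \<sigma>)"] by (simp add: val[OF True])
    then show ?thesis by (simp add: left_diff_distrib)
  next
    case False
    then show ?thesis using e by (simp add: supported_def)
  qed
  then have "(\<lambda>\<sigma>. (c - d) * e \<sigma>) = (\<lambda>_. 0)" by (rule ext)
  then have "c - d = 0" by (rule ann)
  then show ?thesis by simp
qed

end

end

section \<open>The contravariant form\<close>

theorem lemma9p1:
  fixes \<delta> :: "'k::comm_ring_1" and l n :: nat and m :: "nat \<Rightarrow> nat"
    and lam :: "nat \<Rightarrow> nat list" and e\<^sub>Z :: "(nat \<Rightarrow> nat \<Rightarrow> nat) \<Rightarrow> int"
    and e :: "(nat \<Rightarrow> nat \<Rightarrow> nat) \<Rightarrow> 'k"
  assumes "l \<ge> 1"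
    and "m \<in> index_set l n"
    and "lam \<in> multipartitions l m"
    and "preidempotent m e\<^sub>Z"
    and "galg_op e\<^sub>Z = e\<^sub>Z"
    and "e = galg_of_int e\<^sub>Z"
    and "primitive_elem m e"
    and "generates_specht l m lam e"
  shows "let Q = quot_tonal l n \<delta> m; a = a_elem l n \<delta> m;
             ract = right_act l n \<delta> m; lact = left_act l n \<delta> m in
         \<exists>B. contravariant_form l n \<delta> m (standard_module l n \<delta> m e) B \<and>
           (\<forall>x\<in>carrier Q. \<forall>y\<in>carrier Q.
              let xae = ract (x \<otimes>\<^bsub>Q\<^esub> a) e; yae = ract (y \<otimes>\<^bsub>Q\<^esub> a) e in
              quot_op xae \<otimes>\<^bsub>Q\<^esub> yae =
                lact (galg_op e) (ract (a \<otimes>\<^bsub>Q\<^esub> quot_op x \<otimes>\<^bsub>Q\<^esub> y \<otimes>\<^bsub>Q\<^esub> a) e) \<and>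
              quot_op xae \<otimes>\<^bsub>Q\<^esub> yae = B xae yae \<odot>\<^bsub>Q\<^esub> ract a e \<and>
              (\<forall>c. quot_op xae \<otimes>\<^bsub>Q\<^esub> yae = c \<odot>\<^bsub>Q\<^esub> ract a e \<longrightarrow> c = B xae yae))"
proof -
  note l = \<open>l \<ge> 1\<close> and m = \<open>m \<in> index_set l n\<close>
  let ?Q = "quot_tonal l n \<delta> m" and ?cls = "quot_class l n \<delta> m"
  let ?av = "basis_vec (a_diag l n m) :: diagram \<Rightarrow> 'k"
  let ?T = "supported (tonal_diagrams l n) :: (diagram \<Rightarrow> 'k) set"
  define mul (infixl "\<star>" 70) where "f \<star> g = f \<otimes>\<^bsub>tonal_algebra l n \<delta>\<^esub> g" for f g
  note assoc = mult_assoc[where l = l and n = n and \<delta> = \<delta>, folded mul_def]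
  define E where "E = galg_embed l n m e"
  have eop: "galg_op e = e"
  proof
    fix \<sigma> show "galg_op e \<sigma> = e \<sigma>"
      using fun_cong[OF assms(5), of \<sigma>] by (simp add: assms(6) galg_op_def galg_of_int_def)
  qed
  have esupp: "e \<in> supported (sym_prod m)"
    using assms(4) by (auto simp: assms(6) preidempotent_def supported_def galg_of_int_def)
  have Eop: "alg_op E = E" unfolding E_def by (simp add: op_embed[OF l m] eop)
  have aE: "?av \<star> E = E \<star> ?av" unfolding E_def mul_def by (rule a_embed_commute[OF l m])
  note opm = op_mult[where l = l and n = n and \<delta> = \<delta>, folded mul_def]
  note opa = op_a[OF l m]
  note mq = mult_quot[OF l m, where \<delta> = \<delta>, folded mul_def] and sq = scale_quot[OF l m]
    and oq = op_quot[OF l m] and aq = add_quot[OF l m]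
  note ceq = class_eq_iff[OF l m]
  have ract: "right_act l n \<delta> m (?cls (f \<star> ?av)) e = ?cls (f \<star> ?av \<star> E)" for f
    unfolding mul_def E_def by (rule right_act_class[OF l m])
  \<comment> \<open>The action is computed for multiples of a^m; the generator itself is written as
    the unit times a^m.\<close>
  have one: "basis_vec (id_diag n) \<star> ?av = ?av"
    unfolding mul_def
    by (rule one_mult[OF basis_vec_supported[OF a_diag_tonal_diagram[OF l m]]])
  have ract_a: "right_act l n \<delta> m (a_elem l n \<delta> m) e = ?cls (?av \<star> E)"
    using ract[of "basis_vec (id_diag n)"] by (simp add: one a_elem_def)
  have key: "\<exists>c. ?cls (alg_op (f \<star> ?av \<star> E) \<star> (g \<star> ?av \<star> E)) = c \<odot>\<^bsub>?Q\<^esub> ?cls (?av \<star> E)" for f g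
  proof -
    obtain z where z: "z \<in> supported (sym_prod m)"
      "agree_off (below l n m) (?av \<star> (alg_op f \<star> g) \<star> ?av) (?av \<star> galg_embed l n m z)"
      using a_mult_a_embed[OF l m, of \<delta> "alg_op f \<star> g"] unfolding mul_def by blast
    obtain c where c: "galg_mult m (galg_mult m e z) e = (\<lambda>\<sigma>. c * e \<sigma>)"
      using assms(7) z(1) unfolding primitive_elem_def by blast
    have "alg_op (f \<star> ?av \<star> E) \<star> (g \<star> ?av \<star> E) = E \<star> (?av \<star> (alg_op f \<star> g) \<star> ?av) \<star> E"
      by (simp add: opm opa Eop assoc)
    moreover have "agree_off (below l n m) (E \<star> (?av \<star> (alg_op f \<star> g) \<star> ?av) \<star> E)
        (E \<star> (?av \<star> galg_embed l n m z) \<star> E)"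
      unfolding mul_def
      by (rule agree_off_mult[OF l m agree_off_mult[OF l m agree_off_refl z(2)[unfolded mul_def]]
            agree_off_refl])
    \<comment> \<open>Moving \<open>E\<close> across a^m puts it next to the image of
      \<open>z\<close>, where primitivity applies inside the group algebra.\<close>
    moreover have "E \<star> (?av \<star> galg_embed l n m z) \<star> E =
        ?av \<star> (E \<star> galg_embed l n m z \<star> E)"
      using aE by (metis assoc)
    moreover have "E \<star> galg_embed l n m z \<star> E = galg_embed l n m (\<lambda>\<sigma>. c * e \<sigma>)"
      unfolding E_def mul_def embed_mult[OF l m] c ..
    moreover have "galg_embed l n m (\<lambda>\<sigma>. c * e \<sigma>) = (\<lambda>r. c * E r)"
      unfolding E_def by (rule galg_embed_scale)
    moreover have "?av \<star> (\<lambda>r. c * E r) = (\<lambda>r. c * (?av \<star> E) r)"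
      unfolding mul_def by (rule mult_scale_right)
    ultimately show ?thesis by (auto simp: sq ceq)
  qed
  have uniq: "c = d" if "c \<odot>\<^bsub>?Q\<^esub> ?cls (?av \<star> E) = d \<odot>\<^bsub>?Q\<^esub> ?cls (?av \<star> E)" for c d
    by (rule a_embed_scale_inject[where \<delta> = \<delta>, OF l m esupp])
      (use assms(7) that in \<open>auto simp: primitive_elem_def sq ceq mul_def E_def\<close>)
  \<comment> \<open>A function of two module elements, so nothing has to be checked about the choice
    of \<open>x\<close> and \<open>y\<close>. On the standard module the description is met by
    exactly one scalar, by \<open>key\<close> and \<open>uniq\<close>.\<close>
  define B where "B U V = (THE c. quot_op U \<otimes>\<^bsub>?Q\<^esub> V = c \<odot>\<^bsub>?Q\<^esub> ?cls (?av \<star> E))" for U V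
  have B_eqI: "B U V = c" if "quot_op U \<otimes>\<^bsub>?Q\<^esub> V = c \<odot>\<^bsub>?Q\<^esub> ?cls (?av \<star> E)" for U V c
    unfolding B_def
  proof (rule the_equality)
    show "d = c" if "quot_op U \<otimes>\<^bsub>?Q\<^esub> V = d \<odot>\<^bsub>?Q\<^esub> ?cls (?av \<star> E)" for d
      by (rule uniq) (use that \<open>quot_op U \<otimes>\<^bsub>?Q\<^esub> V = c \<odot>\<^bsub>?Q\<^esub> ?cls (?av \<star> E)\<close> in simp)
  qed (rule that)
  let ?S = "standard_module l n \<delta> m e"
  have S: "?S = {?cls (f \<star> ?av \<star> E) | f. f \<in> ?T}"
    unfolding standard_module_def carrier_quot[OF l m] a_elem_def
    by (auto simp: mq ract image_iff) (metis mq ract)+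
  have B: "quot_op U \<otimes>\<^bsub>?Q\<^esub> V = B U V \<odot>\<^bsub>?Q\<^esub> ?cls (?av \<star> E)" if UV: "U \<in> ?S" "V \<in> ?S" for U V
  proof -
    obtain f g where "U = ?cls (f \<star> ?av \<star> E)" "V = ?cls (g \<star> ?av \<star> E)" using UV unfolding S by blast
    then have "quot_op U \<otimes>\<^bsub>?Q\<^esub> V = ?cls (alg_op (f \<star> ?av \<star> E) \<star> (g \<star> ?av \<star> E))"
      by (simp add: oq mq)
    then obtain c where "quot_op U \<otimes>\<^bsub>?Q\<^esub> V = c \<odot>\<^bsub>?Q\<^esub> ?cls (?av \<star> E)" using key by metis
    then show ?thesis using B_eqI by simp
  qed
  have rep: "\<exists>f. U = ?cls f" if "U \<in> ?S" for U using that unfolding S by blast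
  have op_add: "alg_op (\<lambda>p. f p + g p) = (\<lambda>p. alg_op f p + alg_op g p)" for f g :: "diagram \<Rightarrow> 'k"
    by (simp add: alg_op_def)
  have op_scale: "alg_op (\<lambda>p. c * g p) = (\<lambda>p. c * alg_op g p)" for c and g :: "diagram \<Rightarrow> 'k"
    by (simp add: alg_op_def)
  note bil = mult_add_left[where l = l and n = n and \<delta> = \<delta>, folded mul_def] mult_add_right[where l = l and n = n and \<delta> = \<delta>, folded mul_def]
    mult_scale_left[where l = l and n = n and \<delta> = \<delta>, folded mul_def] mult_scale_right[where l = l and n = n and \<delta> = \<delta>, folded mul_def]
  have dist: "(c + d) \<odot>\<^bsub>?Q\<^esub> ?cls h = (c \<odot>\<^bsub>?Q\<^esub> ?cls h) \<oplus>\<^bsub>?Q\<^esub> (d \<odot>\<^bsub>?Q\<^esub> ?cls h)"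
    "(c * d) \<odot>\<^bsub>?Q\<^esub> ?cls h = c \<odot>\<^bsub>?Q\<^esub> (d \<odot>\<^bsub>?Q\<^esub> ?cls h)" for c d h
    by (simp_all add: sq aq distrib_right mult.assoc)
  have form: "bilinear_form_on ?Q ?S B"
    unfolding bilinear_form_on_def
  proof (intro conjI ballI allI)
    fix U U' V assume U: "U \<in> ?S" and U': "U' \<in> ?S" and V: "V \<in> ?S"
    obtain f f' g where r: "U = ?cls f" "U' = ?cls f'" "V = ?cls g" using rep U U' V by metis
    \<comment> \<open>Linearity is an identity between products in the quotient; uniqueness of the
      scalar transfers it to \<open>B\<close>.\<close>
    have "quot_op (U \<oplus>\<^bsub>?Q\<^esub> U') \<otimes>\<^bsub>?Q\<^esub> V = (quot_op U \<otimes>\<^bsub>?Q\<^esub> V) \<oplus>\<^bsub>?Q\<^esub> (quot_op U' \<otimes>\<^bsub>?Q\<^esub> V)"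
      "quot_op V \<otimes>\<^bsub>?Q\<^esub> (U \<oplus>\<^bsub>?Q\<^esub> U') = (quot_op V \<otimes>\<^bsub>?Q\<^esub> U) \<oplus>\<^bsub>?Q\<^esub> (quot_op V \<otimes>\<^bsub>?Q\<^esub> U')"
      by (simp_all add: r aq oq mq op_add bil)
    then show "B (U \<oplus>\<^bsub>?Q\<^esub> U') V = B U V + B U' V" "B V (U \<oplus>\<^bsub>?Q\<^esub> U') = B V U + B V U'"
      by (intro B_eqI; simp add: dist B U U' V)+
  next
    fix c U V assume U: "U \<in> ?S" and V: "V \<in> ?S"
    obtain f g where r: "U = ?cls f" "V = ?cls g" using rep U V by metis
    have "quot_op (c \<odot>\<^bsub>?Q\<^esub> U) \<otimes>\<^bsub>?Q\<^esub> V = c \<odot>\<^bsub>?Q\<^esub> (quot_op U \<otimes>\<^bsub>?Q\<^esub> V)"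
      "quot_op U \<otimes>\<^bsub>?Q\<^esub> (c \<odot>\<^bsub>?Q\<^esub> V) = c \<odot>\<^bsub>?Q\<^esub> (quot_op U \<otimes>\<^bsub>?Q\<^esub> V)"
      by (simp_all add: r sq oq mq op_scale bil)
    then show "B (c \<odot>\<^bsub>?Q\<^esub> U) V = c * B U V" "B U (c \<odot>\<^bsub>?Q\<^esub> V) = c * B U V"
      by (intro B_eqI; simp add: dist B U V)+
  qed
  have contra: "contravariant_form l n \<delta> m ?S B"
    unfolding contravariant_form_def
  proof (intro conjI ballI form)
    fix g U V assume U: "U \<in> ?S" and V: "V \<in> ?S"
    obtain f h where r: "U = ?cls f" "V = ?cls h" using rep U V by metis
    \<comment> \<open>Both sides of contravariance are described by one and the same product,
      bracketed in two ways.\<close>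
    have "quot_op U \<otimes>\<^bsub>?Q\<^esub> (?cls g \<otimes>\<^bsub>?Q\<^esub> V) = quot_op (?cls (alg_op g) \<otimes>\<^bsub>?Q\<^esub> U) \<otimes>\<^bsub>?Q\<^esub> V"
      by (simp add: r oq mq opm assoc)
    then show "B U (?cls g \<otimes>\<^bsub>?Q\<^esub> V) = B (?cls (alg_op g) \<otimes>\<^bsub>?Q\<^esub> U) V" unfolding B_def by simp
  qed
  have main: "let xae = right_act l n \<delta> m (x \<otimes>\<^bsub>?Q\<^esub> a_elem l n \<delta> m) e;
        yae = right_act l n \<delta> m (y \<otimes>\<^bsub>?Q\<^esub> a_elem l n \<delta> m) e in
      quot_op xae \<otimes>\<^bsub>?Q\<^esub> yae = left_act l n \<delta> m (galg_op e)
        (right_act l n \<delta> m (a_elem l n \<delta> m \<otimes>\<^bsub>?Q\<^esub> quot_op x \<otimes>\<^bsub>?Q\<^esub> y \<otimes>\<^bsub>?Q\<^esub> a_elem l n \<delta> m) e) \<and>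
      quot_op xae \<otimes>\<^bsub>?Q\<^esub> yae = B xae yae \<odot>\<^bsub>?Q\<^esub> right_act l n \<delta> m (a_elem l n \<delta> m) e \<and>
      (\<forall>c. quot_op xae \<otimes>\<^bsub>?Q\<^esub> yae = c \<odot>\<^bsub>?Q\<^esub> right_act l n \<delta> m (a_elem l n \<delta> m) e \<longrightarrow> c = B xae yae)"
    if xy: "x \<in> carrier ?Q" "y \<in> carrier ?Q" for x y
  proof -
    obtain f g where f: "x = ?cls f" "f \<in> ?T" and g: "y = ?cls g" "g \<in> ?T"
      using xy unfolding carrier_quot[OF l m] by blast
    have xa: "right_act l n \<delta> m (x \<otimes>\<^bsub>?Q\<^esub> a_elem l n \<delta> m) e = ?cls (f \<star> ?av \<star> E)"
      "right_act l n \<delta> m (y \<otimes>\<^bsub>?Q\<^esub> a_elem l n \<delta> m) e = ?cls (g \<star> ?av \<star> E)"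
      by (simp_all add: f(1) g(1) a_elem_def mq ract)
    have inS: "?cls (f \<star> ?av \<star> E) \<in> ?S" "?cls (g \<star> ?av \<star> E) \<in> ?S"
      unfolding S using f(2) g(2) by auto
    have "right_act l n \<delta> m (a_elem l n \<delta> m \<otimes>\<^bsub>?Q\<^esub> quot_op x \<otimes>\<^bsub>?Q\<^esub> y \<otimes>\<^bsub>?Q\<^esub> a_elem l n \<delta> m) e =
        ?cls (?av \<star> (alg_op f \<star> (g \<star> (?av \<star> E))))"
      using ract[of "?av \<star> alg_op f \<star> g"] by (simp add: f(1) g(1) a_elem_def oq mq assoc)
    then have "left_act l n \<delta> m (galg_op e)
        (right_act l n \<delta> m (a_elem l n \<delta> m \<otimes>\<^bsub>?Q\<^esub> quot_op x \<otimes>\<^bsub>?Q\<^esub> y \<otimes>\<^bsub>?Q\<^esub> a_elem l n \<delta> m) e) =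
      ?cls (E \<star> (?av \<star> (alg_op f \<star> (g \<star> (?av \<star> E)))))"
      unfolding eop E_def mul_def by (simp add: left_act_class[OF l m])
    moreover have "quot_op (?cls (f \<star> ?av \<star> E)) \<otimes>\<^bsub>?Q\<^esub> ?cls (g \<star> ?av \<star> E) =
        ?cls (E \<star> (?av \<star> (alg_op f \<star> (g \<star> (?av \<star> E)))))"
      by (simp add: oq mq opm opa Eop assoc)
    ultimately show ?thesis
      unfolding Let_def xa ract_a using B[OF inS] B_eqI by metis
  qed
  show ?thesis
    unfolding Let_def[of ?Q] Let_def[of "a_elem l n \<delta> m"] Let_def[of "right_act l n \<delta> m"]
      Let_def[of "left_act l n \<delta> m"]
    using contra main by blast
qed

end
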